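(* Let $G$ be a Cohen-Macaulay forest. Then $R/I(G)^{[k]}$ is Cohen-Macaulay for all integers $k\ge 1$.
   Context: All graphs are finite and simple. Fix a field $\mathbb{K}$. For a graph $G$ with vertex set $V(G)$ (vertices are identified with indeterminates), $R=\mathbb{K}[x\mid x\in V(G)]$ and $I(G)=\langle xy\mid \{x,y\}\in E(G)\rangle\subseteq R$ is the edge ideal. A $k$-matching of $G$ is a set of $k$ pairwise disjoint edges; $\nu(G)$ is the maximum cardinality of a matching. The $k$-th square-free power $I(G)^{[k]}$ is the ideal of $R$ generated by the square-free monomials of $I(G)^k$; equivalently it is generated by the products $\prod_{x\in \bigcup_{e\in M}e}x$ over all $k$-matchings $M$ of $G$ (so it is the zero ideal if $k>\nu(G)$). A forest is a graph with no cycles. For a graded ideal $J\subseteq R$, $R/J$ is Cohen-Macaulay if $\operatorname{depth}(R/J)=\dim (R/J)$; the graph $G$ is called Cohen-Macaulay if $R/I(G)$ is Cohen-Macaulay. *)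

theory Defs
  imports
    "HOL-Algebra.QuotRing"
    "HOL-Algebra.Ideal_Product"
    "HOL-Library.Poly_Mapping"
    "HOL-Library.Extended_Nat"
begin

section \<open>Finite simple graphs and forests\<close>

definition simple_graph :: "'v set \<Rightarrow> 'v set set \<Rightarrow> bool" where
  "simple_graph V E \<longleftrightarrow>
     finite V \<and> (\<forall>e\<in>E. \<exists>x\<in>V. \<exists>y\<in>V. x \<noteq> y \<and> e = {x, y})"

definition cycle_of :: "'v set set \<Rightarrow> 'v list \<Rightarrow> bool" where
  "cycle_of E xs \<longleftrightarrow>
     length xs \<ge> 3 \<and> distinct xs \<and>
     (\<forall>i < length xs. {xs ! i, xs ! (Suc i mod length xs)} \<in> E)"

definition forest :: "'v set \<Rightarrow> 'v set set \<Rightarrow> bool" where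
  "forest V E \<longleftrightarrow> simple_graph V E \<and> (\<nexists>xs. cycle_of E xs)"


section \<open>Dimension and depth of commutative rings\<close>

definition krull_dim :: "('a, 'b) ring_scheme \<Rightarrow> enat" where
  "krull_dim A = Sup {enat n | n.
     \<exists>P. (\<forall>i\<le>n. primeideal (P i) A) \<and> (\<forall>i<n. P i \<subset> P (Suc i))}"

definition regular_sequence :: "('a, 'b) ring_scheme \<Rightarrow> 'a list \<Rightarrow> bool" where
  "regular_sequence A xs \<longleftrightarrow>
     set xs \<subseteq> carrier A \<and>
     (\<forall>i < length xs. \<forall>a \<in> carrier A.
        xs ! i \<otimes>\<^bsub>A\<^esub> a \<in> Idl\<^bsub>A\<^esub> (set (take i xs)) \<longrightarrow> a \<in> Idl\<^bsub>A\<^esub> (set (take i xs))) \<and>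
     Idl\<^bsub>A\<^esub> (set xs) \<noteq> carrier A"

definition depth_at :: "('a, 'b) ring_scheme \<Rightarrow> 'a set \<Rightarrow> enat" where
  "depth_at A M = Sup {enat (length xs) | xs. regular_sequence A xs \<and> set xs \<subseteq> M}"


section \<open>Polynomial rings and their graded quotients\<close>

text \<open>A polynomial is a finitely supported map from exponent vectors to coefficients;
  multiplication in this type is convolution.\<close>

type_synonym ('v, 'k) mpoly = "('v \<Rightarrow>\<^sub>0 nat) \<Rightarrow>\<^sub>0 'k"

definition Var :: "'v \<Rightarrow> ('v, 'k::field) mpoly" where
  "Var x = Poly_Mapping.single (Poly_Mapping.single x 1) 1"

definition poly_ring :: "'v set \<Rightarrow> ('v, 'k::field) mpoly ring" where
  "poly_ring V =
     \<lparr>carrier = {p. \<forall>a \<in> Poly_Mapping.keys p. Poly_Mapping.keys a \<subseteq> V},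
      monoid.mult = (*), one = 1, zero = 0, add = (+)\<rparr>"

definition irrelevant_ideal :: "'v set \<Rightarrow> ('v, 'k::field) mpoly set" where
  "irrelevant_ideal V = Idl\<^bsub>poly_ring V\<^esub> (Var ` V)"

text \<open>The depth of \<open>R/J\<close> is taken with respect to the graded maximal ideal. The submodules of
  \<open>R/J\<close> generated by elements of \<open>R\<close> are the ideals generated by their residue classes, so
  \<open>R/J\<close>-regular sequences in the graded maximal ideal of \<open>R\<close> correspond to regular sequences of
  the ring \<open>R/J\<close> lying in the image of that ideal.\<close>

definition cohen_macaulay_quotient :: "'v set \<Rightarrow> ('v, 'k::field) mpoly set \<Rightarrow> bool" where
  "cohen_macaulay_quotient V J \<longleftrightarrow>
     depth_at (poly_ring V Quot J) ((\<lambda>f. J +>\<^bsub>poly_ring V\<^esub> f) ` irrelevant_ideal V)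
       = krull_dim (poly_ring V Quot J)"


section \<open>Edge ideals and square-free powers\<close>

definition edge_ideal :: "'v set \<Rightarrow> 'v set set \<Rightarrow> ('v, 'k::field) mpoly set" where
  "edge_ideal V E = Idl\<^bsub>poly_ring V\<^esub> {Var x * Var y | x y. {x, y} \<in> E}"

definition squarefree_monomial :: "('v, 'k::field) mpoly \<Rightarrow> bool" where
  "squarefree_monomial p \<longleftrightarrow>
     (\<exists>a. p = Poly_Mapping.single a 1 \<and> (\<forall>x. Poly_Mapping.lookup a x \<le> 1))"

text \<open>\<^const>\<open>ideals_set\<close> is the semiring of ideals, so the exponent below is the ordinary
  power of an ideal.\<close>

definition squarefree_power ::
    "'v set \<Rightarrow> ('v, 'k::field) mpoly set \<Rightarrow> nat \<Rightarrow> ('v, 'k) mpoly set" where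
  "squarefree_power V I k =
     Idl\<^bsub>poly_ring V\<^esub>
       {p \<in> I [^]\<^bsub>ideals_set (poly_ring V)\<^esub> k. squarefree_monomial p}"

text \<open>The coefficient field is the type \<open>'k\<close>; it does not occur in the graph, so it is
  passed explicitly.\<close>

definition cohen_macaulay_graph :: "'k::field itself \<Rightarrow> 'v set \<Rightarrow> 'v set set \<Rightarrow> bool" where
  "cohen_macaulay_graph _ V E \<longleftrightarrow>
     cohen_macaulay_quotient V (edge_ideal V E :: ('v, 'k) mpoly set)"

end

theory Submission
  imports Defs
begin

text \<open>A squarefree monomial ideal \<open>J\<close> is described by the upward closed family \<open>\<Phi>\<close> of supports of its
  monomials, so that the faces are the sets violating \<open>\<Phi>\<close>. Koszul cohomology bounds the depth of
  \<open>R/J\<close> by the size of every facet, while the Krull dimension is the size of the largest face.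
  Hence a Cohen--Macaulay forest is well-covered, and a well-covered forest consists of isolated
  vertices and of a forest on a set \<open>X\<close> with one whisker \<open>{x, y x}\<close> attached to every \<open>x \<in> X\<close>.

  For such a graph and \<open>k \<le> |X| + 1\<close>, a set without a \<open>k\<close>-matching contains at most \<open>k - 1\<close> of the pairs
  \<open>{x, y x}\<close>, so it has at most \<open>k - 1 + |V| - |X|\<close> elements. This number of explicit parameters is
  regular modulo \<open>I(G)\<^sup>[\<^sup>k\<^sup>]\<close>: the elementary symmetric polynomials of degrees \<open>k - 1, \<dots>, 1\<close> in the products
  \<open>x \<cdot> y x\<close>, the sums \<open>x + y x\<close>, and the isolated vertices. Indeed, passing repeatedly from an ideal \<open>I\<close>
  to \<open>I : v\<close> and \<open>I + (v)\<close> for a leaf \<open>v\<close> of the base forest and its whisker leads to ideals generated by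
  variables, where regularity is clear, and regularity modulo both of them implies regularity modulo \<open>I\<close>.\<close>

section \<open>Ideals of polynomial rings\<close>

text \<open>Depth is defined by regular sequences, and regular sequences of \<open>R/(I:v)\<close>
  and of \<open>R/(I+(v))\<close> need not have anything to do with each other. The obstacle
  disappears if one sequence, fixed in advance, is carried through all ideals that occur. It must
  then serve every final ideal. A proper final ideal is generated by variables, at most one from
  each pair, and leaves exactly \<open>r = k - 1\<close> pairs untouched; which pairs remain depends
  on the branch. Hence the parameters are symmetric in the pairs. Modulo such an ideal the symmetric
  polynomial of degree \<open>r\<close> becomes one monomial, the product of all variables in the
  untouched pairs, and killing any of these variables leaves \<open>r - 1\<close> untouched pairs.
  Hence the degrees descend. Being explicit, the sequence exists over every field, including finite
  ones, where general linear forms may be missing. Koszul cohomology enters only in the upper bound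
  of the depth; the Krull dimension is found directly from chains of primes.\<close>

abbreviation vpoly :: "'v set \<Rightarrow> ('v, 'k::field) mpoly set" where
  "vpoly V \<equiv> carrier (poly_ring V)"

abbreviation supp :: "('v \<Rightarrow>\<^sub>0 nat) \<Rightarrow> 'v set" where
  "supp \<equiv> Poly_Mapping.keys"

lemma poly_ring_simps [simp]:
  "x \<otimes>\<^bsub>poly_ring V\<^esub> y = x * y" "x \<oplus>\<^bsub>poly_ring V\<^esub> y = x + y"
  "\<one>\<^bsub>poly_ring V\<^esub> = 1" "\<zero>\<^bsub>poly_ring V\<^esub> = 0"
  by (simp_all add: poly_ring_def)

lemma vpoly_iff: "p \<in> vpoly V \<longleftrightarrow> (\<forall>a\<in>Poly_Mapping.keys p. supp a \<subseteq> V)"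
  by (simp add: poly_ring_def)

lemma supp_add: "supp (a + b) = supp a \<union> supp b"
  by (auto simp: in_keys_iff lookup_add)

lemma keys_mult_cases:
  fixes p q :: "('v, 'k::field) mpoly"
  assumes "c \<in> Poly_Mapping.keys (p * q)"
  obtains a b where "a \<in> Poly_Mapping.keys p" "b \<in> Poly_Mapping.keys q" "c = a + b"
  using assms keys_mult[of p q] by blast

lemma keys_add_cases:
  assumes "c \<in> Poly_Mapping.keys (p + q)"
  shows "c \<in> Poly_Mapping.keys p \<or> c \<in> Poly_Mapping.keys q"
  using assms keys_add[of p q] by blast

lemma vpoly_closed [simp, intro]:
  fixes p q :: "('v, 'k::field) mpoly"
  shows "0 \<in> vpoly V" "1 \<in> vpoly V"
    "p \<in> vpoly V \<Longrightarrow> q \<in> vpoly V \<Longrightarrow> p + q \<in> vpoly V"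
    "p \<in> vpoly V \<Longrightarrow> q \<in> vpoly V \<Longrightarrow> p * q \<in> vpoly V"
    "p \<in> vpoly V \<Longrightarrow> - p \<in> vpoly V"
    "p \<in> vpoly V \<Longrightarrow> q \<in> vpoly V \<Longrightarrow> p - q \<in> vpoly V"
proof -
  show add: "p \<in> vpoly V \<Longrightarrow> q \<in> vpoly V \<Longrightarrow> p + q \<in> vpoly V" for p q :: "('v, 'k) mpoly"
    by (auto simp: vpoly_iff dest!: keys_add_cases)
  show "p \<in> vpoly V \<Longrightarrow> q \<in> vpoly V \<Longrightarrow> p * q \<in> vpoly V"
    by (fastforce simp: vpoly_iff supp_add elim!: keys_mult_cases)
  show neg: "p \<in> vpoly V \<Longrightarrow> - p \<in> vpoly V" for p :: "('v, 'k) mpoly"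
    by (auto simp: vpoly_iff in_keys_iff)
  show "p \<in> vpoly V \<Longrightarrow> q \<in> vpoly V \<Longrightarrow> p - q \<in> vpoly V"
    using add[of p "- q"] neg[of q] by simp
qed (auto simp: vpoly_iff)

lemma vpoly_sum: "(\<And>i. i \<in> A \<Longrightarrow> f i \<in> vpoly V) \<Longrightarrow> sum f A \<in> vpoly V"
  by (induction A rule: infinite_finite_induct) auto

lemma vpoly_power: "p \<in> vpoly V \<Longrightarrow> p ^ n \<in> vpoly V"
  by (induction n) auto

lemma vpoly_single: "supp a \<subseteq> V \<Longrightarrow> Poly_Mapping.single a c \<in> vpoly V"
  by (auto simp: vpoly_iff split: if_splits)

lemma vpoly_Var [simp, intro]: "v \<in> V \<Longrightarrow> Var v \<in> vpoly V"
  by (simp add: Var_def vpoly_single)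

lemma cring_poly_ring: "cring (poly_ring V :: ('v, 'k::field) mpoly ring)"
proof (rule cringI)
  show "abelian_group (poly_ring V :: ('v, 'k) mpoly ring)"
    by (rule abelian_groupI) (auto simp: algebra_simps intro: bexI[of _ "- x" for x])
  show "Group.comm_monoid (poly_ring V :: ('v, 'k) mpoly ring)"
    by (rule comm_monoidI) (auto simp: algebra_simps)
qed (auto simp: algebra_simps)

text \<open>Ideals of \<open>poly_ring V\<close> described elementwise with the operations of the
  polynomial type; negatives come from the scalar \<open>- 1\<close>.\<close>

definition pideal :: "'v set \<Rightarrow> ('v, 'k::field) mpoly set \<Rightarrow> bool" where
  "pideal V I \<longleftrightarrow> I \<subseteq> vpoly V \<and> 0 \<in> I \<and> (\<forall>a\<in>I. \<forall>b\<in>I. a + b \<in> I) \<and>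
     (\<forall>r\<in>vpoly V. \<forall>a\<in>I. r * a \<in> I)"

lemma pidealD:
  assumes "pideal V I"
  shows "a \<in> I \<Longrightarrow> a \<in> vpoly V" "0 \<in> I" "a \<in> I \<Longrightarrow> b \<in> I \<Longrightarrow> a + b \<in> I"
    "r \<in> vpoly V \<Longrightarrow> a \<in> I \<Longrightarrow> r * a \<in> I"
    "r \<in> vpoly V \<Longrightarrow> a \<in> I \<Longrightarrow> a * r \<in> I"
    "a \<in> I \<Longrightarrow> - a \<in> I" "a \<in> I \<Longrightarrow> b \<in> I \<Longrightarrow> a - b \<in> I"
proof -
  show mult: "r \<in> vpoly V \<Longrightarrow> a \<in> I \<Longrightarrow> r * a \<in> I" for a r
    using assms by (auto simp: pideal_def)
  show "r \<in> vpoly V \<Longrightarrow> a \<in> I \<Longrightarrow> a * r \<in> I"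
    using mult[of r a] by (simp add: mult.commute)
  show add: "a \<in> I \<Longrightarrow> b \<in> I \<Longrightarrow> a + b \<in> I" for a b
    using assms by (auto simp: pideal_def)
  show neg: "a \<in> I \<Longrightarrow> - a \<in> I" for a
    using mult[of "- 1" a] by auto
  show "a \<in> I \<Longrightarrow> b \<in> I \<Longrightarrow> a - b \<in> I"
    using add[of a "- b"] neg[of b] by simp
qed (use assms in \<open>auto simp: pideal_def\<close>)

lemma pideal_sum: "pideal V I \<Longrightarrow> (\<And>i. i \<in> A \<Longrightarrow> f i \<in> I) \<Longrightarrow> sum f A \<in> I"
  by (induction A rule: infinite_finite_induct) (auto simp: pidealD)

lemma pideal_carrier: "pideal V (vpoly V)"
  by (auto simp: pideal_def)

lemma pideal_congD:
  assumes "pideal V I" "a - b \<in> I"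
  shows "a \<in> I \<longleftrightarrow> b \<in> I"
  using pidealD(3)[OF assms(1), of "a - b" b] pidealD(7)[OF assms(1), of a "a - b"] assms by auto

lemma pideal_iff_ideal:
  fixes I :: "('v, 'k::field) mpoly set"
  shows "pideal V I \<longleftrightarrow> ideal I (poly_ring V)"
proof
  interpret R: cring "poly_ring V :: ('v, 'k) mpoly ring" by (rule cring_poly_ring)
  assume I: "pideal V I"
  show "ideal I (poly_ring V)"
  proof (rule idealI)
    show "subgroup I (add_monoid (poly_ring V))"
    proof (rule subgroup.intro)
      show "inv\<^bsub>add_monoid (poly_ring V)\<^esub> a \<in> I" if "a \<in> I" for a
        using that pidealD[OF I] R.minus_equality[of "- a" a] by (auto simp: a_inv_def)
    qed (use pidealD(1-3)[OF I] in auto)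
  qed (use pidealD(1,4,5)[OF I] R.ring_axioms in auto)
next
  assume "ideal I (poly_ring V)"
  then interpret I: ideal I "poly_ring V" .
  show "pideal V I"
    unfolding pideal_def
  proof (intro conjI ballI)
    show "I \<subseteq> vpoly V" by (rule I.a_subset)
    show "0 \<in> I" using additive_subgroup.zero_closed[OF ideal.axioms(1)[OF I.is_ideal]] unfolding poly_ring_simps .
    show "a + b \<in> I" if "a \<in> I" "b \<in> I" for a b
      using additive_subgroup.a_closed[OF ideal.axioms(1)[OF I.is_ideal] that] unfolding poly_ring_simps .
    show "r * a \<in> I" if "r \<in> vpoly V" "a \<in> I" for a r
      using I.I_l_closed[OF that(2,1)] unfolding poly_ring_simps .
  qed
qed

lemma pideal_Idl: "S \<subseteq> vpoly V \<Longrightarrow> pideal V (Idl\<^bsub>poly_ring V\<^esub> S)"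
  unfolding pideal_iff_ideal
  by (rule ring.genideal_ideal[OF cring.axioms(1)[OF cring_poly_ring]])

lemma Idl_subset: "pideal V I \<Longrightarrow> S \<subseteq> I \<Longrightarrow> Idl\<^bsub>poly_ring V\<^esub> S \<subseteq> I"
  unfolding pideal_iff_ideal
  by (rule ring.genideal_minimal[OF cring.axioms(1)[OF cring_poly_ring]])

lemma Idl_self: "S \<subseteq> vpoly V \<Longrightarrow> S \<subseteq> Idl\<^bsub>poly_ring V\<^esub> S"
  by (rule ring.genideal_self[OF cring.axioms(1)[OF cring_poly_ring]])

section \<open>Squarefree monomial ideals\<close>

lemma poly_eq_sum_single: "p = (\<Sum>a\<in>Poly_Mapping.keys p. Poly_Mapping.single a (Poly_Mapping.lookup p a))"
proof (rule poly_mapping_eqI)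
  fix b
  have "(\<Sum>a\<in>Poly_Mapping.keys p. Poly_Mapping.lookup (Poly_Mapping.single a (Poly_Mapping.lookup p a)) b)
      = (\<Sum>a\<in>Poly_Mapping.keys p. if b = a then Poly_Mapping.lookup p a else 0)"
    by (intro sum.cong) (auto simp: lookup_single when_def)
  thus "Poly_Mapping.lookup p b = Poly_Mapping.lookup
      (\<Sum>a\<in>Poly_Mapping.keys p. Poly_Mapping.single a (Poly_Mapping.lookup p a)) b"
    by (auto simp: lookup_sum in_keys_iff)
qed

lemma lookup_single_mult:
  fixes p :: "('v, 'k::field) mpoly"
  shows "Poly_Mapping.lookup (Poly_Mapping.single c k * p) (c + a) = k * Poly_Mapping.lookup p a"
proof -
  have "Poly_Mapping.lookup (Poly_Mapping.single c k * p) (c + a) =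
     (\<Sum>l. (k when c = l) * (\<Sum>q. Poly_Mapping.lookup p q when c + a = l + q))"
    by (simp add: lookup_mult lookup_single)
  also have "\<dots> = (\<Sum>l. (k * Poly_Mapping.lookup p a) when l = c)"
    by (rule Sum_any.cong) (auto simp: when_def)
  finally show ?thesis by simp
qed

lemma keys_single_mult:
  fixes p :: "('v, 'k::field) mpoly"
  assumes "k \<noteq> 0"
  shows "Poly_Mapping.keys (Poly_Mapping.single c k * p) = (+) c ` Poly_Mapping.keys p"
proof
  show "Poly_Mapping.keys (Poly_Mapping.single c k * p) \<subseteq> (+) c ` Poly_Mapping.keys p"
    by (auto elim!: keys_mult_cases split: if_splits)
  show "(+) c ` Poly_Mapping.keys p \<subseteq> Poly_Mapping.keys (Poly_Mapping.single c k * p)"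
    using assms by (auto simp: in_keys_iff lookup_single_mult)
qed

definition indic :: "'v set \<Rightarrow> 'v \<Rightarrow>\<^sub>0 nat" where
  "indic W = (\<Sum>v\<in>W. Poly_Mapping.single v 1)"

definition xmon :: "'v set \<Rightarrow> ('v, 'k::field) mpoly" where
  "xmon W = Poly_Mapping.single (indic W) 1"

lemma lookup_indic: "finite W \<Longrightarrow> Poly_Mapping.lookup (indic W) v = (if v \<in> W then 1 else 0)"
  by (simp add: indic_def lookup_sum lookup_single when_def)

lemma supp_indic [simp]: "finite W \<Longrightarrow> supp (indic W) = W"
  by (auto simp: in_keys_iff lookup_indic split: if_splits)

lemma vpoly_xmon [simp]: "finite W \<Longrightarrow> W \<subseteq> V \<Longrightarrow> xmon W \<in> vpoly V"
  by (simp add: xmon_def vpoly_single)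

lemma Var_eq_xmon: "Var v = xmon {v}"
  by (simp add: Var_def xmon_def indic_def)

lemma xmon_Un: "finite A \<Longrightarrow> finite B \<Longrightarrow> A \<inter> B = {} \<Longrightarrow> xmon (A \<union> B) = xmon A * xmon B"
  by (simp add: xmon_def mult_single indic_def sum.union_disjoint)

lemma xmon_empty [simp]: "xmon {} = 1"
  by (simp add: xmon_def indic_def)

lemma single_factor_xmon:
  assumes "finite W" "W \<subseteq> supp a"
  shows "Poly_Mapping.single a k = xmon W * Poly_Mapping.single (a - indic W) k"
proof -
  have "indic W + (a - indic W) = a"
    using assms
    by (intro poly_mapping_eqI) (auto simp: lookup_add lookup_minus lookup_indic in_keys_iff)
  thus ?thesis by (simp add: xmon_def mult_single)
qed

text \<open>For upward closed \<open>\<Phi>\<close> this is the Stanley-Reisner ideal of the complex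
  of subsets of \<open>V\<close> violating \<open>\<Phi>\<close>. Encoding it by a predicate makes
  the colon ideal by a squarefree monomial a substitution into \<open>\<Phi>\<close> and the
  addition of such a monomial a disjunction, so no generators have to be tracked.\<close>

definition sqideal :: "'v set \<Rightarrow> ('v set \<Rightarrow> bool) \<Rightarrow> ('v, 'k::field) mpoly set" where
  "sqideal V \<Phi> = {p \<in> vpoly V. \<forall>a\<in>Poly_Mapping.keys p. \<Phi> (supp a)}"

lemma pideal_sqideal:
  assumes "mono \<Phi>"
  shows "pideal V (sqideal V \<Phi> :: ('v, 'k::field) mpoly set)"
proof -
  have "\<Phi> (supp a \<union> supp b)" if "\<Phi> (supp b)" for a b :: "'v \<Rightarrow>\<^sub>0 nat"
    using monoD[OF assms, of "supp b" "supp a \<union> supp b"] that by auto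
  thus ?thesis
    unfolding pideal_def sqideal_def
    by (auto dest!: keys_add_cases elim!: keys_mult_cases simp: supp_add)
qed

lemma sqideal_mono: "(\<And>S. S \<subseteq> V \<Longrightarrow> \<Phi> S \<Longrightarrow> \<Psi> S) \<Longrightarrow> sqideal V \<Phi> \<subseteq> sqideal V \<Psi>"
  by (auto simp: sqideal_def vpoly_iff)

lemma sqideal_cong: "(\<And>S. S \<subseteq> V \<Longrightarrow> \<Phi> S = \<Psi> S) \<Longrightarrow> sqideal V \<Phi> = sqideal V \<Psi>"
  by (intro equalityI sqideal_mono) auto

lemma sqideal_subset:
  fixes I :: "('v, 'k::field) mpoly set"
  assumes I: "pideal V I"
    and mon: "\<And>a c. supp a \<subseteq> V \<Longrightarrow> \<Phi> (supp a) \<Longrightarrow> Poly_Mapping.single a c \<in> I"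
  shows "sqideal V \<Phi> \<subseteq> I"
proof
  fix p :: "('v, 'k) mpoly" assume p: "p \<in> sqideal V \<Phi>"
  have "(\<Sum>a\<in>Poly_Mapping.keys p. Poly_Mapping.single a (Poly_Mapping.lookup p a)) \<in> I"
    by (rule pideal_sum[OF I], rule mon) (use p in \<open>auto simp: sqideal_def vpoly_iff\<close>)
  thus "p \<in> I" by (metis poly_eq_sum_single)
qed

lemma xmon_in_sqideal: "finite W \<Longrightarrow> W \<subseteq> V \<Longrightarrow> xmon W \<in> sqideal V \<Phi> \<longleftrightarrow> \<Phi> W"
  by (auto simp: sqideal_def) (auto simp: xmon_def)

lemma one_in_sqideal: "1 \<in> sqideal V \<Phi> \<longleftrightarrow> \<Phi> {}"
  using xmon_in_sqideal[of "{}" V \<Phi>] by simp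

text \<open>Multiplication by a monomial shifts the exponents injectively, so no terms cancel and
  each support grows by exactly \<open>W\<close>. This computes the colon ideal.\<close>

lemma xmon_mult_in_sqideal:
  assumes "finite W" "W \<subseteq> V" "p \<in> vpoly V"
  shows "xmon W * p \<in> sqideal V \<Phi> \<longleftrightarrow> p \<in> sqideal V (\<lambda>S. \<Phi> (W \<union> S))"
  using assms
  by (simp add: sqideal_def) (simp add: xmon_def keys_single_mult supp_add)

section \<open>Adding an element to an ideal, regular sequences\<close>

definition iadd :: "'v set \<Rightarrow> ('v, 'k::field) mpoly set \<Rightarrow> ('v, 'k) mpoly \<Rightarrow> ('v, 'k) mpoly set" where
  "iadd V I f = {i + f * b | i b. i \<in> I \<and> b \<in> vpoly V}"

lemma iaddE:
  assumes "p \<in> iadd V I f"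
  obtains i b where "i \<in> I" "b \<in> vpoly V" "p = i + f * b"
  using assms by (auto simp: iadd_def)

lemma iaddI: "i \<in> I \<Longrightarrow> b \<in> vpoly V \<Longrightarrow> i + f * b \<in> iadd V I f"
  by (auto simp: iadd_def)

lemma pideal_iadd:
  assumes I: "pideal V I" and f: "f \<in> vpoly V"
  shows "pideal V (iadd V I f)"
  unfolding pideal_def
proof (intro conjI ballI subsetI)
  show "p \<in> vpoly V" if "p \<in> iadd V I f" for p
    using that f pidealD[OF I] by (auto elim!: iaddE)
  show "0 \<in> iadd V I f" using iaddI[of 0 I 0] pidealD[OF I] by auto
  show "p + q \<in> iadd V I f" if "p \<in> iadd V I f" "q \<in> iadd V I f" for p q
  proof -
    from that obtain i b i' b' where *: "i \<in> I" "b \<in> vpoly V" "p = i + f * b"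
      "i' \<in> I" "b' \<in> vpoly V" "q = i' + f * b'" by (metis iaddE)
    hence eq: "p + q = (i + i') + f * (b + b')" by (simp add: algebra_simps)
    show ?thesis unfolding eq using * pidealD(3)[OF I] by (intro iaddI) auto
  qed
  show "r * p \<in> iadd V I f" if "r \<in> vpoly V" "p \<in> iadd V I f" for r p
  proof -
    from that obtain i b where *: "i \<in> I" "b \<in> vpoly V" "p = i + f * b" by (metis iaddE)
    hence eq: "r * p = r * i + f * (r * b)" by (simp add: algebra_simps)
    show ?thesis unfolding eq using * that pidealD(4)[OF I] by (intro iaddI) auto
  qed
qed

lemma iadd_superset: "I \<subseteq> iadd V I f"
  using iaddI[of _ I 0] by fastforce

lemma iadd_self: "pideal V I \<Longrightarrow> f \<in> iadd V I f"
  using iaddI[of 0 I 1 V f] by (simp add: pidealD)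

lemma iadd_least: "pideal V K \<Longrightarrow> I \<subseteq> K \<Longrightarrow> f \<in> K \<Longrightarrow> iadd V I f \<subseteq> K"
  by (auto elim!: iaddE intro!: pidealD(3,5))

text \<open>Lets a parameter be replaced by a monomial congruent to it, after which the enlarged
  ideal is again a squarefree monomial ideal.\<close>

lemma iadd_cong:
  assumes I: "pideal V I" and f: "f \<in> vpoly V" "f' \<in> vpoly V" and d: "f - f' \<in> I"
  shows "iadd V I f = iadd V I f'"
proof -
  have "iadd V I f \<subseteq> iadd V I f'" if "f - f' \<in> I" "f' \<in> vpoly V" for f f'
  proof (rule iadd_least[OF pideal_iadd[OF I] iadd_superset])
    have "(f - f') + f' * 1 \<in> iadd V I f'" using that by (intro iaddI) auto
    thus "f \<in> iadd V I f'" by simp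
  qed (use that in auto)
  from this[of f f'] this[of f' f] show ?thesis
    using f d pidealD(6)[OF I d] by auto
qed

fun iadds :: "'v set \<Rightarrow> ('v, 'k::field) mpoly set \<Rightarrow> ('v, 'k) mpoly list \<Rightarrow> ('v, 'k) mpoly set" where
  "iadds V I [] = I"
| "iadds V I (f # fs) = iadds V (iadd V I f) fs"

lemma pideal_iadds: "pideal V I \<Longrightarrow> set fs \<subseteq> vpoly V \<Longrightarrow> pideal V (iadds V I fs)"
  by (induction fs arbitrary: I) (auto simp: pideal_iadd)

lemma iadds_superset: "I \<subseteq> iadds V I fs"
  by (induction fs arbitrary: I) (use iadd_superset in force)+

lemma iadds_gens: "pideal V I \<Longrightarrow> set fs \<subseteq> vpoly V \<Longrightarrow> set fs \<subseteq> iadds V I fs"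
proof (induction fs arbitrary: I)
  case (Cons f fs)
  have "f \<in> iadds V (iadd V I f) fs"
    using iadds_superset iadd_self[OF Cons.prems(1)] by blast
  moreover have "set fs \<subseteq> iadds V (iadd V I f) fs"
    using Cons.prems by (intro Cons.IH) (auto simp: pideal_iadd)
  ultimately show ?case by simp
qed simp

lemma iadds_least: "pideal V K \<Longrightarrow> I \<subseteq> K \<Longrightarrow> set fs \<subseteq> K \<Longrightarrow> iadds V I fs \<subseteq> K"
proof (induction fs arbitrary: I)
  case (Cons f fs)
  show ?case using Cons.prems iadd_least[of V K I f]
    by (simp, intro Cons.IH) auto
qed simp

text \<open>Properness of the final ideal is left out because the unit ideal arises in the
  splittings and has to accept every sequence; it returns in
  \<open>regular_sequence_Quot_iff\<close>.\<close>

fun regs :: "'v set \<Rightarrow> ('v, 'k::field) mpoly set \<Rightarrow> ('v, 'k) mpoly list \<Rightarrow> bool" where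
  "regs V I [] \<longleftrightarrow> True"
| "regs V I (f # fs) \<longleftrightarrow> (\<forall>a\<in>vpoly V. f * a \<in> I \<longrightarrow> a \<in> I) \<and> regs V (iadd V I f) fs"

lemma regs_iff_nth:
  "regs V I fs \<longleftrightarrow> (\<forall>i<length fs. \<forall>a\<in>vpoly V.
     fs ! i * a \<in> iadds V I (take i fs) \<longrightarrow> a \<in> iadds V I (take i fs))"
proof (induction fs arbitrary: I)
  case (Cons f fs)
  show ?case
    by (simp add: Cons.IH All_less_Suc2)
qed simp

lemma regs_carrier: "set fs \<subseteq> vpoly V \<Longrightarrow> regs V (vpoly V) fs"
proof (induction fs)
  case (Cons f fs)
  have "iadd V (vpoly V) f = vpoly V"
    using Cons.prems iadd_superset[of "vpoly V" V f] pidealD(1)[OF pideal_iadd[OF pideal_carrier]]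
    by auto
  thus ?case using Cons by simp
qed simp

text \<open>The ideal-theoretic form of the depth lemma for
  \<open>0 \<rightarrow> R/(I:f) \<rightarrow> R/I \<rightarrow> R/(I+f) \<rightarrow> 0\<close>, with one sequence serving all three modules.\<close>

lemma regs_colon_iadd:
  assumes "pideal V I" "f \<in> vpoly V" "set fs \<subseteq> vpoly V"
    and "regs V {a \<in> vpoly V. f * a \<in> I} fs" "regs V (iadd V I f) fs"
  shows "regs V I fs"
  using assms
proof (induction fs arbitrary: I)
  case (Cons s fs)
  note I = \<open>pideal V I\<close>
  define C where "C = {a \<in> vpoly V. f * a \<in> I}"
  have C: "pideal V C"
    unfolding C_def pideal_def
    using Cons.prems(2)
    by (auto simp: distrib_left mult.left_commute[of f] pidealD[OF I])
  have s: "s \<in> vpoly V" and f: "f \<in> vpoly V" using Cons.prems by auto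
  have nzC: "a \<in> C" if "a \<in> vpoly V" "s * a \<in> C" for a
    using that Cons.prems(4) by (auto simp: C_def)
  have nzA: "a \<in> iadd V I f" if "a \<in> vpoly V" "s * a \<in> iadd V I f" for a
    using that Cons.prems(5) by auto
  have key: "\<exists>i\<in>I. \<exists>b\<in>vpoly V. a = i + f * b" if "a \<in> vpoly V" "s * a \<in> iadd V I f" for a
    using nzA[OF that] by (auto elim!: iaddE)
  have nz: "a \<in> I" if a: "a \<in> vpoly V" "s * a \<in> I" for a
  proof -
    from key[of a] a iadd_superset[of I V f] obtain i b where ib: "i \<in> I" "b \<in> vpoly V" "a = i + f * b"
      by blast
    have "f * (s * b) = s * a - s * i" using ib by (simp add: algebra_simps)
    hence "s * b \<in> C" using ib s a pidealD[OF I] by (auto simp: C_def)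
    hence "b \<in> C" using nzC ib by blast
    thus ?thesis using ib pidealD[OF I] by (auto simp: C_def)
  qed
  \<comment> \<open>Taking the colon by \<open>f\<close> commutes with adding \<open>s\<close>
    because \<open>s\<close> is regular modulo \<open>I + (f)\<close>: from
    \<open>f * b = i + s * c\<close> it follows that \<open>c\<close> lies in
    \<open>I + (f)\<close>, and subtracting the \<open>f\<close>-part of \<open>c\<close> moves
    \<open>b\<close> into \<open>C\<close> up to a multiple of \<open>s\<close>.\<close>
  have colon: "{a \<in> vpoly V. f * a \<in> iadd V I s} = iadd V C s"
  proof (intro equalityI subsetI)
    fix b assume "b \<in> {a \<in> vpoly V. f * a \<in> iadd V I s}"
    then obtain i c where b: "b \<in> vpoly V" and ic: "i \<in> I" "c \<in> vpoly V" "f * b = i + s * c"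
      by (auto elim!: iaddE)
    have "s * c = - i + f * b" using ic by simp
    moreover have "- i + f * b \<in> iadd V I f" using ic b pidealD(6)[OF I] by (intro iaddI) auto
    ultimately have "s * c \<in> iadd V I f" by metis
    then obtain i' c' where c: "i' \<in> I" "c' \<in> vpoly V" "c = i' + f * c'" using key ic by blast
    have "f * (b - s * c') = i + s * i'" using ic c by (simp add: algebra_simps)
    hence "b - s * c' \<in> C" using ic b c s pidealD[OF I] by (auto simp: C_def)
    hence "(b - s * c') + s * c' \<in> iadd V C s" using c by (intro iaddI)
    thus "b \<in> iadd V C s" by simp
  next
    fix b assume "b \<in> iadd V C s"
    then obtain i c where ic: "i \<in> C" "c \<in> vpoly V" "b = i + s * c" by (auto elim!: iaddE)
    hence "f * b = f * i + s * (f * c)" by (simp add: algebra_simps)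
    thus "b \<in> {a \<in> vpoly V. f * a \<in> iadd V I s}"
      using ic s f by (auto simp: C_def iaddI)
  qed
  have swap: "iadd V (iadd V I s) f = iadd V (iadd V I f) s"
  proof -
    have "iadd V (iadd V I a) b \<subseteq> iadd V (iadd V I b) a" if "a \<in> vpoly V" "b \<in> vpoly V" for a b
    proof (rule iadd_least)
      show K: "pideal V (iadd V (iadd V I b) a)" using that I by (intro pideal_iadd)
      show "b \<in> iadd V (iadd V I b) a"
        using iadd_self[OF I] iadd_superset by blast
      show "iadd V I a \<subseteq> iadd V (iadd V I b) a"
        using iadd_superset[of I V b] iadd_superset[of "iadd V I b" V a]
          iadd_self[OF pideal_iadd[OF I that(2)]]
        by (intro iadd_least[OF K]) auto
    qed
    from this[OF s f] this[OF f s] show ?thesis by (rule equalityI)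
  qed
  have "regs V (iadd V I s) fs"
  proof (rule Cons.IH[OF pideal_iadd[OF I s] f])
    show "set fs \<subseteq> vpoly V" using Cons.prems(3) by simp
    show "regs V {a \<in> vpoly V. f * a \<in> iadd V I s} fs"
      unfolding colon C_def using Cons.prems(4) by simp
    show "regs V (iadd V (iadd V I s) f) fs"
      unfolding swap using Cons.prems(5) by simp
  qed
  thus ?case using nz by simp
qed simp

lemma iadd_sqideal_xmon:
  assumes "mono \<Phi>" "finite W" "W \<subseteq> V"
  shows "iadd V (sqideal V \<Phi>) (xmon W) = sqideal V (\<lambda>S. \<Phi> S \<or> W \<subseteq> S)"
proof
  have m: "mono (\<lambda>S. \<Phi> S \<or> W \<subseteq> S)"
    using assms(1) by (auto simp: mono_def)
  show "iadd V (sqideal V \<Phi>) (xmon W) \<subseteq> sqideal V (\<lambda>S. \<Phi> S \<or> W \<subseteq> S)"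
    using assms by (intro iadd_least pideal_sqideal[OF m] sqideal_mono) (auto simp: xmon_in_sqideal)
  show "sqideal V (\<lambda>S. \<Phi> S \<or> W \<subseteq> S) \<subseteq> iadd V (sqideal V \<Phi>) (xmon W)"
  proof (rule sqideal_subset)
    show "pideal V (iadd V (sqideal V \<Phi>) (xmon W))"
      using assms by (intro pideal_iadd pideal_sqideal) auto
    fix a c assume a: "supp a \<subseteq> V" "\<Phi> (supp a) \<or> W \<subseteq> supp a"
    show "Poly_Mapping.single a c \<in> iadd V (sqideal V \<Phi>) (xmon W)"
    proof (cases "\<Phi> (supp a)")
      case True
      hence "Poly_Mapping.single a c \<in> sqideal V \<Phi>"
        using a by (auto simp: sqideal_def vpoly_single)
      thus ?thesis using iadd_superset by blast
    next
      case False
      hence eq: "Poly_Mapping.single a c = 0 + xmon W * Poly_Mapping.single (a - indic W) c"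
        using single_factor_xmon[of W a c] a assms by auto
      have "supp (a - indic W) \<subseteq> supp a"
        by (auto simp: in_keys_iff lookup_minus)
      thus ?thesis unfolding eq using a pidealD(2)[OF pideal_sqideal[OF assms(1)]]
        by (intro iaddI vpoly_single) auto
    qed
  qed
qed

text \<open>The splitting at a variable stays inside squarefree monomial ideals, and neither of the
  two new predicates depends on whether \<open>v\<close> lies in \<open>S\<close> except through the
  generator \<open>v\<close> itself. All regularity inductions below run on this rule.\<close>

lemma regs_sqideal_split:
  fixes fs :: "('v, 'k::field) mpoly list"
  assumes "mono \<Phi>" "v \<in> V" "set fs \<subseteq> vpoly V"
    and "regs V (sqideal V (\<lambda>S. \<Phi> (insert v S))) fs"
    and "regs V (sqideal V (\<lambda>S. \<Phi> S \<or> v \<in> S)) fs"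
  shows "regs V (sqideal V \<Phi>) fs"
proof (rule regs_colon_iadd[where f = "Var v"])
  show "regs V {a \<in> vpoly V. Var v * a \<in> sqideal V \<Phi>} fs"
  proof -
    have "{a :: ('v, 'k) mpoly. a \<in> vpoly V \<and> Var v * a \<in> sqideal V \<Phi>}
        = sqideal V (\<lambda>S. \<Phi> (insert v S))"
      using xmon_mult_in_sqideal[of "{v}" V _ \<Phi>] assms(2)
      by (force simp: Var_eq_xmon sqideal_def)
    thus ?thesis using assms by simp
  qed
  show "regs V (iadd V (sqideal V \<Phi>) (Var v)) fs"
    unfolding Var_eq_xmon
    by (subst iadd_sqideal_xmon) (use assms in auto)
qed (use assms in \<open>auto simp: pideal_sqideal\<close>)

section \<open>Koszul cochains\<close>

text \<open>A cochain of the Koszul complex on \<open>vs\<close> is a function on bit vectors, the bit vector \<open>w\<close>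
  standing for the exterior product of the variables that it selects.\<close>

fun koszul_d :: "'v list \<Rightarrow> (bool list \<Rightarrow> ('v, 'k::field) mpoly) \<Rightarrow> bool list \<Rightarrow> ('v, 'k) mpoly" where
  "koszul_d [] c w = 0"
| "koszul_d (v # vs) c [] = 0"
| "koszul_d (v # vs) c (False # w) = koszul_d vs (\<lambda>u. c (False # u)) w"
| "koszul_d (v # vs) c (True # w) = Var v * c (False # w) - koszul_d vs (\<lambda>u. c (True # u)) w"

text \<open>Contraction with the basis vector of \<open>x\<close>, with one sign for each selected
  variable standing before it. It is the homotopy showing that \<open>x\<close> acts as zero on
  Koszul cohomology.\<close>

fun koszul_h :: "'v \<Rightarrow> 'v list \<Rightarrow> (bool list \<Rightarrow> ('v, 'k::field) mpoly) \<Rightarrow> bool list \<Rightarrow> ('v, 'k) mpoly" where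
  "koszul_h x [] c w = 0"
| "koszul_h x (v # vs) c [] = 0"
| "koszul_h x (v # vs) c (False # w) =
     (if v = x then c (True # w) else koszul_h x vs (\<lambda>u. c (False # u)) w)"
| "koszul_h x (v # vs) c (True # w) =
     (if v = x then 0 else - koszul_h x vs (\<lambda>u. c (True # u)) w)"

lemma bit_list_cases:
  obtains "w = []" | u where "w = False # u" | u where "w = True # u"
  by (cases w) (metis (full_types))+

lemma koszul_d_mult: "koszul_d vs (\<lambda>w. r * c w) w = r * koszul_d vs c w"
proof (induction vs arbitrary: c w)
  case (Cons v vs)
  show ?case
    by (cases w rule: bit_list_cases) (auto simp: Cons.IH algebra_simps)
qed simp

lemma koszul_d_zero [simp]: "koszul_d vs (\<lambda>w. 0) w = 0"
  using koszul_d_mult[of vs 0 "\<lambda>w. 0" w] by simp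

lemma koszul_d_diff: "koszul_d vs (\<lambda>w. a w - b w) w = koszul_d vs a w - koszul_d vs b w"
proof (induction vs arbitrary: a b w)
  case (Cons v vs)
  show ?case
    by (cases w rule: bit_list_cases) (auto simp: Cons.IH algebra_simps)
qed simp

lemma koszul_d_add: "koszul_d vs (\<lambda>w. a w + b w) w = koszul_d vs a w + koszul_d vs b w"
proof (induction vs arbitrary: a b w)
  case (Cons v vs)
  show ?case
    by (cases w rule: bit_list_cases) (auto simp: Cons.IH algebra_simps)
qed simp

lemma koszul_d_d: "koszul_d vs (koszul_d vs c) w = 0"
proof (induction vs arbitrary: c w)
  case (Cons v vs)
  show ?case
    by (cases w rule: bit_list_cases)
      (auto simp: Cons.IH koszul_d_mult koszul_d_diff)
qed simp

lemma koszul_h_mult: "koszul_h x vs (\<lambda>w. r * c w) w = r * koszul_h x vs c w"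
proof (induction vs arbitrary: c w)
  case (Cons v vs)
  show ?case
    by (cases w rule: bit_list_cases) (auto simp: Cons.IH algebra_simps)
qed simp

lemma koszul_h_diff: "koszul_h x vs (\<lambda>w. a w - b w) w = koszul_h x vs a w - koszul_h x vs b w"
proof (induction vs arbitrary: a b w)
  case (Cons v vs)
  show ?case
    by (cases w rule: bit_list_cases) (auto simp: Cons.IH algebra_simps)
qed simp

lemma koszul_homotopy:
  fixes c :: "bool list \<Rightarrow> ('v, 'k::field) mpoly"
  shows "x \<in> set vs \<Longrightarrow> length w = length vs \<Longrightarrow>
     koszul_d vs (koszul_h x vs c) w + koszul_h x vs (koszul_d vs c) w = Var x * c w"
proof (induction vs arbitrary: c w)
  case (Cons v vs)
  then obtain s u where w: "w = s # u" "length u = length vs" by (cases w) auto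
  show ?case
  proof (cases "v = x")
    case True
    thus ?thesis using w by (cases s) auto
  next
    case False
    hence "koszul_d vs (koszul_h x vs c) u + koszul_h x vs (koszul_d vs c) u = Var x * c u"
      for c :: "bool list \<Rightarrow> ('v, 'k) mpoly"
      using Cons w by auto
    note IH = this[of "\<lambda>u. c (False # u)"] this[of "\<lambda>u. c (True # u)"]
    have neg: "koszul_d vs (\<lambda>u. - g u) u = - koszul_d vs g u"
      for g :: "bool list \<Rightarrow> ('v, 'k) mpoly"
      using koszul_d_mult[of vs "-1" g u] by simp
    show ?thesis
      using False w IH by (cases s) (auto simp: koszul_h_mult koszul_h_diff neg algebra_simps)
  qed
qed simp

text \<open>The hypothesis concerns only the products \<open>Var v * c w\<close>, since the monomial
  of a facet is not in the ideal although its products with the outside variables are.\<close>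

lemma koszul_d_in:
  assumes "pideal V I" "\<And>w v. v \<in> set vs \<Longrightarrow> Var v * c w \<in> I"
  shows "koszul_d vs c w \<in> I"
  using assms(2)
proof (induction vs arbitrary: c w)
  case (Cons v vs)
  thus ?case
    by (cases w rule: bit_list_cases)
      (auto simp: pidealD[OF assms(1)] intro!: pidealD(7)[OF assms(1)])
qed (use assms in \<open>auto simp: pidealD\<close>)

lemma koszul_h_in:
  assumes "pideal V I" "\<And>w. c w \<in> I"
  shows "koszul_h x vs c w \<in> I"
  using assms(2)
proof (induction vs arbitrary: c w)
  case (Cons v vs)
  thus ?case
    by (cases w rule: bit_list_cases)
      (auto simp: pidealD[OF assms(1)] intro!: pidealD(6)[OF assms(1)])
qed (use assms in \<open>auto simp: pidealD\<close>)

text \<open>Degrees are integers so that degree \<open>- 1\<close> exists and carries only the zero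
  cochain; exactness in degree \<open>0\<close> then says that every cocycle vanishes modulo the
  ideal. The length condition confines a cochain to finitely many bit vectors.\<close>

definition homogeneous :: "'v list \<Rightarrow> int \<Rightarrow> (bool list \<Rightarrow> ('v, 'k::field) mpoly) \<Rightarrow> bool" where
  "homogeneous vs i c \<longleftrightarrow>
     (\<forall>w. c w \<noteq> 0 \<longrightarrow> length w = length vs \<and> int (count_list w True) = i)"

lemma homogeneousD:
  "homogeneous vs i c \<Longrightarrow> length w \<noteq> length vs \<or> int (count_list w True) \<noteq> i \<Longrightarrow> c w = 0"
  by (auto simp: homogeneous_def)

lemma homogeneous_Cons:
  "homogeneous (v # vs) i c \<Longrightarrow> homogeneous vs i (\<lambda>u. c (False # u))"
  "homogeneous (v # vs) i c \<Longrightarrow> homogeneous vs (i - 1) (\<lambda>u. c (True # u))"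
  unfolding homogeneous_def by fastforce+

lemma homogeneous_koszul_d: "homogeneous vs i c \<Longrightarrow> homogeneous vs (i + 1) (koszul_d vs c)"
proof (induction vs arbitrary: c i)
  case Nil
  show ?case by (simp add: homogeneous_def)
next
  case (Cons v vs)
  note h = homogeneous_Cons[OF Cons.prems]
  note IH = Cons.IH[OF h(1)] Cons.IH[OF h(2)]
  have "koszul_d (v # vs) c w = 0"
    if "length w \<noteq> length (v # vs) \<or> int (count_list w True) \<noteq> i + 1" for w
  proof (cases w)
    case (Cons s u)
    thus ?thesis using that h homogeneousD[OF IH(1), of u] homogeneousD[OF IH(2), of u]
        homogeneousD[OF h(1), of u] by (cases s) auto
  qed simp
  thus ?case unfolding homogeneous_def by blast
qed

lemma homogeneous_koszul_h: "homogeneous vs i c \<Longrightarrow> homogeneous vs (i - 1) (koszul_h x vs c)"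
proof (induction vs arbitrary: c i)
  case Nil
  show ?case by (simp add: homogeneous_def)
next
  case (Cons v vs)
  note h = homogeneous_Cons[OF Cons.prems]
  note IH = Cons.IH[OF h(1)] Cons.IH[OF h(2)]
  have "koszul_h x (v # vs) c w = 0"
    if "length w \<noteq> length (v # vs) \<or> int (count_list w True) \<noteq> i - 1" for w
  proof (cases w)
    case (Cons s u)
    thus ?thesis using that h homogeneousD[OF IH(1), of u] homogeneousD[OF IH(2), of u]
        homogeneousD[OF h(2), of u] by (cases s) auto
  qed simp
  thus ?case unfolding homogeneous_def by blast
qed

definition cochain :: "'v set \<Rightarrow> 'v list \<Rightarrow> int \<Rightarrow> (bool list \<Rightarrow> ('v, 'k::field) mpoly) \<Rightarrow> bool" where
  "cochain V vs i c \<longleftrightarrow> (\<forall>w. c w \<in> vpoly V) \<and> homogeneous vs i c"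

lemma cochain_koszul_d:
  "set vs \<subseteq> V \<Longrightarrow> cochain V vs i c \<Longrightarrow> cochain V vs (i + 1) (koszul_d vs c)"
  unfolding cochain_def
  by (auto intro!: homogeneous_koszul_d koszul_d_in[OF pideal_carrier])

lemma cochain_koszul_h: "cochain V vs i c \<Longrightarrow> cochain V vs (i - 1) (koszul_h x vs c)"
  unfolding cochain_def
  by (auto intro!: homogeneous_koszul_h koszul_h_in[OF pideal_carrier])

lemma cochain_zero: "cochain V vs i (\<lambda>w. 0)"
  by (auto simp: cochain_def homogeneous_def)

lemma cochain_add: "cochain V vs i a \<Longrightarrow> cochain V vs i b \<Longrightarrow> cochain V vs i (\<lambda>w. a w + b w)"
  unfolding cochain_def homogeneous_def
  by (auto simp: vpoly_closed(3)) (metis add.right_neutral)+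

lemma cochain_mult: "r \<in> vpoly V \<Longrightarrow> cochain V vs i c \<Longrightarrow> cochain V vs i (\<lambda>w. r * c w)"
  unfolding cochain_def homogeneous_def by (auto simp: vpoly_closed(4)) (metis mult_zero_right)+

lemma cochain_diff: "cochain V vs i a \<Longrightarrow> cochain V vs i b \<Longrightarrow> cochain V vs i (\<lambda>w. a w - b w)"
  using cochain_add[of V vs i a "\<lambda>w. - 1 * b w"] cochain_mult[of "- 1" V vs i b] by auto

lemma cochain_negative: "cochain V vs i c \<Longrightarrow> i < 0 \<Longrightarrow> c w = 0"
  by (auto simp: cochain_def intro!: homogeneousD)

text \<open>Vanishing of the Koszul cohomology of \<open>R/I\<close> in degree \<open>i\<close>,
  expressed through lifts: cochains have polynomial values and the equations hold modulo
  \<open>I\<close>.\<close>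

definition koszul_exact :: "'v set \<Rightarrow> ('v, 'k::field) mpoly set \<Rightarrow> 'v list \<Rightarrow> int \<Rightarrow> bool" where
  "koszul_exact V I vs i \<longleftrightarrow>
     (\<forall>c. cochain V vs i c \<and> (\<forall>w. koszul_d vs c w \<in> I) \<longrightarrow>
        (\<exists>b. cochain V vs (i - 1) b \<and> (\<forall>w. c w - koszul_d vs b w \<in> I)))"

lemma koszul_exact_negative:
  assumes "pideal V I" "i < 0"
  shows "koszul_exact V I vs i"
  unfolding koszul_exact_def
proof safe
  fix c assume c: "cochain V vs i c" "\<forall>w. koszul_d vs c w \<in> I"
  show "\<exists>b. cochain V vs (i - 1) b \<and> (\<forall>w. c w - koszul_d vs b w \<in> I)"
    using cochain_negative[OF c(1) assms(2)] pidealD(2)[OF assms(1)]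
    by (intro exI[of _ "\<lambda>w. 0"]) (simp add: cochain_zero)
qed

lemma irrelevant_ideal_subset: "(irrelevant_ideal V :: ('v, 'k::field) mpoly set) \<subseteq> vpoly V"
proof -
  have "(Var ` V :: ('v, 'k) mpoly set) \<subseteq> vpoly V" by auto
  from pideal_Idl[OF this] show ?thesis by (auto simp: irrelevant_ideal_def pideal_def)
qed

text \<open>The polynomials annihilating the class of \<open>c\<close> form an ideal
  \<open>K\<close>, and the contraction with \<open>x\<close> puts every variable \<open>x\<close>
  into it.\<close>

lemma irrelevant_kills_cohomology:
  assumes I: "pideal V I" and vs: "set vs = V" and y: "y \<in> irrelevant_ideal V"
    and c: "cochain V vs i c" "\<And>w. koszul_d vs c w \<in> I"
  shows "\<exists>b. cochain V vs (i - 1) b \<and> (\<forall>w. y * c w - koszul_d vs b w \<in> I)"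
proof -
  define K where
    "K = {y \<in> vpoly V. \<exists>b. cochain V vs (i - 1) b \<and> (\<forall>w. y * c w - koszul_d vs b w \<in> I)}"
  have "pideal V K"
    unfolding pideal_def
  proof (intro conjI ballI)
    show "0 \<in> K" unfolding K_def using cochain_zero[of V vs "i - 1"] pidealD(2)[OF I]
      by (auto intro!: exI[of _ "\<lambda>w. 0"])
    show "a + b \<in> K" if ab: "a \<in> K" "b \<in> K" for a b
    proof -
      from ab obtain p q where pq: "cochain V vs (i - 1) p" "\<And>w. a * c w - koszul_d vs p w \<in> I"
        "cochain V vs (i - 1) q" "\<And>w. b * c w - koszul_d vs q w \<in> I" unfolding K_def by blast
      have "(a + b) * c w - koszul_d vs (\<lambda>w. p w + q w) w =
          (a * c w - koszul_d vs p w) + (b * c w - koszul_d vs q w)" for w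
        by (simp add: koszul_d_add algebra_simps)
      hence "(a + b) * c w - koszul_d vs (\<lambda>w. p w + q w) w \<in> I" for w
        using pidealD(3)[OF I pq(2,4)] by metis
      thus ?thesis using ab cochain_add[OF pq(1,3)] by (auto simp: K_def)
    qed
    show "r * a \<in> K" if ra: "r \<in> vpoly V" "a \<in> K" for r a
    proof -
      from ra obtain p where p: "cochain V vs (i - 1) p" "\<And>w. a * c w - koszul_d vs p w \<in> I"
        unfolding K_def by blast
      have "r * a * c w - koszul_d vs (\<lambda>w. r * p w) w = r * (a * c w - koszul_d vs p w)" for w
        by (simp add: koszul_d_mult algebra_simps)
      hence "r * a * c w - koszul_d vs (\<lambda>w. r * p w) w \<in> I" for w
        using pidealD(4)[OF I ra(1) p(2)] by metis
      thus ?thesis using ra cochain_mult[OF ra(1) p(1)] by (auto simp: K_def)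
    qed
  qed (auto simp: K_def)
  moreover have "Var ` V \<subseteq> K"
  proof safe
    fix x assume x: "x \<in> V"
    have b: "cochain V vs (i - 1) (koszul_h x vs c)" by (rule cochain_koszul_h[OF c(1)])
    have "Var x * c w - koszul_d vs (koszul_h x vs c) w \<in> I" for w
    proof (cases "length w = length vs")
      case True
      hence "Var x * c w - koszul_d vs (koszul_h x vs c) w = koszul_h x vs (koszul_d vs c) w"
        using koszul_homotopy[of x vs w c] x vs by (simp add: algebra_simps)
      thus ?thesis using koszul_h_in[OF I c(2)] by simp
    next
      case False
      hence "c w = 0" "koszul_d vs (koszul_h x vs c) w = 0"
        using c(1) cochain_koszul_d[OF _ b] vs
        by (auto simp: cochain_def homogeneous_def)
      thus ?thesis using pidealD(2)[OF I] by simp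
    qed
    thus "Var x \<in> K" using b x by (auto simp: K_def)
  qed
  ultimately have "irrelevant_ideal V \<subseteq> K" unfolding irrelevant_ideal_def by (rule Idl_subset)
  thus ?thesis using y by (auto simp: K_def)
qed

text \<open>Since \<open>y\<close> annihilates cohomology, \<open>y * c\<close> is the coboundary of
  some \<open>b\<close> modulo \<open>I\<close>. Then \<open>b\<close> is a cocycle modulo
  \<open>I + (y)\<close>, so by induction it is a coboundary plus \<open>y * b'\<close>, and
  applying the differential gives \<open>y * c\<close> congruent to \<open>y\<close> times the
  coboundary of \<open>b'\<close>. Regularity of \<open>y\<close> cancels the factor.\<close>

lemma regs_imp_koszul_exact:
  assumes "set vs = V" "pideal V I" "regs V I ys" "set ys \<subseteq> irrelevant_ideal V"
    "i < int (length ys)"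
  shows "koszul_exact V I vs i"
  using assms(2-)
proof (induction ys arbitrary: I i)
  case Nil
  thus ?case by (intro koszul_exact_negative) auto
next
  case (Cons y ys)
  note I = \<open>pideal V I\<close>
  have y: "y \<in> irrelevant_ideal V" "y \<in> vpoly V"
    using Cons.prems irrelevant_ideal_subset[of V] by auto
  have ex: "koszul_exact V (iadd V I y) vs (i - 1)"
    using Cons.prems y pideal_iadd[OF I] by (intro Cons.IH) auto
  show ?case
    unfolding koszul_exact_def
  proof safe
    fix c assume c: "cochain V vs i c" "\<forall>w. koszul_d vs c w \<in> I"
    obtain b where b: "cochain V vs (i - 1) b" "\<And>w. y * c w - koszul_d vs b w \<in> I"
      using irrelevant_kills_cohomology[OF I assms(1) y(1) c(1)] c(2) by blast
    have "koszul_d vs b w \<in> iadd V I y" for w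
    proof -
      have "- (y * c w - koszul_d vs b w) + y * c w \<in> iadd V I y"
        using c(1) pidealD(6)[OF I b(2)] by (intro iaddI) (auto simp: cochain_def)
      thus ?thesis by simp
    qed
    then obtain e where e: "cochain V vs (i - 1 - 1) e" "\<And>w. b w - koszul_d vs e w \<in> iadd V I y"
      using ex b(1) unfolding koszul_exact_def by blast
    have cbe: "cochain V vs (i - 1) (\<lambda>w. b w - koszul_d vs e w)"
      using cochain_diff[OF b(1)] cochain_koszul_d[OF _ e(1)] assms(1) by fastforce
    \<comment> \<open>The quotient is chosen to be \<open>0\<close> wherever the dividend is
      \<open>0\<close>, so that \<open>b'\<close> inherits homogeneity.\<close>
    have "\<exists>q. q \<in> vpoly V \<and> (b w - koszul_d vs e w = 0 \<longrightarrow> q = 0) \<and> b w - koszul_d vs e w - y * q \<in> I" for w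
    proof (cases "b w - koszul_d vs e w = 0")
      case True
      thus ?thesis using pidealD(2)[OF I] by (intro exI[of _ 0]) auto
    next
      case False
      from e(2)[of w] obtain j q where "j \<in> I" "q \<in> vpoly V" "b w - koszul_d vs e w = j + y * q"
        by (rule iaddE)
      thus ?thesis using False by (intro exI[of _ q]) auto
    qed
    then obtain b' where b': "\<And>w. b' w \<in> vpoly V" "\<And>w. b w - koszul_d vs e w = 0 \<Longrightarrow> b' w = 0"
      "\<And>w. b w - koszul_d vs e w - y * b' w \<in> I" by metis
    have cb': "cochain V vs (i - 1) b'"
      using cbe b'(1,2) unfolding cochain_def homogeneous_def by metis
    have "c w - koszul_d vs b' w \<in> I" for w
    proof -
      have "koszul_d vs (\<lambda>w. b w - koszul_d vs e w - y * b' w) w \<in> I"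
        using b'(3) assms(1) by (intro koszul_d_in[OF I] pidealD(4)[OF I]) auto
      hence "koszul_d vs b w - y * koszul_d vs b' w \<in> I"
        by (simp add: koszul_d_diff koszul_d_mult koszul_d_d)
      from pidealD(3)[OF I b(2)[of w] this] have "y * (c w - koszul_d vs b' w) \<in> I"
        by (simp add: algebra_simps)
      moreover have "c w - koszul_d vs b' w \<in> vpoly V"
        using c(1) cochain_koszul_d[OF _ cb'] assms(1) by (auto simp: cochain_def)
      ultimately show ?thesis using Cons.prems(2) by auto
    qed
    thus "\<exists>b. cochain V vs (i - 1) b \<and> (\<forall>w. c w - koszul_d vs b w \<in> I)"
      using cb' by blast
  qed
qed

section \<open>Truncation with respect to one variable\<close>

text \<open>Drops the terms divisible by \<open>Var v ^ n\<close>. Since whole terms are kept or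
  dropped, every \<open>sqideal\<close> is preserved, and a congruence modulo such an ideal may be
  truncated.\<close>

definition trunc :: "'v \<Rightarrow> nat \<Rightarrow> ('v, 'k::field) mpoly \<Rightarrow> ('v, 'k) mpoly" where
  "trunc v n p = (\<Sum>a\<in>{a \<in> Poly_Mapping.keys p. Poly_Mapping.lookup a v < n}.
     Poly_Mapping.single a (Poly_Mapping.lookup p a))"

lemma lookup_trunc:
  "Poly_Mapping.lookup (trunc v n p) b =
     (if Poly_Mapping.lookup b v < n then Poly_Mapping.lookup p b else 0)"
proof -
  have "Poly_Mapping.lookup (trunc v n p) b =
      (\<Sum>a\<in>{a \<in> Poly_Mapping.keys p. Poly_Mapping.lookup a v < n}.
         if b = a then Poly_Mapping.lookup p a else 0)"
    unfolding trunc_def lookup_sum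
    by (intro sum.cong) (auto simp: lookup_single when_def)
  thus ?thesis by (auto simp: in_keys_iff)
qed

lemma trunc_diff: "trunc v n (p - q) = trunc v n p - trunc v n q"
  by (rule poly_mapping_eqI) (simp add: lookup_trunc lookup_minus)

lemma trunc_zero [simp]: "trunc v n 0 = 0"
  by (rule poly_mapping_eqI) (simp add: lookup_trunc)

lemma trunc_Var_mult:
  assumes "u \<noteq> v"
  shows "trunc v n (Var u * p) = Var u * trunc v n p"
proof (rule poly_mapping_eqI)
  fix b
  show "Poly_Mapping.lookup (trunc v n (Var u * p)) b = Poly_Mapping.lookup (Var u * trunc v n p) b"
  proof (cases "\<exists>a. b = Poly_Mapping.single u 1 + a")
    case True
    then obtain a where a: "b = Poly_Mapping.single u 1 + a" by blast
    have "Poly_Mapping.lookup b v = Poly_Mapping.lookup a v"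
      using assms by (simp add: a lookup_add lookup_single)
    thus ?thesis by (simp add: lookup_trunc Var_def lookup_single_mult a)
  next
    case False
    hence "b \<notin> Poly_Mapping.keys (Var u * p)" for p :: "('a, 'b) mpoly"
      by (auto simp: Var_def keys_single_mult)
    thus ?thesis by (simp add: lookup_trunc in_keys_iff)
  qed
qed

lemma Var_power: "Var v ^ n = Poly_Mapping.single (Poly_Mapping.single v n) 1"
  by (induction n) (auto simp: Var_def mult_single simp flip: single_add)

lemma trunc_Var_power_mult: "trunc v n (Var v ^ n * p) = 0"
proof (rule poly_mapping_eqI)
  fix b
  have "n \<le> Poly_Mapping.lookup b v" if "b \<in> Poly_Mapping.keys (Var v ^ n * p)"
    using that by (auto simp: Var_power keys_single_mult lookup_add)
  thus "Poly_Mapping.lookup (trunc v n (Var v ^ n * p)) b = Poly_Mapping.lookup 0 b"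
    by (cases "b \<in> Poly_Mapping.keys (Var v ^ n * p)") (auto simp: lookup_trunc not_in_keys_iff_lookup_eq_zero)
qed

lemma trunc_sqideal: "p \<in> sqideal V \<Phi> \<Longrightarrow> trunc v n p \<in> sqideal V \<Phi>"
  by (auto simp: sqideal_def vpoly_iff in_keys_iff lookup_trunc split: if_splits)

lemma trunc_vpoly: "p \<in> vpoly V \<Longrightarrow> trunc v n p \<in> vpoly V"
  by (auto simp: vpoly_iff in_keys_iff lookup_trunc split: if_splits)

lemma trunc_id:
  "(\<And>a. a \<in> Poly_Mapping.keys p \<Longrightarrow> Poly_Mapping.lookup a v < n) \<Longrightarrow> trunc v n p = p"
  by (rule poly_mapping_eqI) (auto simp: lookup_trunc in_keys_iff)

lemma trunc_koszul_d:
  "v \<notin> set vs \<Longrightarrow> trunc v n (koszul_d vs c w) = koszul_d vs (\<lambda>u. trunc v n (c u)) w"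
proof (induction vs arbitrary: c w)
  case (Cons u vs)
  thus ?case
    by (cases w rule: bit_list_cases)
      (auto simp: trunc_diff trunc_Var_mult)
qed simp

text \<open>The cohomology of the complex without \<open>v\<close> is divisible by arbitrary powers of \<open>v\<close>, hence
  zero: truncating in \<open>v\<close> commutes with the differential and kills the multiples of a high power.\<close>

lemma koszul_exact_tail:
  fixes V :: "'v set" and \<Phi> :: "'v set \<Rightarrow> bool"
  defines "J \<equiv> (sqideal V \<Phi> :: ('v, 'k::field) mpoly set)"
  assumes \<Phi>: "mono \<Phi>" and v: "v \<in> V" "set vs \<subseteq> V" "v \<notin> set vs"
    and ex: "koszul_exact V J (v # vs) (i + 1)"
  shows "koszul_exact V J vs i"
proof -
  have J: "pideal V J" unfolding J_def by (rule pideal_sqideal[OF \<Phi>])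
  have step: "\<exists>a b. cochain V vs i a \<and> (\<forall>w. koszul_d vs a w \<in> J) \<and> cochain V vs (i - 1) b \<and>
      (\<forall>w. c w - Var v * a w - koszul_d vs b w \<in> J)"
    if c: "cochain V vs i c" "\<And>w. koszul_d vs c w \<in> J" for c
  proof -
    \<comment> \<open>\<open>c'\<close> is the exterior product of the basis vector of
      \<open>v\<close> with \<open>c\<close>, a cocycle one degree higher. If it is the coboundary
      of \<open>B\<close> modulo \<open>J\<close>, comparing the components with \<open>v\<close>
      expresses \<open>c\<close> as \<open>Var v * a\<close> plus a coboundary; the components
      without \<open>v\<close> show that \<open>a\<close> is again a cocycle, so the step can be
      repeated.\<close>
    define c' where "c' = (\<lambda>w. case w of [] \<Rightarrow> 0 | s # u \<Rightarrow> if s then c u else 0)"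
    have c'_simps: "c' [] = 0" "c' (False # u) = 0" "c' (True # u) = c u" for u
      by (auto simp: c'_def)
    have "cochain V (v # vs) (i + 1) c'"
      using c(1) unfolding cochain_def homogeneous_def c'_def by (auto split: list.split)
    moreover have "koszul_d (v # vs) c' w \<in> J" for w
      using c(2) pidealD(2)[OF J] pidealD(6)[OF J c(2)]
      by (cases w rule: bit_list_cases) (auto simp: c'_simps)
    ultimately obtain B where B: "cochain V (v # vs) i B"
      "\<And>w. c' w - koszul_d (v # vs) B w \<in> J"
      using ex unfolding koszul_exact_def by fastforce
    define a where "a = (\<lambda>u. B (False # u))"
    define b where "b = (\<lambda>u. - 1 * B (True # u))"
    have "cochain V vs i a" "cochain V vs (i - 1) b"
      using B(1) homogeneous_Cons[of v vs i B] cochain_mult[of "- 1" V vs "i - 1" "\<lambda>u. B (True # u)"]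
      unfolding a_def b_def cochain_def by auto
    moreover have "koszul_d vs a w \<in> J" for w
      using pidealD(6)[OF J B(2)[of "False # w"]] by (simp add: c'_simps a_def)
    moreover have "c w - Var v * a w - koszul_d vs b w \<in> J" for w
      using B(2)[of "True # w"] unfolding b_def koszul_d_mult
      by (simp add: c'_simps a_def algebra_simps)
    ultimately show ?thesis by blast
  qed
  have iter: "\<exists>a b. cochain V vs i a \<and> (\<forall>w. koszul_d vs a w \<in> J) \<and> cochain V vs (i - 1) b \<and>
      (\<forall>w. c w - Var v ^ n * a w - koszul_d vs b w \<in> J)"
    if c: "cochain V vs i c" "\<And>w. koszul_d vs c w \<in> J" for c n
  proof (induction n)
    case 0
    show ?case using c pidealD(2)[OF J]
      by (intro exI[of _ c] exI[of _ "\<lambda>w. 0"]) (auto simp: cochain_zero)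
  next
    case (Suc n)
    then obtain a b where ab: "cochain V vs i a" "\<And>w. koszul_d vs a w \<in> J" "cochain V vs (i - 1) b"
      "\<And>w. c w - Var v ^ n * a w - koszul_d vs b w \<in> J" by blast
    from step[OF ab(1,2)] obtain a' b' where ab': "cochain V vs i a'" "\<And>w. koszul_d vs a' w \<in> J"
      "cochain V vs (i - 1) b'" "\<And>w. a w - Var v * a' w - koszul_d vs b' w \<in> J" by blast
    have vn: "Var v ^ n \<in> vpoly V" using v by (intro vpoly_power) auto
    have "c w - Var v ^ Suc n * a' w - koszul_d vs (\<lambda>w. b w + Var v ^ n * b' w) w \<in> J" for w
    proof -
      have "c w - Var v ^ Suc n * a' w - koszul_d vs (\<lambda>w. b w + Var v ^ n * b' w) w =
        (c w - Var v ^ n * a w - koszul_d vs b w) + Var v ^ n * (a w - Var v * a' w - koszul_d vs b' w)"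
        unfolding koszul_d_add koszul_d_mult by (simp add: algebra_simps)
      thus ?thesis using pidealD(3)[OF J ab(4) pidealD(4)[OF J vn ab'(4)]] by metis
    qed
    thus ?case using ab' cochain_add[OF ab(3) cochain_mult[OF vn ab'(3)]] by blast
  qed
  show ?thesis
    unfolding koszul_exact_def
  proof safe
    fix c assume c: "cochain V vs i c" "\<forall>w. koszul_d vs c w \<in> J"
    \<comment> \<open>All exponents of \<open>v\<close> in the values of \<open>c\<close>. They form
      a finite set because only bit vectors of the right length matter; an \<open>n\<close> above
      them makes truncation leave \<open>c\<close> unchanged.\<close>
    define D where "D = (\<Union>w\<in>{w. set w \<subseteq> UNIV \<and> length w = length vs}.
      (\<lambda>a. Poly_Mapping.lookup a v) ` Poly_Mapping.keys (c w))"
    have "finite D"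
      unfolding D_def by (intro finite_UN_I finite_lists_length_eq) auto
    then obtain n where n: "\<And>d. d \<in> D \<Longrightarrow> d < n"
      using finite_nat_set_iff_bounded by auto
    have tc: "trunc v n (c w) = c w" for w
    proof (rule trunc_id)
      fix a assume a: "a \<in> Poly_Mapping.keys (c w)"
      hence "c w \<noteq> 0" by auto
      hence "length w = length vs" using c(1) by (auto simp: cochain_def homogeneous_def)
      thus "Poly_Mapping.lookup a v < n" using a by (intro n) (auto simp: D_def)
    qed
    obtain a b where ab: "cochain V vs (i - 1) b"
      "\<And>w. c w - Var v ^ n * a w - koszul_d vs b w \<in> J"
      using iter[OF c(1)] c(2) by blast
    have "cochain V vs (i - 1) (\<lambda>w. trunc v n (b w))"
      using ab(1) unfolding cochain_def homogeneous_def by (metis trunc_vpoly trunc_zero)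
    moreover have "c w - koszul_d vs (\<lambda>w. trunc v n (b w)) w \<in> J" for w
    proof -
      have "trunc v n (c w - Var v ^ n * a w - koszul_d vs b w) \<in> J"
        using ab(2)[of w] unfolding J_def by (rule trunc_sqideal)
      thus ?thesis
        by (simp add: trunc_diff tc trunc_Var_power_mult trunc_koszul_d[OF v(3)])
    qed
    ultimately show "\<exists>b. cochain V vs (i - 1) b \<and> (\<forall>w. c w - koszul_d vs b w \<in> J)" by blast
  qed
qed

text \<open>For a facet \<open>F\<close>, the monomial of \<open>F\<close> is a nonzero class of \<open>R/J\<close> killed by the variables
  outside \<open>F\<close>; removing the variables of \<open>F\<close> one at a time moves this class from Koszul degree
  \<open>0\<close> up to degree \<open>card F\<close>, where a longer regular sequence would force it to vanish.\<close>

theorem regs_length_le_card_facet: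
  fixes \<Phi> :: "'v set \<Rightarrow> bool" and ys :: "('v, 'k::field) mpoly list"
  assumes "finite V" and \<Phi>: "mono \<Phi>" and F: "F \<subseteq> V" "\<not> \<Phi> F" "\<And>v. v \<in> V - F \<Longrightarrow> \<Phi> (insert v F)"
    and ys: "regs V (sqideal V \<Phi>) ys" "set ys \<subseteq> irrelevant_ideal V"
  shows "length ys \<le> card F"
proof (rule ccontr)
  assume *: "\<not> length ys \<le> card F"
  define J where "J = (sqideal V \<Phi> :: ('v, 'k) mpoly set)"
  have J: "pideal V J" unfolding J_def by (rule pideal_sqideal[OF \<Phi>])
  have finF: "finite F" using F(1) assms(1) finite_subset by blast
  obtain fs where fs: "set fs = F" "distinct fs" using finite_distinct_list[OF finF] by blast
  obtain vs where vs: "set vs = V - F" "distinct vs"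
    using finite_distinct_list[of "V - F"] assms(1) by blast
  have peel: "koszul_exact V J vs i"
    if "koszul_exact V J (us @ vs) (i + int (length us))" "distinct (us @ vs)" "set (us @ vs) \<subseteq> V"
    for us i
    using that
  proof (induction us arbitrary: i)
    case (Cons u us)
    have "koszul_exact V J (u # us @ vs) (i + int (length us) + 1)"
      using Cons.prems(1) by (simp add: add_ac)
    hence "koszul_exact V J (us @ vs) (i + int (length us))"
      unfolding J_def by (rule koszul_exact_tail[OF \<Phi>, rotated -1]) (use Cons.prems in auto)
    thus ?case using Cons by auto
  qed simp
  have "koszul_exact V J (fs @ vs) (0 + int (length fs))"
    using * fs vs F ys distinct_card[OF fs(2)] J
    by (intro regs_imp_koszul_exact[where ys = ys]) (auto simp: J_def)
  hence ex: "koszul_exact V J vs 0"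
    by (rule peel) (use fs vs F in auto)
  define c :: "bool list \<Rightarrow> ('v, 'k) mpoly"
    where "c = (\<lambda>w. if w = replicate (length vs) False then xmon F else 0)"
  have "count_list (replicate n False) True = 0" for n by (induction n) auto
  hence "cochain V vs 0 c"
    unfolding cochain_def homogeneous_def c_def using F(1) finF by auto
  moreover have "koszul_d vs c w \<in> J" for w
  proof (rule koszul_d_in[OF J])
    fix w v assume v: "v \<in> set vs"
    have "Var v * xmon F = (xmon (insert v F) :: ('v, 'k) mpoly)"
      using v vs finF by (simp add: Var_eq_xmon flip: xmon_Un)
    moreover have "xmon (insert v F) \<in> J"
      unfolding J_def using F v vs finF by (subst xmon_in_sqideal) auto
    ultimately show "Var v * c w \<in> J" using pidealD(2)[OF J] by (auto simp: c_def)
  qed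
  ultimately obtain b where b: "cochain V vs (0 - 1) b" "\<And>w. c w - koszul_d vs b w \<in> J"
    using ex unfolding koszul_exact_def by blast
  have "b = (\<lambda>w. 0)" using cochain_negative[OF b(1)] by auto
  hence "xmon F \<in> J" using b(2)[of "replicate (length vs) False"] by (simp add: c_def)
  thus False unfolding J_def using F finF by (simp add: xmon_in_sqideal)
qed

section \<open>Passage to the quotient ring\<close>

abbreviation proj :: "'v set \<Rightarrow> ('v, 'k::field) mpoly set \<Rightarrow> ('v, 'k) mpoly \<Rightarrow> ('v, 'k) mpoly set" where
  "proj V J f \<equiv> J +>\<^bsub>poly_ring V\<^esub> f"

lemma ring_poly_ring: "ring (poly_ring V :: ('v, 'k::field) mpoly ring)"
  by (rule cring.axioms(1)[OF cring_poly_ring])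

lemma carrier_Quot: "carrier (poly_ring V Quot J) = proj V J ` vpoly V"
  by (auto simp: FactRing_def A_RCOSETS_def')

lemma proj_mult:
  assumes "pideal V J" "a \<in> vpoly V" "b \<in> vpoly V"
  shows "proj V J a \<otimes>\<^bsub>poly_ring V Quot J\<^esub> proj V J b = proj V J (a * b)"
  using ideal.rcoset_mult_add[of J "poly_ring V" a b] assms
  by (simp add: pideal_iff_ideal FactRing_def)

lemma Union_proj_image:
  assumes "pideal V J" "pideal V K" "J \<subseteq> K"
  shows "\<Union> (proj V J ` K) = K"
  using ring.ideal_incl_iff[OF ring_poly_ring, of J V K] assms by (simp add: pideal_iff_ideal)

lemma proj_mem_iff:
  assumes "pideal V J" "P \<subseteq> carrier (poly_ring V Quot J)" "a \<in> vpoly V"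
  shows "proj V J a \<in> P \<longleftrightarrow> a \<in> \<Union> P"
  using ring.canonical_proj_vimage_mem_iff[OF ring_poly_ring, of J V P a] assms
  by (simp add: pideal_iff_ideal)

lemma proj_mem_image_iff:
  assumes "pideal V J" "pideal V K" "J \<subseteq> K" "a \<in> vpoly V"
  shows "proj V J a \<in> proj V J ` K \<longleftrightarrow> a \<in> K"
proof -
  have "proj V J ` K \<subseteq> carrier (poly_ring V Quot J)"
    using pidealD(1)[OF assms(2)] by (auto simp: carrier_Quot)
  from proj_mem_iff[OF assms(1) this assms(4)] show ?thesis
    by (simp add: Union_proj_image assms)
qed

lemma ideal_proj_image:
  "pideal V J \<Longrightarrow> pideal V K \<Longrightarrow> ideal (proj V J ` K) (poly_ring V Quot J)"
  unfolding pideal_iff_ideal by (rule ring.ring_ideal_imp_quot_ideal[OF ring_poly_ring])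

lemma pideal_Union:
  "pideal V J \<Longrightarrow> ideal P (poly_ring V Quot J) \<Longrightarrow> pideal V (\<Union> P)"
  unfolding pideal_iff_ideal by (rule ring.quot_ideal_imp_ring_ideal[OF ring_poly_ring])

lemma Union_superset:
  assumes "pideal V J" "ideal P (poly_ring V Quot J)"
  shows "J \<subseteq> \<Union> P"
proof -
  have "\<zero>\<^bsub>poly_ring V Quot J\<^esub> \<in> P"
    using assms(2) by (simp add: additive_subgroup.zero_closed ideal.axioms(1))
  thus ?thesis by (auto simp: FactRing_def)
qed

lemma proj_image_Union:
  assumes "pideal V J" "ideal P (poly_ring V Quot J)"
  shows "proj V J ` \<Union> P = P"
proof -
  have P: "P \<subseteq> carrier (poly_ring V Quot J)"
    using assms(2) additive_subgroup.a_subset ideal.axioms(1) by blast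
  note mem = proj_mem_iff[OF assms(1) P]
  have UP: "\<Union> P \<subseteq> vpoly V" using pideal_Union[OF assms] by (auto simp: pideal_def)
  show ?thesis
  proof
    show "proj V J ` \<Union> P \<subseteq> P" using UP mem by blast
    show "P \<subseteq> proj V J ` \<Union> P"
    proof
      fix x assume x: "x \<in> P"
      then obtain a where "a \<in> vpoly V" "x = proj V J a" using P by (auto simp: carrier_Quot)
      thus "x \<in> proj V J ` \<Union> P" using x mem[of a] by (intro image_eqI[of _ _ a]) auto
    qed
  qed
qed

lemma Idl_Quot:
  assumes J: "pideal V J" and ys: "set ys \<subseteq> vpoly V"
  shows "Idl\<^bsub>poly_ring V Quot J\<^esub> (set (map (proj V J) ys)) = proj V J ` iadds V J ys"
proof -
  let ?Q = "poly_ring V Quot J"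
  interpret Q: ring ?Q
    using J ideal.quotient_is_ring by (auto simp: pideal_iff_ideal)
  have K: "pideal V (iadds V J ys)" by (rule pideal_iadds[OF J ys])
  have sub: "set (map (proj V J) ys) \<subseteq> carrier ?Q"
    using ys by (auto simp: carrier_Quot)
  have id: "ideal (Idl\<^bsub>?Q\<^esub> (set (map (proj V J) ys))) ?Q" by (rule Q.genideal_ideal[OF sub])
  show ?thesis
  proof
    show "Idl\<^bsub>?Q\<^esub> (set (map (proj V J) ys)) \<subseteq> proj V J ` iadds V J ys"
      using iadds_gens[OF J ys] by (intro Q.genideal_minimal ideal_proj_image[OF J K]) auto
    have "set ys \<subseteq> \<Union> (Idl\<^bsub>?Q\<^esub> (set (map (proj V J) ys)))"
    proof
      fix y assume "y \<in> set ys"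
      thus "y \<in> \<Union> (Idl\<^bsub>?Q\<^esub> (set (map (proj V J) ys)))"
        using ys Q.genideal_self[OF sub] additive_subgroup.a_subset[OF ideal.axioms(1)[OF id]]
        by (subst proj_mem_iff[OF J, symmetric]) auto
    qed
    hence "iadds V J ys \<subseteq> \<Union> (Idl\<^bsub>?Q\<^esub> (set (map (proj V J) ys)))"
      by (intro iadds_least pideal_Union[OF J id] Union_superset[OF J id])
    thus "proj V J ` iadds V J ys \<subseteq> Idl\<^bsub>?Q\<^esub> (set (map (proj V J) ys))"
      using proj_image_Union[OF J id] by blast
  qed
qed

text \<open>Ideals of the quotient correspond to ideals containing \<open>J\<close>, and the one
  generated by the classes of \<open>ys\<close> to \<open>iadds V J ys\<close>. From here on
  regularity is a statement about polynomials.\<close>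

lemma regular_sequence_Quot_iff:
  assumes J: "pideal V J" and ys: "set ys \<subseteq> vpoly V"
  shows "regular_sequence (poly_ring V Quot J) (map (proj V J) ys) \<longleftrightarrow>
    regs V J ys \<and> 1 \<notin> iadds V J ys"
proof -
  let ?Q = "poly_ring V Quot J"
  have take: "set (take i ys) \<subseteq> vpoly V" for i using ys set_take_subset by fast
  have mem: "proj V J a \<in> Idl\<^bsub>?Q\<^esub> (set (take i (map (proj V J) ys))) \<longleftrightarrow> a \<in> iadds V J (take i ys)"
    if "a \<in> vpoly V" for a i
    using that take
    by (simp only: take_map Idl_Quot[OF J take])
      (rule proj_mem_image_iff, auto intro: J pideal_iadds iadds_superset[THEN subsetD])
  have 1: "set (map (proj V J) ys) \<subseteq> carrier ?Q"
    using ys by (auto simp: carrier_Quot)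
  have 2: "(\<forall>i < length (map (proj V J) ys). \<forall>a \<in> carrier ?Q.
        map (proj V J) ys ! i \<otimes>\<^bsub>?Q\<^esub> a \<in> Idl\<^bsub>?Q\<^esub> (set (take i (map (proj V J) ys)))
          \<longrightarrow> a \<in> Idl\<^bsub>?Q\<^esub> (set (take i (map (proj V J) ys)))) \<longleftrightarrow> regs V J ys"
  proof -
    have "ys ! i \<in> vpoly V" if "i < length ys" for i using that ys by auto
    thus ?thesis unfolding regs_iff_nth carrier_Quot
      by (auto simp: proj_mult[OF J] mem)
  qed
  have 3: "Idl\<^bsub>?Q\<^esub> (set (map (proj V J) ys)) \<noteq> carrier ?Q \<longleftrightarrow> 1 \<notin> iadds V J ys"
  proof -
    have K: "pideal V (iadds V J ys)" by (rule pideal_iadds[OF J ys])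
    have "iadds V J ys = vpoly V" if "1 \<in> iadds V J ys"
      using pidealD(4)[OF K _ that] pidealD(1)[OF K] by fastforce
    moreover have "1 \<in> iadds V J ys" if "proj V J ` iadds V J ys = proj V J ` vpoly V"
      using proj_mem_image_iff[OF J K iadds_superset, of 1] that by auto
    ultimately show ?thesis unfolding Idl_Quot[OF J ys] carrier_Quot by blast
  qed
  show ?thesis unfolding regular_sequence_def using 1 2 3 by blast
qed

section \<open>Chains of primes in the quotient and chains of primes above the ideal\<close>

definition pprime :: "'v set \<Rightarrow> ('v, 'k::field) mpoly set \<Rightarrow> bool" where
  "pprime V K \<longleftrightarrow> pideal V K \<and> 1 \<notin> K \<and>
     (\<forall>a\<in>vpoly V. \<forall>b\<in>vpoly V. a * b \<in> K \<longrightarrow> a \<in> K \<or> b \<in> K)"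

lemma primeideal_Quot_imp_pprime:
  assumes J: "pideal V J" and P: "primeideal P (poly_ring V Quot J)"
  shows "pprime V (\<Union> P)"
proof -
  interpret P: primeideal P "poly_ring V Quot J" by fact
  have UP: "pideal V (\<Union> P)" by (rule pideal_Union[OF J P.is_ideal])
  note mem = proj_mem_iff[OF J P.a_subset]
  show ?thesis
    unfolding pprime_def
  proof (intro conjI ballI impI UP)
    show "1 \<notin> \<Union> P"
    proof
      assume "1 \<in> \<Union> P"
      hence "vpoly V \<subseteq> \<Union> P" using pidealD(4)[OF UP, of _ 1] by auto
      hence "carrier (poly_ring V Quot J) \<subseteq> P" using mem by (auto simp: carrier_Quot)
      thus False using P.I_notcarr P.a_subset by blast
    qed
    fix a b assume "a \<in> vpoly V" "b \<in> vpoly V" "a * b \<in> \<Union> P"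
    thus "a \<in> \<Union> P \<or> b \<in> \<Union> P"
      using P.I_prime[of "proj V J a" "proj V J b"] mem[of a] mem[of b] mem[of "a * b"]
        proj_mult[OF J, of a b]
      by (auto simp: carrier_Quot)
  qed
qed

lemma pprime_imp_primeideal_Quot:
  assumes J: "pideal V J" and K: "pprime V K" and JK: "J \<subseteq> K"
  shows "primeideal (proj V J ` K) (poly_ring V Quot J)"
proof (rule primeidealI)
  have K': "pideal V K" using K by (simp add: pprime_def)
  note mem = proj_mem_image_iff[OF J K' JK]
  show "ideal (proj V J ` K) (poly_ring V Quot J)" by (rule ideal_proj_image[OF J K'])
  show "cring (poly_ring V Quot J)"
    using J cring_poly_ring by (auto simp: pideal_iff_ideal intro: ideal.quotient_is_cring)
  have "proj V J 1 \<notin> proj V J ` K" using K mem[of 1] by (auto simp: pprime_def)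
  thus "carrier (poly_ring V Quot J) \<noteq> proj V J ` K" by (auto simp: carrier_Quot)
  fix x y assume "x \<in> carrier (poly_ring V Quot J)" "y \<in> carrier (poly_ring V Quot J)"
    and xy: "x \<otimes>\<^bsub>poly_ring V Quot J\<^esub> y \<in> proj V J ` K"
  then obtain a b where ab: "a \<in> vpoly V" "b \<in> vpoly V" "x = proj V J a" "y = proj V J b"
    by (auto simp: carrier_Quot)
  hence "a * b \<in> K" using xy mem[of "a * b"] by (auto simp: proj_mult[OF J])
  thus "x \<in> proj V J ` K \<or> y \<in> proj V J ` K" using K ab by (auto simp: pprime_def)
qed

lemma krull_dim_Quot_ge:
  assumes J: "pideal V J" and K: "\<And>i. i \<le> n \<Longrightarrow> pprime V (K i)" "\<And>i. i < n \<Longrightarrow> K i \<subset> K (Suc i)"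
    "\<And>i. i \<le> n \<Longrightarrow> J \<subseteq> K i"
  shows "enat n \<le> krull_dim (poly_ring V Quot J)"
proof -
  have "proj V J ` K i \<subset> proj V J ` K (Suc i)" if "i < n" for i
    using K(2)[OF that] K(1)[of i] K(1)[of "Suc i"] K(3)[of i] K(3)[of "Suc i"] that
      Union_proj_image[OF J, of "K i"] Union_proj_image[OF J, of "K (Suc i)"]
    unfolding pprime_def psubset_eq by (metis Suc_leI image_mono less_imp_le)
  moreover have "primeideal (proj V J ` K i) (poly_ring V Quot J)" if "i \<le> n" for i
    using that K by (intro pprime_imp_primeideal_Quot[OF J]) auto
  ultimately have "\<exists>P. (\<forall>i\<le>n. primeideal (P i) (poly_ring V Quot J)) \<and> (\<forall>i<n. P i \<subset> P (Suc i))"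
    by (intro exI[of _ "\<lambda>i. proj V J ` K i"]) blast
  thus ?thesis unfolding krull_dim_def by (intro Sup_upper) blast
qed

lemma krull_dim_Quot_le:
  assumes J: "pideal V J"
    and bound: "\<And>n K. \<lbrakk>\<And>i. i \<le> n \<Longrightarrow> pprime V (K i); \<And>i. i < n \<Longrightarrow> K i \<subset> K (Suc i);
      \<And>i. i \<le> n \<Longrightarrow> J \<subseteq> K i\<rbrakk> \<Longrightarrow> n \<le> d"
  shows "krull_dim (poly_ring V Quot J) \<le> enat d"
  unfolding krull_dim_def
proof (rule Sup_least, clarify)
  fix n P assume P: "\<forall>i\<le>n. primeideal (P i) (poly_ring V Quot J)" "\<forall>i<n. P i \<subset> P (Suc i)"
  have id: "ideal (P i) (poly_ring V Quot J)" if "i \<le> n" for i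
    using P(1) that by (auto dest: primeideal.axioms(1))
  have "n \<le> d"
  proof (rule bound)
    show "pprime V (\<Union> (P i))" if "i \<le> n" for i
      using primeideal_Quot_imp_pprime[OF J] P(1) that by blast
    show "J \<subseteq> \<Union> (P i)" if "i \<le> n" for i
      by (rule Union_superset[OF J id[OF that]])
    show "\<Union> (P i) \<subset> \<Union> (P (Suc i))" if "i < n" for i
      using P(2) that proj_image_Union[OF J id, of i] proj_image_Union[OF J id, of "Suc i"]
      by (metis Suc_leI Union_mono less_imp_le psubset_eq)
  qed
  thus "enat n \<le> enat d" by simp
qed

section \<open>Lower bound for the Krull dimension\<close>

text \<open>A lexicographic leading-term argument without an order on the variables: for each
  variable of \<open>W\<close> in turn only the exponents with the least value there are kept, and a
  sum of two minima can arise only from minima. It provides a coefficient of a product that cannot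
  cancel.\<close>

lemma unique_sum_of_exponents:
  fixes A B :: "('v \<Rightarrow>\<^sub>0 nat) set"
  assumes "finite W" "finite A" "A \<noteq> {}" "finite B" "B \<noteq> {}"
    and "\<And>a a' v. a \<in> A \<Longrightarrow> a' \<in> A \<Longrightarrow> v \<notin> W \<Longrightarrow> Poly_Mapping.lookup a v = Poly_Mapping.lookup a' v"
    and "\<And>b b' v. b \<in> B \<Longrightarrow> b' \<in> B \<Longrightarrow> v \<notin> W \<Longrightarrow> Poly_Mapping.lookup b v = Poly_Mapping.lookup b' v"
  shows "\<exists>a\<in>A. \<exists>b\<in>B. \<forall>a'\<in>A. \<forall>b'\<in>B. a' + b' = a + b \<longrightarrow> a' = a \<and> b' = b"
  using assms
proof (induction W arbitrary: A B rule: finite_induct)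
  case empty
  then obtain a b where "a \<in> A" "b \<in> B" by blast
  moreover have "a' = a" if "a' \<in> A" for a'
    using empty(5)[OF that \<open>a \<in> A\<close>] by (intro poly_mapping_eqI) auto
  moreover have "b' = b" if "b' \<in> B" for b'
    using empty(6)[OF that \<open>b \<in> B\<close>] by (intro poly_mapping_eqI) auto
  ultimately show ?case by blast
next
  case (insert v W)
  define f where "f = (\<lambda>a::'v \<Rightarrow>\<^sub>0 nat. Poly_Mapping.lookup a v)"
  define m n where "m = Min (f ` A)" and "n = Min (f ` B)"
  define A0 B0 where "A0 = {a \<in> A. f a = m}" and "B0 = {b \<in> B. f b = n}"
  have "m \<in> f ` A" "n \<in> f ` B"
    unfolding m_def n_def using insert.prems(1-4) by (intro Min_in; auto)+
  hence ne: "A0 \<noteq> {}" "B0 \<noteq> {}" by (auto simp: A0_def B0_def)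
  have le: "m \<le> f a" "n \<le> f b" if "a \<in> A" "b \<in> B" for a b
    unfolding m_def n_def using insert.prems(1,3) that by auto
  have "\<exists>a\<in>A0. \<exists>b\<in>B0. \<forall>a'\<in>A0. \<forall>b'\<in>B0. a' + b' = a + b \<longrightarrow> a' = a \<and> b' = b"
  proof (rule insert.IH)
    show "finite A0" "finite B0" using insert.prems(1,3) by (auto simp: A0_def B0_def)
    show "Poly_Mapping.lookup a u = Poly_Mapping.lookup a' u"
      if "a \<in> A0" "a' \<in> A0" "u \<notin> W" for a a' u
      using that insert.prems(5)[of a a' u] by (cases "u = v") (auto simp: A0_def f_def)
    show "Poly_Mapping.lookup a u = Poly_Mapping.lookup a' u"
      if "a \<in> B0" "a' \<in> B0" "u \<notin> W" for a a' u
      using that insert.prems(6)[of a a' u] by (cases "u = v") (auto simp: B0_def f_def)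
  qed (use ne in auto)
  then obtain a b where ab: "a \<in> A0" "b \<in> B0"
    "\<And>a' b'. a' \<in> A0 \<Longrightarrow> b' \<in> B0 \<Longrightarrow> a' + b' = a + b \<Longrightarrow> a' = a \<and> b' = b" by blast
  have "a' = a \<and> b' = b" if *: "a' \<in> A" "b' \<in> B" "a' + b' = a + b" for a' b'
  proof -
    have "f a' + f b' = m + n"
      using *(3) ab(1,2) by (metis (mono_tags, lifting) A0_def B0_def f_def lookup_add mem_Collect_eq)
    hence "f a' = m" "f b' = n" using le[OF *(1,2)] by auto
    thus ?thesis using * by (intro ab(3)) (auto simp: A0_def B0_def)
  qed
  thus ?case using ab(1,2) unfolding A0_def B0_def by blast
qed

text \<open>The ideal is generated by the variables of \<open>V\<close> outside \<open>G\<close>.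
  Among the exponents supported in \<open>G\<close> some sum is attained only once; terms with
  support not in \<open>G\<close> cannot contribute to it because supports unite under addition. So
  this coefficient of the product survives.\<close>

lemma pprime_sqideal:
  fixes V :: "'v set"
  assumes "finite G"
  shows "pprime V (sqideal V (\<lambda>S. \<not> S \<subseteq> G) :: ('v, 'k::field) mpoly set)"
proof -
  let ?K = "sqideal V (\<lambda>S. \<not> S \<subseteq> G) :: ('v, 'k) mpoly set"
  have "p * q \<notin> ?K" if pq: "p \<in> vpoly V" "q \<in> vpoly V" "p \<notin> ?K" "q \<notin> ?K" for p q
  proof -
    define A B where "A = {a \<in> Poly_Mapping.keys p. supp a \<subseteq> G}"
      and "B = {a \<in> Poly_Mapping.keys q. supp a \<subseteq> G}"
    have fin: "finite A" "A \<noteq> {}" "finite B" "B \<noteq> {}"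
      using pq by (auto simp: A_def B_def sqideal_def)
    have zero: "Poly_Mapping.lookup a v = 0" if "supp a \<subseteq> G" "v \<notin> G" for a :: "'v \<Rightarrow>\<^sub>0 nat" and v
      using that by (auto simp: in_keys_iff)
    have "\<exists>a\<in>A. \<exists>b\<in>B. \<forall>a'\<in>A. \<forall>b'\<in>B. a' + b' = a + b \<longrightarrow> a' = a \<and> b' = b"
      by (rule unique_sum_of_exponents[OF assms fin]) (auto simp: A_def B_def zero)
    then obtain a b where ab: "a \<in> A" "b \<in> B"
      "\<And>a' b'. a' \<in> A \<Longrightarrow> b' \<in> B \<Longrightarrow> a' + b' = a + b \<Longrightarrow> a' = a \<and> b' = b" by blast
    have supp_ab: "supp (a + b) \<subseteq> G" using ab by (auto simp: A_def B_def supp_add)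
    have unique: "l = a" if "l \<in> Poly_Mapping.keys p" "r \<in> Poly_Mapping.keys q" "a + b = l + r" for l r
    proof -
      have "supp l \<subseteq> G" "supp r \<subseteq> G" using supp_ab that(3) by (auto simp: supp_add)
      thus ?thesis using that ab(3)[of l r] by (auto simp: A_def B_def)
    qed
    have inner: "Poly_Mapping.lookup p l * (\<Sum>r. Poly_Mapping.lookup q r when a + b = l + r) =
        ((Poly_Mapping.lookup p a * Poly_Mapping.lookup q b) when l = a)" for l
    proof (cases "l = a")
      case False
      have "Poly_Mapping.lookup p l * (\<Sum>r. Poly_Mapping.lookup q r when a + b = l + r) = 0"
      proof (cases "l \<in> Poly_Mapping.keys p")
        case True
        have "(Poly_Mapping.lookup q r when a + b = l + r) = 0" for r
          using unique[OF True, of r] False by (auto simp: when_def in_keys_iff)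
        thus ?thesis by simp
      qed (simp add: in_keys_iff)
      thus ?thesis using False by simp
    qed simp
    have "Poly_Mapping.lookup (p * q) (a + b) = Poly_Mapping.lookup p a * Poly_Mapping.lookup q b"
      unfolding lookup_mult inner by simp
    also have "\<dots> \<noteq> 0" using ab by (auto simp: A_def B_def in_keys_iff)
    finally show ?thesis using supp_ab by (auto simp: sqideal_def in_keys_iff)
  qed
  moreover have "pideal V ?K"
    by (rule pideal_sqideal) (auto simp: mono_def)
  moreover have "1 \<notin> ?K" by (simp add: one_in_sqideal)
  ultimately show ?thesis unfolding pprime_def by blast
qed

lemma krull_dim_ge_card_face:
  fixes V :: "'v set"
  assumes "finite V" "mono \<Phi>" "F \<subseteq> V" "\<not> \<Phi> F"
  shows "enat (card F) \<le> krull_dim (poly_ring V Quot (sqideal V \<Phi> :: ('v, 'k::field) mpoly set))"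
proof -
  obtain fs where fs: "set fs = F" "distinct fs"
    using finite_distinct_list assms(1,3) finite_subset by metis
  \<comment> \<open>\<open>K 0\<close> is generated by the variables outside \<open>F\<close>, and
    each step adds the variable of one vertex of \<open>F\<close>.\<close>
  define K where "K = (\<lambda>i. sqideal V (\<lambda>S. \<not> S \<subseteq> set (drop i fs)) :: ('v, 'k) mpoly set)"
  have "enat (length fs) \<le> krull_dim (poly_ring V Quot (sqideal V \<Phi> :: ('v, 'k) mpoly set))"
  proof (rule krull_dim_Quot_ge)
    show "pideal V (sqideal V \<Phi> :: ('v, 'k) mpoly set)" by (rule pideal_sqideal[OF assms(2)])
    show "pprime V (K i)" for i unfolding K_def by (rule pprime_sqideal) simp
    show "sqideal V \<Phi> \<subseteq> K i" for i
      unfolding K_def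
    proof (rule sqideal_mono, rule notI)
      fix S assume "\<Phi> S" "S \<subseteq> set (drop i fs)"
      moreover have "set (drop i fs) \<subseteq> F" using fs set_drop_subset by fast
      ultimately show False using monoD[OF assms(2), of S F] assms(4) by auto
    qed
    show "K i \<subset> K (Suc i)" if i: "i < length fs" for i
    proof
      have "set (drop (Suc i) fs) \<subseteq> set (drop i fs)" by (rule set_drop_subset_set_drop) simp
      thus "K i \<subseteq> K (Suc i)" unfolding K_def by (intro sqideal_mono) auto
      have dr: "drop i fs = fs ! i # drop (Suc i) fs" using i by (rule Cons_nth_drop_Suc[symmetric])
      have "fs ! i \<notin> set (drop (Suc i) fs)"
        using distinct_drop[OF fs(2), of i] unfolding dr by simp
      moreover have "fs ! i \<in> V" using i fs(1) assms(3) nth_mem by blast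
      ultimately have "xmon {fs ! i} \<in> K (Suc i)" "xmon {fs ! i} \<notin> K i"
        unfolding K_def by (subst xmon_in_sqideal; simp add: dr)+
      thus "K i \<noteq> K (Suc i)" by blast
    qed
  qed
  thus ?thesis using fs distinct_card by fastforce
qed

section \<open>Upper bound for the Krull dimension\<close>

text \<open>Gaussian elimination. Its unknowns will be the coefficients of a polynomial relation,
  with one equation for each bounded exponent supported on a face.\<close>

lemma exists_nontrivial_solution:
  fixes f :: "'a \<Rightarrow> 'b \<Rightarrow> 'k::field"
  assumes "finite B" "finite A" "card B < card A"
  shows "\<exists>c. (\<exists>a\<in>A. c a \<noteq> 0) \<and> (\<forall>b\<in>B. (\<Sum>a\<in>A. c a * f a b) = 0)"
  using assms
proof (induction B arbitrary: A f rule: finite_induct)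
  case empty
  hence "A \<noteq> {}" by auto
  thus ?case by (intro exI[of _ "\<lambda>_. 1"]) auto
next
  case (insert b B)
  show ?case
  proof (cases "\<forall>a\<in>A. f a b = 0")
    case True
    have "card B < card A" using insert by simp
    from insert.IH[OF insert.prems(1) this] obtain c
      where "\<exists>a\<in>A. c a \<noteq> 0" "\<forall>b\<in>B. (\<Sum>a\<in>A. c a * f a b) = 0" by blast
    thus ?thesis using True by (intro exI[of _ c]) auto
  next
    case False
    then obtain a0 where a0: "a0 \<in> A" "f a0 b \<noteq> 0" by blast
    define A' where "A' = A - {a0}"
    \<comment> \<open>The system after elimination of the unknown \<open>a0\<close> by means of
      equation \<open>b\<close>; \<open>e\<close> below recovers the value at
      \<open>a0\<close>.\<close>
    define g where "g = (\<lambda>a b'. f a b' - f a b / f a0 b * f a0 b')"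
    have A': "finite A'" "card B < card A'" "A = insert a0 A'" "a0 \<notin> A'"
      using insert a0 by (auto simp: A'_def)
    from insert.IH[OF A'(1,2), of g] obtain c
      where c: "\<exists>a\<in>A'. c a \<noteq> 0" "\<And>b'. b' \<in> B \<Longrightarrow> (\<Sum>a\<in>A'. c a * g a b') = 0" by blast
    define e where "e = c(a0 := - (\<Sum>a\<in>A'. c a * f a b) / f a0 b)"
    have e: "(\<Sum>a\<in>A. e a * f a b') = (\<Sum>a\<in>A'. c a * g a b')" for b'
    proof -
      have "(\<Sum>a\<in>A'. e a * f a b') = (\<Sum>a\<in>A'. c a * f a b')"
        using A'(4) by (intro sum.cong) (auto simp: e_def)
      hence "(\<Sum>a\<in>A. e a * f a b') = e a0 * f a0 b' + (\<Sum>a\<in>A'. c a * f a b')"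
        using A' by simp
      also have "e a0 * f a0 b' = - (\<Sum>a\<in>A'. c a * (f a b / f a0 b * f a0 b'))"
        by (simp add: e_def sum_distrib_right sum_divide_distrib mult.assoc)
      also have "\<dots> + (\<Sum>a\<in>A'. c a * f a b') = (\<Sum>a\<in>A'. c a * g a b')"
        by (simp add: g_def right_diff_distrib sum_subtractf)
      finally show ?thesis .
    qed
    have "(\<Sum>a\<in>A. e a * f a b') = 0" if "b' \<in> insert b B" for b'
    proof (cases "b' = b")
      case True
      have "g a b = 0" for a using a0 by (simp add: g_def)
      thus ?thesis unfolding e True by simp
    qed (use that c(2) e in auto)
    moreover have "\<exists>a\<in>A. e a \<noteq> 0" using c(1) A'(3,4) by (auto simp: e_def)
    ultimately show ?thesis by blast
  qed
qed

fun power_product :: "('v, 'k::field) mpoly list \<Rightarrow> nat list \<Rightarrow> ('v, 'k) mpoly" where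
  "power_product (y # ys) (j # js) = y ^ j * power_product ys js"
| "power_product ys js = 1"

text \<open>A box of exponents rather than a bound on the total degree: its size is an exact power,
  and a sum over it splits along the first exponent.\<close>

definition exps :: "nat \<Rightarrow> nat \<Rightarrow> nat list set" where
  "exps N m = {js. set js \<subseteq> {..N} \<and> length js = m}"

lemma finite_exps: "finite (exps N m)" and card_exps: "card (exps N m) = Suc N ^ m"
  unfolding exps_def
  by (rule finite_lists_length_eq; simp) (subst card_lists_length_eq; simp)

lemma exps_0: "exps N 0 = {[]}"
  by (auto simp: exps_def)

lemma sum_exps_Suc: "(\<Sum>js\<in>exps N (Suc m). g js) = (\<Sum>j\<le>N. \<Sum>js\<in>exps N m. g (j # js))"
proof -
  have "exps N (Suc m) = (\<lambda>(j, js). j # js) ` ({..N} \<times> exps N m)"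
    by (auto simp: exps_def length_Suc_conv image_iff)
  moreover have "inj_on (\<lambda>(j, js). j # js) ({..N} \<times> exps N m)"
    by (auto simp: inj_on_def)
  ultimately show ?thesis
    by (simp add: sum.reindex sum.cartesian_product case_prod_unfold)
qed

lemma vpoly_power_product: "set ys \<subseteq> vpoly V \<Longrightarrow> power_product ys js \<in> vpoly V"
  by (induction ys js rule: power_product.induct) (auto intro: vpoly_power)

lemma pprime_power:
  assumes "pprime V K" "y \<in> vpoly V" "y \<notin> K"
  shows "y ^ n \<notin> K"
proof (induction n)
  case 0
  thus ?case using assms(1) by (simp add: pprime_def)
next
  case (Suc n)
  thus ?case using assms vpoly_power[of y V n] unfolding pprime_def power_Suc by blast
qed

text \<open>A polynomial relation between elements \<open>y\<^sub>i \<in> K\<^sub>i\<^sub>+\<^sub>1 - K\<^sub>i\<close> along a chain of primes is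
  impossible: cancel the lowest power of \<open>y\<^sub>0\<close> and reduce modulo \<open>K\<^sub>1\<close>.\<close>

lemma no_relation_along_prime_chain:
  fixes ys :: "('v, 'k::field) mpoly list"
  assumes "\<And>i. i \<le> length ys \<Longrightarrow> pprime V (K i)" "\<And>i. i < length ys \<Longrightarrow> K i \<subseteq> K (Suc i)"
    and "\<And>i. i < length ys \<Longrightarrow> ys ! i \<in> K (Suc i) - K i"
    and "\<exists>js\<in>exps N (length ys). c js \<noteq> 0"
  shows "(\<Sum>js\<in>exps N (length ys). Poly_Mapping.single 0 (c js) * power_product ys js) \<notin> K 0"
  using assms
proof (induction ys arbitrary: K c)
  case Nil
  have K: "pprime V (K 0)" using Nil(1) by simp
  hence pK: "pideal V (K 0)" by (simp add: pprime_def)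
  have "c [] \<noteq> 0" using Nil(4) by (simp add: exps_0)
  hence "Poly_Mapping.single 0 (inverse (c [])) * Poly_Mapping.single 0 (c []) = (1 :: ('v, 'k) mpoly)"
    by (simp add: mult_single)
  hence "Poly_Mapping.single 0 (c []) \<notin> K 0"
    using pidealD(4)[OF pK, of "Poly_Mapping.single 0 (inverse (c []))" "Poly_Mapping.single 0 (c [])"] K
    by (auto simp: pprime_def vpoly_single)
  thus ?case by (simp add: exps_0)
next
  case (Cons y ys)
  \<comment> \<open>The coefficient of \<open>y ^ j\<close> in the relation. Unless all of its own
    coefficients vanish, the induction hypothesis for the chain starting at \<open>K 1\<close> keeps
    it outside \<open>K 1\<close>.\<close>
  define E where "E = (\<lambda>j. \<Sum>js\<in>exps N (length ys). Poly_Mapping.single 0 (c (j # js)) * power_product ys js)"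
  have K: "pprime V (K i)" if "i \<le> Suc (length ys)" for i using Cons.prems(1) that by simp
  have pK: "pideal V (K i)" if "i \<le> Suc (length ys)" for i using K[OF that] by (simp add: pprime_def)
  have y: "y \<in> K 1" "y \<notin> K 0" using Cons.prems(3)[of 0] by auto
  have yV: "y \<in> vpoly V" using y(1) pidealD(1)[OF pK[of 1]] by simp
  have ysV: "set ys \<subseteq> vpoly V"
  proof
    fix x assume "x \<in> set ys"
    then obtain i where i: "i < length ys" "x = ys ! i" by (auto simp: in_set_conv_nth)
    thus "x \<in> vpoly V"
      using Cons.prems(3)[of "Suc i"] pidealD(1)[OF pK[of "Suc (Suc i)"]] by auto
  qed
  have EV: "E j \<in> vpoly V" for j
    unfolding E_def by (intro vpoly_sum vpoly_closed(4) vpoly_power_product[OF ysV] vpoly_single) auto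
  have E1: "E j \<notin> K 1" if "\<exists>js\<in>exps N (length ys). c (j # js) \<noteq> 0" for j
  proof -
    have "E j \<notin> (\<lambda>i. K (Suc i)) 0"
      unfolding E_def
    proof (rule Cons.IH)
      show "pprime V (K (Suc i))" if "i \<le> length ys" for i using K that by simp
      show "K (Suc i) \<subseteq> K (Suc (Suc i))" if "i < length ys" for i using Cons.prems(2) that by simp
      show "ys ! i \<in> K (Suc (Suc i)) - K (Suc i)" if "i < length ys" for i
        using Cons.prems(3)[of "Suc i"] that by simp
    qed (rule that)
    thus ?thesis by simp
  qed
  define P where "P = (\<lambda>j. \<exists>js\<in>exps N (length ys). c (j # js) \<noteq> 0)"
  have "\<exists>j\<le>N. P j"
    using Cons.prems(4) by (fastforce simp: P_def exps_def length_Suc_conv)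
  define j where "j = (LEAST j. P j)"
  have j: "P j" "j \<le> N" "\<And>i. i < j \<Longrightarrow> \<not> P i"
    using \<open>\<exists>j\<le>N. P j\<close> LeastI_ex[of P] not_less_Least[of _ P] Least_le[of P]
    unfolding j_def by (blast, meson le_trans, blast)
  have E0: "E i = 0" if "i < j" for i
    using j(3)[OF that] by (simp add: E_def P_def)
  define r where "r = (\<Sum>i\<in>{j<..N}. y ^ (i - j) * E i)"
  have "(\<Sum>i\<le>N. y ^ i * E i) = (\<Sum>i\<in>{j..N}. y ^ i * E i)"
    by (rule sum.mono_neutral_right) (auto simp: E0)
  also have "\<dots> = y ^ j * E j + (\<Sum>i\<in>{j<..N}. y ^ i * E i)"
    using j(2) by (simp add: sum.head)
  also have "(\<Sum>i\<in>{j<..N}. y ^ i * E i) = y ^ j * r"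
    unfolding r_def sum_distrib_left
    by (intro sum.cong) (auto simp flip: power_add mult.assoc)
  finally have total: "(\<Sum>i\<le>N. y ^ i * E i) = y ^ j * (E j + r)" by (simp add: distrib_left)
  have "r \<in> K 1"
    unfolding r_def
  proof (rule pideal_sum[OF pK])
    fix i assume i: "i \<in> {j<..N}"
    then obtain m where "i - j = Suc m" by (metis Suc_diff_Suc greaterThanAtMost_iff)
    hence "y ^ (i - j) * E i = (y ^ m * E i) * y" by (simp add: mult_ac)
    thus "y ^ (i - j) * E i \<in> K 1"
      using y(1) EV vpoly_power[OF yV] pidealD(4)[OF pK[of 1]] by auto
  qed simp
  moreover have "E j \<notin> K 1" using E1 j(1) by (simp add: P_def)
  ultimately have "E j + r \<notin> K 1"
    using pidealD(7)[OF pK[of 1], of "E j + r" r] by auto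
  hence "E j + r \<notin> K 0" using Cons.prems(2)[of 0] by auto
  moreover have "E j + r \<in> vpoly V"
    using EV \<open>r \<in> K 1\<close> pidealD(1)[OF pK[of 1]] by auto
  ultimately have "y ^ j * (E j + r) \<notin> K 0"
    using K[of 0] pprime_power[OF K[of 0] yV y(2)] vpoly_power[OF yV] unfolding pprime_def by blast
  moreover have "(\<Sum>js\<in>exps N (length (y # ys)). Poly_Mapping.single 0 (c js) * power_product (y # ys) js)
      = (\<Sum>i\<le>N. y ^ i * E i)"
    by (simp add: sum_exps_Suc E_def sum_distrib_left mult_ac)
  ultimately show ?case unfolding total by simp
qed

section \<open>Bounded exponents and the count of monomials supported on faces\<close>

definition exp_le :: "nat \<Rightarrow> ('v, 'k::field) mpoly \<Rightarrow> bool" where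
  "exp_le M p \<longleftrightarrow> (\<forall>a\<in>Poly_Mapping.keys p. \<forall>v. Poly_Mapping.lookup a v \<le> M)"

lemma exp_le_mult: "exp_le M p \<Longrightarrow> exp_le N q \<Longrightarrow> exp_le (M + N) (p * q)"
  unfolding exp_le_def by (auto elim!: keys_mult_cases simp: lookup_add add_mono)

lemma exp_le_mono: "exp_le M p \<Longrightarrow> M \<le> N \<Longrightarrow> exp_le N p"
  unfolding exp_le_def by (meson le_trans)

lemma exp_le_power: "exp_le M p \<Longrightarrow> exp_le (n * M) (p ^ n)"
proof (induction n)
  case 0
  show ?case by (auto simp: exp_le_def)
next
  case (Suc n)
  thus ?case using exp_le_mult[of M p "n * M" "p ^ n"] by simp
qed

lemma exp_le_power_product:
  assumes "\<And>y. y \<in> set ys \<Longrightarrow> exp_le D y" "js \<in> exps N (length ys)"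
  shows "exp_le (length ys * (N * D)) (power_product ys js)"
  using assms
proof (induction ys arbitrary: js)
  case Nil
  thus ?case by (auto simp: exps_def exp_le_def)
next
  case (Cons y ys)
  then obtain i rs where js: "js = i # rs" "i \<le> N" "rs \<in> exps N (length ys)"
    by (auto simp: exps_def length_Suc_conv)
  have "exp_le (N * D) (y ^ i)"
    using exp_le_mono[OF exp_le_power[of D y i]] Cons.prems(1) js(2) by simp
  from exp_le_mult[OF this Cons.IH[OF Cons.prems(1) js(3)]] show ?case
    by (simp add: js(1))
qed

lemma exp_le_exists:
  assumes "finite Y"
  shows "\<exists>D. \<forall>y\<in>Y. exp_le D y"
proof -
  define X where "X = (\<Union>y\<in>Y. \<Union>a\<in>Poly_Mapping.keys y. Poly_Mapping.lookup a ` supp a)"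
  have "finite X" using assms by (auto simp: X_def)
  then obtain D where D: "\<And>x. x \<in> X \<Longrightarrow> x \<le> D" using finite_nat_set_iff_bounded_le by auto
  have "Poly_Mapping.lookup a v \<le> D" if "y \<in> Y" "a \<in> Poly_Mapping.keys y" for y a v
  proof (cases "v \<in> supp a")
    case True
    thus ?thesis using that by (intro D) (auto simp: X_def)
  qed (simp add: in_keys_iff)
  thus ?thesis unfolding exp_le_def by blast
qed

lemma finite_bounded_exponents:
  fixes S :: "'v set" and M :: nat
  assumes "finite S"
  defines "B \<equiv> {b :: 'v \<Rightarrow>\<^sub>0 nat. supp b \<subseteq> S \<and> (\<forall>v. Poly_Mapping.lookup b v \<le> M)}"
  shows "finite B" "card B \<le> Suc M ^ card S"
proof -
  define g where "g = (\<lambda>b::'v \<Rightarrow>\<^sub>0 nat. restrict (Poly_Mapping.lookup b) S)"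
  have inj: "inj_on g B"
  proof (rule inj_onI, rule poly_mapping_eqI)
    fix a b v assume ab: "a \<in> B" "b \<in> B" "g a = g b"
    show "Poly_Mapping.lookup a v = Poly_Mapping.lookup b v"
    proof (cases "v \<in> S")
      case True
      thus ?thesis using fun_cong[OF ab(3), of v] by (simp add: g_def)
    next
      case False
      hence "v \<notin> supp a" "v \<notin> supp b" using ab by (auto simp: B_def)
      thus ?thesis by (simp add: in_keys_iff)
    qed
  qed
  have sub: "g ` B \<subseteq> S \<rightarrow>\<^sub>E {..M}" by (auto simp: g_def B_def)
  have fin: "finite (S \<rightarrow>\<^sub>E {..M})" using assms(1) by (intro finite_PiE) auto
  show "finite B" using inj sub fin by (meson finite_imageD finite_subset)
  have "card B \<le> card (S \<rightarrow>\<^sub>E {..M})" by (rule card_inj_on_le[OF inj sub fin])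
  thus "card B \<le> Suc M ^ card S" using assms(1) by (simp add: card_PiE)
qed

text \<open>A growth argument. With exponents up to \<open>C\<close>, the power products of
  \<open>d + 1\<close> elements number \<open>(C + 1) ^ (d + 1)\<close>, whereas modulo the ideal
  they involve only monomials supported on faces, whose number grows like \<open>C ^ d\<close>. For
  large \<open>C\<close> some nontrivial combination lies in the ideal, hence in \<open>K 0\<close>,
  which a chain longer than \<open>d\<close> forbids.\<close>

lemma prime_chain_length_le:
  fixes V :: "'v set" and K :: "nat \<Rightarrow> ('v, 'k::field) mpoly set"
  assumes V: "finite V" and d: "\<And>S. S \<subseteq> V \<Longrightarrow> \<not> \<Phi> S \<Longrightarrow> card S \<le> d"
    and K: "\<And>i. i \<le> n \<Longrightarrow> pprime V (K i)" "\<And>i. i < n \<Longrightarrow> K i \<subset> K (Suc i)"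
    "sqideal V \<Phi> \<subseteq> K 0"
  shows "n \<le> d"
proof (rule ccontr)
  assume "\<not> n \<le> d"
  hence dn: "Suc d \<le> n" by simp
  have "\<exists>y. y \<in> K (Suc i) - K i" if "i < n" for i using K(2)[OF that] by blast
  then obtain y where y: "\<And>i. i < n \<Longrightarrow> y i \<in> K (Suc i) - K i" by metis
  define ys where "ys = map y [0..<Suc d]"
  have len: "length ys = Suc d" by (simp add: ys_def)
  have ysV: "set ys \<subseteq> vpoly V"
  proof
    fix x assume "x \<in> set ys"
    then obtain i where i: "i < Suc d" "x = y i" unfolding ys_def by (auto simp del: upt_Suc)
    hence "pideal V (K (Suc i))" using K(1)[of "Suc i"] dn by (simp add: pprime_def)
    thus "x \<in> vpoly V" using y[of i] i dn pidealD(1) by force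
  qed
  obtain D where D: "\<And>y. y \<in> set ys \<Longrightarrow> exp_le D y" using exp_le_exists[of "set ys"] by auto
  \<comment> \<open>Chosen to make the count strict. The factor \<open>2 ^ card V\<close> bounds the
    number of faces, and \<open>M\<close> below bounds the exponents of the power products. As
    \<open>Suc M\<close> is at most \<open>Suc (Suc d * D) * Suc C\<close>, there are at most
    \<open>C * Suc C ^ d\<close> equations, fewer than the \<open>Suc C ^ Suc d\<close>
    unknowns.\<close>
  define C where "C = 2 ^ card V * Suc (Suc d * D) ^ d"
  define M where "M = Suc d * (C * D)"
  define Bs where "Bs = (\<lambda>S. {b :: 'v \<Rightarrow>\<^sub>0 nat. supp b \<subseteq> S \<and> (\<forall>v. Poly_Mapping.lookup b v \<le> M)})"
  define F where "F = {S. S \<subseteq> V \<and> \<not> \<Phi> S}"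
  have F: "finite F" "card F \<le> 2 ^ card V"
  proof -
    have "F \<subseteq> Pow V" by (auto simp: F_def)
    thus "finite F" "card F \<le> 2 ^ card V"
      using V card_mono[of "Pow V" F] by (auto simp: card_Pow finite_subset)
  qed
  have finS: "finite S" if "S \<in> F" for S using that V by (auto simp: F_def finite_subset)
  have finB: "finite (\<Union>S\<in>F. Bs S)"
    using F(1) finite_bounded_exponents(1)[OF finS] by (auto simp: Bs_def)
  have "card (\<Union>S\<in>F. Bs S) \<le> (\<Sum>S\<in>F. card (Bs S))" by (rule card_UN_le[OF F(1)])
  also have "\<dots> \<le> (\<Sum>S\<in>F. Suc M ^ d)"
  proof (rule sum_mono)
    fix S assume S: "S \<in> F"
    have "card (Bs S) \<le> Suc M ^ card S"
      unfolding Bs_def by (rule finite_bounded_exponents(2)[OF finS[OF S]])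
    also have "\<dots> \<le> Suc M ^ d" using S d by (intro power_increasing) (auto simp: F_def)
    finally show "card (Bs S) \<le> Suc M ^ d" .
  qed
  also have "\<dots> \<le> 2 ^ card V * Suc M ^ d" using F(2) by simp
  also have "\<dots> \<le> 2 ^ card V * (Suc (Suc d * D) * Suc C) ^ d"
    by (intro mult_le_mono2 power_mono) (auto simp: M_def algebra_simps)
  also have "\<dots> = C * Suc C ^ d" unfolding power_mult_distrib by (simp only: C_def mult.assoc)
  also have "\<dots> < Suc C ^ Suc d" by simp
  also have "\<dots> = card (exps C (length ys))" by (simp add: card_exps len)
  finally have "card (\<Union>S\<in>F. Bs S) < card (exps C (length ys))" .
  from exists_nontrivial_solution[OF finB finite_exps this,
      of "\<lambda>js b. Poly_Mapping.lookup (power_product ys js) b"]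
  obtain c where c: "\<exists>js\<in>exps C (length ys). c js \<noteq> 0"
    "\<And>b. b \<in> (\<Union>S\<in>F. Bs S) \<Longrightarrow>
      (\<Sum>js\<in>exps C (length ys). c js * Poly_Mapping.lookup (power_product ys js) b) = 0"
    by blast
  define T where "T = (\<Sum>js\<in>exps C (length ys). Poly_Mapping.single 0 (c js) * power_product ys js)"
  have look: "Poly_Mapping.lookup T b =
      (\<Sum>js\<in>exps C (length ys). c js * Poly_Mapping.lookup (power_product ys js) b)" for b
    unfolding T_def lookup_sum using lookup_single_mult[of 0] by (intro sum.cong) auto
  have "T \<in> sqideal V \<Phi>"
    unfolding sqideal_def
  proof safe
    show TV: "T \<in> vpoly V"
      unfolding T_def by (intro vpoly_sum vpoly_closed(4) vpoly_power_product[OF ysV] vpoly_single) auto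
    fix b assume b: "b \<in> Poly_Mapping.keys T"
    \<comment> \<open>An exponent of \<open>T\<close> supported on a face is bounded by
      \<open>M\<close>, so its coefficient is among those that the choice of \<open>c\<close> makes
      zero.\<close>
    show "\<Phi> (supp b)"
    proof (rule ccontr)
      assume n\<Phi>: "\<not> \<Phi> (supp b)"
      have "(\<Sum>js\<in>exps C (length ys). c js * Poly_Mapping.lookup (power_product ys js) b) \<noteq> 0"
        using b by (simp add: in_keys_iff look)
      then obtain js where js: "js \<in> exps C (length ys)" "b \<in> Poly_Mapping.keys (power_product ys js)"
        by (metis (no_types, lifting) in_keys_iff mult_zero_right sum.neutral)
      hence "\<forall>v. Poly_Mapping.lookup b v \<le> M"
        using exp_le_power_product[OF D js(1)] by (auto simp: exp_le_def len M_def)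
      hence "b \<in> (\<Union>S\<in>F. Bs S)"
        using TV b n\<Phi> by (auto simp: Bs_def F_def vpoly_iff)
      from c(2)[OF this] b show False by (simp add: in_keys_iff look)
    qed
  qed
  moreover have "T \<notin> K 0"
    unfolding T_def
  proof (rule no_relation_along_prime_chain[OF _ _ _ c(1)])
    fix i
    show "pprime V (K i)" if "i \<le> length ys" using K(1) that dn len by simp
    show "K i \<subseteq> K (Suc i)" if "i < length ys" using K(2)[of i] that dn len by auto
    show "ys ! i \<in> K (Suc i) - K i" if "i < length ys"
      using y[of i] that dn unfolding ys_def by (simp del: upt_Suc)
  qed
  ultimately show False using K(3) by blast
qed

lemma krull_dim_le:
  fixes V :: "'v set"
  assumes "finite V" "mono \<Phi>" "\<And>S. S \<subseteq> V \<Longrightarrow> \<not> \<Phi> S \<Longrightarrow> card S \<le> d"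
  shows "krull_dim (poly_ring V Quot (sqideal V \<Phi> :: ('v, 'k::field) mpoly set)) \<le> enat d"
proof (rule krull_dim_Quot_le[OF pideal_sqideal[OF assms(2)]])
  fix n and K :: "nat \<Rightarrow> ('v, 'k) mpoly set"
  assume K: "\<And>i. i \<le> n \<Longrightarrow> pprime V (K i)" "\<And>i. i < n \<Longrightarrow> K i \<subset> K (Suc i)"
    "\<And>i. i \<le> n \<Longrightarrow> sqideal V \<Phi> \<subseteq> K i"
  show "n \<le> d" by (rule prime_chain_length_le[OF assms(1,3) K(1,2) K(3)[of 0]]) auto
qed

section \<open>Cohen--Macaulay quotients by squarefree monomial ideals\<close>

lemma depth_le_card_facet:
  fixes V :: "'v set"
  defines "m \<equiv> (irrelevant_ideal V :: ('v, 'k::field) mpoly set)"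
  assumes "finite V" "mono \<Phi>" "F \<subseteq> V" "\<not> \<Phi> F" "\<And>v. v \<in> V - F \<Longrightarrow> \<Phi> (insert v F)"
  shows "depth_at (poly_ring V Quot sqideal V \<Phi>) (proj V (sqideal V \<Phi>) ` m) \<le> enat (card F)"
  unfolding depth_at_def
proof (rule Sup_least, clarify)
  define J where "J = (sqideal V \<Phi> :: ('v, 'k) mpoly set)"
  have J: "pideal V J" unfolding J_def by (rule pideal_sqideal[OF assms(3)])
  fix xs assume xs: "regular_sequence (poly_ring V Quot sqideal V \<Phi>) xs"
    "set xs \<subseteq> proj V (sqideal V \<Phi>) ` m"
  have "\<forall>x\<in>set xs. \<exists>y\<in>m. x = proj V J y" using xs(2) by (auto simp: J_def)
  then obtain g where g: "\<And>x. x \<in> set xs \<Longrightarrow> g x \<in> m \<and> x = proj V J (g x)" by metis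
  define ys where "ys = map g xs"
  have "map (\<lambda>x. proj V J (g x)) xs = xs" by (rule map_idI) (use g in metis)
  hence xs_eq: "xs = map (proj V J) ys" by (simp add: ys_def comp_def)
  have ys: "set ys \<subseteq> m" using g by (auto simp: ys_def)
  have "regs V J ys"
    using xs(1) regular_sequence_Quot_iff[OF J, of ys] ys irrelevant_ideal_subset[of V]
    unfolding J_def[symmetric] xs_eq m_def by blast
  hence "length ys \<le> card F"
    using assms ys unfolding J_def m_def by (intro regs_length_le_card_facet[where \<Phi> = \<Phi> and V = V])
  thus "enat (length xs) \<le> enat (card F)" by (simp add: ys_def)
qed

lemma irrelevant_ideal_subset_sqideal: "irrelevant_ideal V \<subseteq> sqideal V (\<lambda>S. S \<noteq> {})"
proof -
  have "mono (\<lambda>S::'a set. S \<noteq> {})" by (auto simp: mono_def)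
  thus ?thesis
    unfolding irrelevant_ideal_def
    by (intro Idl_subset pideal_sqideal) (auto simp: Var_eq_xmon xmon_in_sqideal)
qed

text \<open>The ideal and all the parameters consist of polynomials without constant term, so the
  ideal that they generate together is proper.\<close>

lemma le_depth_at:
  fixes V :: "'v set" and ys :: "('v, 'k::field) mpoly list"
  assumes "mono \<Phi>" "\<not> \<Phi> {}" "regs V (sqideal V \<Phi>) ys" "set ys \<subseteq> irrelevant_ideal V"
  shows "enat (length ys) \<le>
    depth_at (poly_ring V Quot sqideal V \<Phi>)
      (proj V (sqideal V \<Phi>) ` (irrelevant_ideal V :: ('v, 'k) mpoly set))"
proof -
  define J where "J = (sqideal V \<Phi> :: ('v, 'k) mpoly set)"
  have J: "pideal V J" unfolding J_def by (rule pideal_sqideal[OF assms(1)])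
  have ysV: "set ys \<subseteq> vpoly V" using assms(4) irrelevant_ideal_subset by blast
  have mono: "mono (\<lambda>S::'v set. S \<noteq> {})" by (auto simp: mono_def)
  have "iadds V J ys \<subseteq> sqideal V (\<lambda>S. S \<noteq> {})"
    using assms irrelevant_ideal_subset_sqideal
    by (intro iadds_least pideal_sqideal[OF mono]) (auto simp: J_def intro!: sqideal_mono)
  moreover have "1 \<notin> (sqideal V (\<lambda>S. S \<noteq> {}) :: ('v, 'k) mpoly set)" by (simp add: one_in_sqideal)
  ultimately have "1 \<notin> iadds V J ys" by (rule contra_subsetD)
  hence "regular_sequence (poly_ring V Quot J) (map (proj V J) ys)"
    using assms(3) regular_sequence_Quot_iff[OF J ysV] by (simp add: J_def)
  hence "enat (length (map (proj V J) ys)) \<le> depth_at (poly_ring V Quot J) (proj V J ` irrelevant_ideal V)"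
    unfolding depth_at_def using assms(4) by (intro Sup_upper) fastforce
  thus ?thesis by (simp add: J_def)
qed

text \<open>Purity of the complex: the dimension is at least the size of any face, the depth at most
  the size of any facet.\<close>

theorem cohen_macaulay_imp_card_le_facet:
  fixes V :: "'v set"
  assumes "finite V" "mono \<Phi>"
    and "cohen_macaulay_quotient V (sqideal V \<Phi> :: ('v, 'k::field) mpoly set)"
    and "F \<subseteq> V" "\<not> \<Phi> F" "\<And>v. v \<in> V - F \<Longrightarrow> \<Phi> (insert v F)"
    and "G \<subseteq> V" "\<not> \<Phi> G"
  shows "card G \<le> card F"
proof -
  have "enat (card G) \<le> krull_dim (poly_ring V Quot (sqideal V \<Phi> :: ('v, 'k) mpoly set))"
    using assms by (intro krull_dim_ge_card_face) auto
  also have "\<dots> \<le> enat (card F)"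
    using assms(3) depth_le_card_facet[OF assms(1,2,4-6)]
    unfolding cohen_macaulay_quotient_def by metis
  finally show ?thesis by simp
qed

text \<open>Any facet \<open>F\<close> closes the circle \<open>length ys\<close> \<le> depth \<le>
  \<open>card F\<close> \<le> dimension \<le> \<open>length ys\<close>.\<close>

theorem cohen_macaulayI:
  fixes V :: "'v set" and ys :: "('v, 'k::field) mpoly list"
  assumes "finite V" "mono \<Phi>" "\<not> \<Phi> {}"
    and "regs V (sqideal V \<Phi>) ys" "set ys \<subseteq> irrelevant_ideal V"
    and d: "\<And>S. S \<subseteq> V \<Longrightarrow> \<not> \<Phi> S \<Longrightarrow> card S \<le> length ys"
  shows "cohen_macaulay_quotient V (sqideal V \<Phi> :: ('v, 'k) mpoly set)"
proof -
  define \<F> where "\<F> = {S. S \<subseteq> V \<and> \<not> \<Phi> S}"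
  have "finite \<F>" unfolding \<F>_def by (rule finite_subset[of _ "Pow V"]) (use assms(1) in auto)
  moreover have "{} \<in> \<F>" using assms(3) by (simp add: \<F>_def)
  ultimately obtain F where F: "F \<in> \<F>" "\<And>S. S \<in> \<F> \<Longrightarrow> F \<subseteq> S \<Longrightarrow> F = S"
    using finite_has_maximal[of \<F>] by blast
  have facet: "\<Phi> (insert v F)" if "v \<in> V - F" for v
    using F(1) F(2)[of "insert v F"] that by (auto simp: \<F>_def)
  have F': "F \<subseteq> V" "\<not> \<Phi> F" using F(1) by (auto simp: \<F>_def)
  let ?Q = "poly_ring V Quot (sqideal V \<Phi> :: ('v, 'k) mpoly set)"
  let ?m = "proj V (sqideal V \<Phi>) ` (irrelevant_ideal V :: ('v, 'k) mpoly set)"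
  have 1: "enat (length ys) \<le> depth_at ?Q ?m" by (rule le_depth_at[OF assms(2-5)])
  have 2: "depth_at ?Q ?m \<le> enat (card F)"
    by (rule depth_le_card_facet[OF assms(1,2) F' facet])
  have 3: "enat (card F) \<le> krull_dim ?Q" by (rule krull_dim_ge_card_face[OF assms(1,2) F'])
  have 4: "krull_dim ?Q \<le> enat (length ys)" by (rule krull_dim_le[OF assms(1,2) d])
  show ?thesis unfolding cohen_macaulay_quotient_def using 1 2 3 4 by (meson order.antisym order.trans)
qed

section \<open>Matchings and squarefree powers of edge ideals\<close>

definition has_matching :: "'v set set \<Rightarrow> nat \<Rightarrow> 'v set \<Rightarrow> bool" where
  "has_matching E k S \<longleftrightarrow> (\<exists>M\<subseteq>E. finite M \<and> card M = k \<and> pairwise disjnt M \<and> \<Union> M \<subseteq> S)"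

lemma has_matchingD: "has_matching E k S \<Longrightarrow> S \<subseteq> T \<Longrightarrow> has_matching E k T"
  unfolding has_matching_def by (elim exE conjE, rule exI) (intro conjI, assumption+, rule order_trans)

lemma mono_has_matching: "mono (has_matching E k)"
  by (rule monoI) (auto intro: has_matchingD)

lemma has_matching_less:
  assumes "has_matching E k S" "j \<le> k"
  shows "has_matching E j S"
proof -
  obtain M where M: "M \<subseteq> E" "finite M" "card M = k" "pairwise disjnt M" "\<Union> M \<subseteq> S"
    using assms(1) by (auto simp: has_matching_def)
  obtain M' where "M' \<subseteq> M" "card M' = j" "finite M'"
    using obtain_subset_with_card_n[of j M] M(3) assms(2) by blast
  thus ?thesis unfolding has_matching_def
    using M by (intro exI[of _ M']) (auto intro: pairwise_subset)
qed

lemma has_matching_1: "has_matching E 1 S \<longleftrightarrow> (\<exists>e\<in>E. e \<subseteq> S)"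
proof
  assume "\<exists>e\<in>E. e \<subseteq> S"
  then obtain e where "e \<in> E" "e \<subseteq> S" by blast
  thus "has_matching E 1 S" unfolding has_matching_def by (intro exI[of _ "{e}"]) auto
qed (auto simp: has_matching_def card_1_singleton_iff)

lemma simple_graphD:
  assumes "simple_graph V E"
  shows "finite V" "e \<in> E \<Longrightarrow> finite e" "e \<in> E \<Longrightarrow> e \<subseteq> V" "e \<in> E \<Longrightarrow> e \<noteq> {}"
  using assms by (auto simp: simple_graph_def)

lemma simple_graph_edge:
  assumes "simple_graph V E" "e \<in> E" "x \<in> e"
  obtains y where "e = {x, y}" "y \<noteq> x" "x \<in> V" "y \<in> V"
  using assms unfolding simple_graph_def by (metis empty_iff insertE insert_commute)

lemma edge_ideal_eq:
  fixes V :: "'v set"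
  assumes G: "simple_graph V E"
  shows "(edge_ideal V E :: ('v, 'k::field) mpoly set) = sqideal V (\<lambda>S. \<exists>e\<in>E. e \<subseteq> S)"
proof -
  let ?gen = "{Var x * Var y | x y. {x, y} \<in> E} :: ('v, 'k) mpoly set"
  have gen: "?gen = xmon ` E"
  proof -
    have V: "Var x * Var y = (xmon {x, y} :: ('v, 'k) mpoly)" if "{x, y} \<in> E" for x y
    proof -
      have "x \<noteq> y" using G that by (auto simp: simple_graph_def doubleton_eq_iff)
      thus ?thesis by (simp add: Var_eq_xmon insert_commute flip: xmon_Un)
    qed
    have "\<exists>x y. e = {x, y}" if "e \<in> E" for e using G that unfolding simple_graph_def by blast
    thus ?thesis using V by (auto simp: image_iff) metis
  qed
  have mono: "mono (\<lambda>S. \<exists>e\<in>E. e \<subseteq> S)" by (auto simp: mono_def)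
  have sub: "?gen \<subseteq> vpoly V" unfolding gen using simple_graphD[OF G] by auto
  show ?thesis
    unfolding edge_ideal_def
  proof
    show "Idl\<^bsub>poly_ring V\<^esub> ?gen \<subseteq> sqideal V (\<lambda>S. \<exists>e\<in>E. e \<subseteq> S)"
      unfolding gen using simple_graphD[OF G]
      by (intro Idl_subset pideal_sqideal mono) (auto simp: xmon_in_sqideal)
    show "sqideal V (\<lambda>S. \<exists>e\<in>E. e \<subseteq> S) \<subseteq> Idl\<^bsub>poly_ring V\<^esub> ?gen"
    proof (rule sqideal_subset[OF pideal_Idl[OF sub]])
      fix a c assume a: "supp a \<subseteq> V" "\<exists>e\<in>E. e \<subseteq> supp a"
      then obtain e where e: "e \<in> E" "e \<subseteq> supp a" by blast
      have "supp (a - indic e) \<subseteq> V" using a(1) by (auto simp: in_keys_iff lookup_minus)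
      hence "xmon e * Poly_Mapping.single (a - indic e) c \<in> Idl\<^bsub>poly_ring V\<^esub> ?gen"
        using e gen Idl_self[OF sub] by (intro pidealD(5)[OF pideal_Idl[OF sub]] vpoly_single) auto
      thus "Poly_Mapping.single a c \<in> Idl\<^bsub>poly_ring V\<^esub> ?gen"
        using single_factor_xmon[of e a c] simple_graphD[OF G] e by simp
    qed
  qed
qed

text \<open>Every monomial in a \<open>k\<close>-th power is divisible by a product of
  \<open>k\<close> edges. The edges form a list because they may repeat, and the count of edges
  through \<open>v\<close> is the exponent of \<open>v\<close> in that product.\<close>

lemma edge_ideal_power_keys:
  fixes V :: "'v set"
  assumes G: "simple_graph V E"
    and p: "p \<in> (edge_ideal V E :: ('v, 'k::field) mpoly set) [^]\<^bsub>ideals_set (poly_ring V)\<^esub> k"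
  shows "p \<in> vpoly V \<and> (\<forall>a\<in>Poly_Mapping.keys p. \<exists>es. length es = k \<and> set es \<subseteq> E \<and>
    (\<forall>v. length (filter (\<lambda>e. v \<in> e) es) \<le> Poly_Mapping.lookup a v))"
  using p
proof (induction k arbitrary: p)
  case 0
  thus ?case by (simp add: nat_pow_def ideals_set_def)
next
  case (Suc k)
  have "p \<in> ideal_prod (poly_ring V) (edge_ideal V E [^]\<^bsub>ideals_set (poly_ring V)\<^esub> k) (edge_ideal V E)"
    using Suc.prems by (simp add: nat_pow_def ideals_set_def)
  thus ?case
  proof (induction p rule: ideal_prod.induct)
    case (prod i j)
    note i = Suc.IH[OF prod(1)]
    have j: "j \<in> vpoly V" "\<And>b. b \<in> Poly_Mapping.keys j \<Longrightarrow> \<exists>e\<in>E. e \<subseteq> supp b"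
      using prod(2) by (auto simp: edge_ideal_eq[OF G] sqideal_def)
    have "\<exists>es. length es = Suc k \<and> set es \<subseteq> E \<and>
        (\<forall>v. length (filter (\<lambda>e. v \<in> e) es) \<le> Poly_Mapping.lookup c v)"
      if c: "c \<in> Poly_Mapping.keys (i * j)" for c
    proof -
      obtain a b where ab: "a \<in> Poly_Mapping.keys i" "b \<in> Poly_Mapping.keys j" "c = a + b"
        using c by (rule keys_mult_cases)
      obtain es where es: "length es = k" "set es \<subseteq> E"
        "\<And>v. length (filter (\<lambda>e. v \<in> e) es) \<le> Poly_Mapping.lookup a v" using i ab(1) by blast
      obtain e where e: "e \<in> E" "e \<subseteq> supp b" using j(2)[OF ab(2)] by blast
      have "length (filter (\<lambda>e. v \<in> e) (e # es)) \<le> Poly_Mapping.lookup c v" for v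
        using es(3)[of v] e(2) by (auto simp: ab(3) lookup_add in_keys_iff Suc_le_eq)
      thus ?thesis using es e(1) by (intro exI[of _ "e # es"]) auto
    qed
    thus ?case using i j(1) by auto
  next
    case (sum s1 s2)
    thus ?case by (auto dest!: keys_add_cases)
  qed
qed

lemma xmon_matching_in_edge_ideal_power:
  fixes V :: "'v set"
  assumes G: "simple_graph V E" and M: "finite M" "M \<subseteq> E" "pairwise disjnt M"
  shows "xmon (\<Union> M) \<in> (edge_ideal V E :: ('v, 'k::field) mpoly set) [^]\<^bsub>ideals_set (poly_ring V)\<^esub> card M"
  using M
proof (induction M rule: finite_induct)
  case empty
  show ?case by (simp add: nat_pow_def ideals_set_def)
next
  case (insert e M)
  have "disjnt (\<Union> M) e"
    using insert.prems(2) insert.hyps(2) by (auto simp: pairwise_insert disjnt_def)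
  moreover have "finite e" "e \<subseteq> V"
    using insert.prems(1) simple_graphD[OF G] by auto
  moreover have "finite (\<Union> M)"
    using insert.prems(1) insert.hyps(1) simple_graphD(2)[OF G] by (intro finite_Union) auto
  ultimately have eq: "xmon (\<Union> (insert e M)) = (xmon (\<Union> M) * xmon e :: ('v, 'k) mpoly)"
    using xmon_Un[of "\<Union> M" e] by (simp add: Un_commute disjnt_def)
  have "xmon e \<in> (edge_ideal V E :: ('v, 'k) mpoly set)"
    using insert.prems(1) \<open>finite e\<close> \<open>e \<subseteq> V\<close> by (auto simp: edge_ideal_eq[OF G] xmon_in_sqideal)
  moreover have "xmon (\<Union> M) \<in> (edge_ideal V E :: ('v, 'k) mpoly set) [^]\<^bsub>ideals_set (poly_ring V)\<^esub> card M"
    using insert by (intro insert.IH) (auto simp: pairwise_insert)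
  ultimately have "xmon (\<Union> M) \<otimes>\<^bsub>poly_ring V\<^esub> xmon e \<in>
      ideal_prod (poly_ring V)
        ((edge_ideal V E :: ('v, 'k) mpoly set) [^]\<^bsub>ideals_set (poly_ring V)\<^esub> card M) (edge_ideal V E)"
    by (intro ideal_prod.prod)
  thus ?case using insert.hyps unfolding eq by (simp add: nat_pow_def ideals_set_def)
qed

text \<open>In a squarefree monomial at most one of the \<open>k\<close> edges passes through each
  vertex. As edges are nonempty, the list is then free of repetitions and is a matching.\<close>

lemma squarefree_power_edge_ideal:
  fixes V :: "'v set"
  assumes G: "simple_graph V E"
  shows "squarefree_power V (edge_ideal V E :: ('v, 'k::field) mpoly set) k = sqideal V (has_matching E k)"
proof -
  let ?I = "(edge_ideal V E :: ('v, 'k) mpoly set) [^]\<^bsub>ideals_set (poly_ring V)\<^esub> k"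
  let ?gen = "{p \<in> ?I. squarefree_monomial p}"
  have sub: "?gen \<subseteq> vpoly V" using edge_ideal_power_keys[OF G] by blast
  have gen: "?gen \<subseteq> sqideal V (has_matching E k)"
  proof
    fix p assume p: "p \<in> ?gen"
    then obtain a where a: "p = Poly_Mapping.single a 1" "\<And>x. Poly_Mapping.lookup a x \<le> 1"
      by (auto simp: squarefree_monomial_def)
    obtain es where es: "length es = k" "set es \<subseteq> E"
      "\<And>v. length (filter (\<lambda>e. v \<in> e) es) \<le> Poly_Mapping.lookup a v"
      using edge_ideal_power_keys[OF G, of p k] p a(1) by auto
    have disj: "disjnt (es ! i) (es ! j)" if ij: "i < j" "j < length es" for i j
    proof (rule ccontr)
      assume "\<not> disjnt (es ! i) (es ! j)"
      then obtain v where v: "v \<in> es ! i" "v \<in> es ! j" by (auto simp: disjnt_iff)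
      have "{i, j} \<subseteq> {l. l < length es \<and> v \<in> es ! l}" using ij v by auto
      hence "card {i, j} \<le> length (filter (\<lambda>e. v \<in> e) es)"
        unfolding length_filter_conv_card by (intro card_mono) auto
      thus False using es(3)[of v] a(2)[of v] ij by simp
    qed
    have ne: "e \<noteq> {}" if "e \<in> set es" for e using that es(2) simple_graphD(4)[OF G] by blast
    have "distinct es"
      unfolding distinct_conv_nth
    proof (intro allI impI)
      fix i j assume ij: "i < length es" "j < length es" "i \<noteq> j"
      show "es ! i \<noteq> es ! j"
        using ij disj[of i j] disj[of j i] ne[of "es ! i"] by (cases "i < j") (auto simp: disjnt_def)
    qed
    hence card: "card (set es) = k" using es(1) by (simp add: distinct_card)
    have "pairwise disjnt (set es)"
    proof (rule pairwiseI)
      fix e f assume "e \<in> set es" "f \<in> set es" "e \<noteq> f"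
      then obtain i j where "i < length es" "j < length es" "e = es ! i" "f = es ! j" "i \<noteq> j"
        by (metis in_set_conv_nth)
      thus "disjnt e f" using disj[of i j] disj[of j i] by (cases "i < j") (auto simp: disjnt_sym)
    qed
    moreover have "\<Union> (set es) \<subseteq> supp a"
    proof
      fix v assume "v \<in> \<Union> (set es)"
      hence "0 < length (filter (\<lambda>e. v \<in> e) es)" by (auto simp: filter_empty_conv)
      hence "0 < Poly_Mapping.lookup a v" using es(3)[of v] by linarith
      thus "v \<in> supp a" by (simp add: in_keys_iff)
    qed
    ultimately have "has_matching E k (supp a)"
      unfolding has_matching_def using es(2) card by (intro exI[of _ "set es"]) auto
    thus "p \<in> sqideal V (has_matching E k)" using sub p by (auto simp: sqideal_def a(1))
  qed
  show ?thesis
    unfolding squarefree_power_def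
  proof
    show "Idl\<^bsub>poly_ring V\<^esub> ?gen \<subseteq> sqideal V (has_matching E k)"
      by (rule Idl_subset[OF pideal_sqideal[OF mono_has_matching] gen])
    show "sqideal V (has_matching E k) \<subseteq> Idl\<^bsub>poly_ring V\<^esub> ?gen"
    proof (rule sqideal_subset[OF pideal_Idl[OF sub]])
      fix a c assume a: "supp a \<subseteq> V" "has_matching E k (supp a)"
      then obtain M where M: "M \<subseteq> E" "finite M" "card M = k" "pairwise disjnt M" "\<Union> M \<subseteq> supp a"
        by (auto simp: has_matching_def)
      have fin: "finite (\<Union> M)" using M(1,2) simple_graphD(2)[OF G] by (intro finite_Union) auto
      have "squarefree_monomial (xmon (\<Union> M) :: ('v, 'k) mpoly)"
        unfolding squarefree_monomial_def xmon_def using fin by (auto simp: lookup_indic)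
      moreover have "xmon (\<Union> M) \<in> ?I"
        using xmon_matching_in_edge_ideal_power[OF G M(2,1,4)] M(3) by simp
      ultimately have "xmon (\<Union> M) \<in> Idl\<^bsub>poly_ring V\<^esub> ?gen" using Idl_self[OF sub] by blast
      moreover have "supp (a - indic (\<Union> M)) \<subseteq> V" using a(1) by (auto simp: in_keys_iff lookup_minus)
      ultimately have "xmon (\<Union> M) * Poly_Mapping.single (a - indic (\<Union> M)) c \<in> Idl\<^bsub>poly_ring V\<^esub> ?gen"
        by (intro pidealD(5)[OF pideal_Idl[OF sub]] vpoly_single) auto
      thus "Poly_Mapping.single a c \<in> Idl\<^bsub>poly_ring V\<^esub> ?gen"
        using single_factor_xmon[OF fin M(5), of c] by simp
    qed
  qed
qed

section \<open>Well-covered forests\<close>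

text \<open>The first vertex of a longest path inside \<open>U\<close> works: all its neighbours in
  \<open>U\<close> lie on the path, and a neighbour other than the next vertex closes a
  cycle.\<close>

lemma forest_leaf:
  assumes F: "forest V E" and U: "finite U" "U \<noteq> {}"
  shows "\<exists>x\<in>U. \<forall>y\<in>U. \<forall>z\<in>U. {x, y} \<in> E \<longrightarrow> {x, z} \<in> E \<longrightarrow> y = z"
proof (rule ccontr)
  assume *: "\<not> ?thesis"
  define P where "P = (\<lambda>p. p \<noteq> [] \<and> distinct p \<and> set p \<subseteq> U \<and>
    (\<forall>i. Suc i < length p \<longrightarrow> {p ! i, p ! Suc i} \<in> E))"
  obtain u where "u \<in> U" using U(2) by blast
  hence "P [u]" by (simp add: P_def)
  moreover have "length p < Suc (card U)" if "P p" for p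
  proof -
    have "card (set p) \<le> card U" using that U(1) by (intro card_mono) (auto simp: P_def)
    thus ?thesis using that by (simp add: P_def distinct_card)
  qed
  ultimately obtain p where p: "P p" "\<And>q. P q \<Longrightarrow> length q \<le> length p"
    using ex_has_greatest_nat[of P "[u]" length "Suc (card U)"] by blast
  define x where "x = p ! 0"
  have x: "x \<in> U" using p(1) by (auto simp: P_def x_def)
  have nbr: "\<exists>i<length p. i \<noteq> 0 \<and> y = p ! i" if y: "y \<in> U" "{x, y} \<in> E" for y
  proof (rule ccontr)
    assume "\<not> ?thesis"
    moreover have "y \<noteq> x"
      using F y(2) by (auto simp: forest_def simple_graph_def doubleton_eq_iff)
    ultimately have "y \<notin> set p" by (auto simp: in_set_conv_nth x_def)
    moreover have "{(y # p) ! i, (y # p) ! Suc i} \<in> E" if "Suc i < length (y # p)" for i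
      using p(1) y that by (cases i) (auto simp: P_def x_def insert_commute)
    ultimately have "P (y # p)" using p(1) y(1) by (simp add: P_def)
    from p(2)[OF this] show False by simp
  qed
  obtain y z where yz: "y \<in> U" "z \<in> U" "{x, y} \<in> E" "{x, z} \<in> E" "y \<noteq> z" using * x by blast
  obtain i j where "i < length p" "i \<noteq> 0" "y = p ! i" "j < length p" "j \<noteq> 0" "z = p ! j"
    using nbr yz by metis
  \<comment> \<open>Of two different nonzero positions one is at least \<open>2\<close>, so the
    cycle closed there has at least three vertices.\<close>
  hence "\<exists>m. 2 \<le> m \<and> m < length p \<and> {x, p ! m} \<in> E"
    using yz by (cases "2 \<le> i"; cases "2 \<le> j") (auto dest: less_2_cases simp: not_le)
  then obtain m where m: "2 \<le> m" "m < length p" "{x, p ! m} \<in> E" by blast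
  have "cycle_of E (take (Suc m) p)"
    unfolding cycle_of_def
  proof (intro conjI allI impI)
    show "3 \<le> length (take (Suc m) p)" "distinct (take (Suc m) p)"
      using m p(1) by (auto simp: P_def)
    fix i assume "i < length (take (Suc m) p)"
    hence i: "i \<le> m" using m by simp
    have len: "length (take (Suc m) p) = Suc m" using m by simp
    show "{take (Suc m) p ! i, take (Suc m) p ! (Suc i mod length (take (Suc m) p))} \<in> E"
    proof (cases "i = m")
      case True
      thus ?thesis using m(3) unfolding len True by (simp add: x_def insert_commute)
    next
      case False
      thus ?thesis using i m(2) p(1) unfolding len by (simp add: P_def)
    qed
  qed
  thus False using F by (auto simp: forest_def)
qed

lemma forest_no_triangle:
  assumes "forest V E" "{a, b} \<in> E" "{b, c} \<in> E" "{c, a} \<in> E"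
  shows "\<not> distinct [a, b, c]"
proof
  assume "distinct [a, b, c]"
  hence "cycle_of E [a, b, c]"
    using assms(2-4) by (simp add: cycle_of_def All_less_Suc)
  thus False using assms(1) by (auto simp: forest_def)
qed

lemma forest_no_square:
  assumes "forest V E" "{a, b} \<in> E" "{b, c} \<in> E" "{c, d} \<in> E" "{d, a} \<in> E"
  shows "\<not> distinct [a, b, c, d]"
proof
  assume "distinct [a, b, c, d]"
  hence "cycle_of E [a, b, c, d]"
    using assms(2-5) by (simp add: cycle_of_def All_less_Suc)
  thus False using assms(1) by (auto simp: forest_def)
qed

section \<open>Independent sets and the structure of well-covered forests\<close>

definition independent :: "'v set \<Rightarrow> 'v set set \<Rightarrow> 'v set \<Rightarrow> bool" where
  "independent V E S \<longleftrightarrow> S \<subseteq> V \<and> (\<forall>e\<in>E. \<not> e \<subseteq> S)"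

definition max_independent :: "'v set \<Rightarrow> 'v set set \<Rightarrow> 'v set \<Rightarrow> bool" where
  "max_independent V E S \<longleftrightarrow> independent V E S \<and> (\<forall>v\<in>V - S. \<exists>e\<in>E. e \<subseteq> insert v S)"

definition well_covered :: "'v set \<Rightarrow> 'v set set \<Rightarrow> bool" where
  "well_covered V E \<longleftrightarrow>
     (\<forall>S T. max_independent V E S \<longrightarrow> independent V E T \<longrightarrow> card T \<le> card S)"

lemma max_independent_extend:
  assumes "finite V" "independent V E S"
  obtains T where "S \<subseteq> T" "max_independent V E T"
proof -
  define \<F> where "\<F> = {T. independent V E T}"
  have "finite \<F>"
    unfolding \<F>_def by (rule finite_subset[of _ "Pow V"]) (use assms(1) in \<open>auto simp: independent_def\<close>)
  moreover have "S \<in> \<F>" using assms(2) by (simp add: \<F>_def)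
  ultimately have "\<exists>T\<in>\<F>. S \<subseteq> T \<and> (\<forall>T'\<in>\<F>. T \<subseteq> T' \<longrightarrow> T = T')"
    by (rule finite_has_maximal2)
  then obtain T where T: "S \<subseteq> T" "T \<in> \<F>" "\<And>T'. T' \<in> \<F> \<Longrightarrow> T \<subseteq> T' \<Longrightarrow> T = T'"
    by metis
  have "\<exists>e\<in>E. e \<subseteq> insert v T" if "v \<in> V - T" for v
    using T(2) T(3)[of "insert v T"] that by (auto simp: \<F>_def independent_def)
  thus ?thesis using T that by (auto simp: \<F>_def max_independent_def)
qed

text \<open>Peeling off a leaf \<open>l\<close> with its neighbour \<open>w\<close> keeps the forest well-covered, so the rest has a
  perfect matching by pendant edges. Such an edge \<open>{x, y}\<close> stays pendant: otherwise an independent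
  set containing \<open>w\<close> and a neighbour of \<open>x\<close> would miss both of its ends and be too small.\<close>

theorem well_covered_forest_pendant_edges:
  assumes "forest V E" "well_covered V E"
  shows "\<exists>M\<subseteq>E. pairwise disjnt M \<and> (\<forall>e\<in>M. \<exists>l\<in>e. \<forall>f\<in>E. l \<in> f \<longrightarrow> f = e) \<and> \<Union> E \<subseteq> \<Union> M"
  using assms
proof (induction "card V" arbitrary: V E rule: less_induct)
  case less
  note F = \<open>forest V E\<close> and wc = \<open>well_covered V E\<close>
  have G: "simple_graph V E" using F by (simp add: forest_def)
  have finV: "finite V" by (rule simple_graphD(1)[OF G])
  show ?case
  proof (cases "E = {}")
    case True
    thus ?thesis by (intro exI[of _ "{}"]) auto
  next
    case False
    have "\<Union> E \<noteq> {}" using False simple_graphD(4)[OF G] by blast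
    moreover have "finite (\<Union> E)" using simple_graphD(3)[OF G] finV by (meson Sup_le_iff finite_subset)
    ultimately obtain l where l: "l \<in> \<Union> E"
      "\<And>y z. y \<in> \<Union> E \<Longrightarrow> z \<in> \<Union> E \<Longrightarrow> {l, y} \<in> E \<Longrightarrow> {l, z} \<in> E \<Longrightarrow> y = z"
      using forest_leaf[OF F, of "\<Union> E"] by metis
    then obtain w where w: "{l, w} \<in> E" "w \<noteq> l" "l \<in> V" "w \<in> V"
      by (metis UnionE simple_graph_edge[OF G])
    have leaf: "f = {l, w}" if f: "f \<in> E" "l \<in> f" for f
    proof -
      obtain y where y: "f = {l, y}" using simple_graph_edge[OF G f] by metis
      hence "y = w" using f w(1) by (intro l(2)) auto
      thus ?thesis by (simp add: y)
    qed
    define V1 where "V1 = V - {l, w}"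
    define E1 where "E1 = {e \<in> E. l \<notin> e \<and> w \<notin> e}"
    have E1V: "e \<in> E1 \<longleftrightarrow> e \<in> E \<and> e \<subseteq> V1" for e
      using simple_graphD(3)[OF G] by (auto simp: E1_def V1_def)
    have G1: "simple_graph V1 E1"
      unfolding simple_graph_def
    proof (intro conjI ballI)
      show "finite V1" using finV by (simp add: V1_def)
      fix e assume e: "e \<in> E1"
      then obtain x y where "x \<noteq> y" "e = {x, y}" using G E1V unfolding simple_graph_def by blast
      thus "\<exists>x\<in>V1. \<exists>y\<in>V1. x \<noteq> y \<and> e = {x, y}" using e E1V by blast
    qed
    have F1: "forest V1 E1"
      using F G1 unfolding forest_def cycle_of_def by (auto simp: E1_def)
    have ind1: "independent V E (insert l T)" if "independent V1 E1 T" for T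
      unfolding independent_def
    proof (intro conjI ballI notI)
      show "insert l T \<subseteq> V" using that w by (auto simp: independent_def V1_def)
      fix e assume e: "e \<in> E" "e \<subseteq> insert l T"
      show False
      proof (cases "l \<in> e")
        case True
        thus False using leaf[OF e(1)] e(2) w that by (auto simp: independent_def V1_def)
      next
        case False
        hence "e \<subseteq> T" using e by auto
        thus False using e(1) that E1V by (auto simp: independent_def)
      qed
    qed
    have notl: "l \<notin> T" if "independent V1 E1 T" for T
      using that by (auto simp: independent_def V1_def)
    \<comment> \<open>Adding \<open>l\<close> to a maximal independent set of the rest gives one of
      the whole forest, as \<open>l\<close> blocks \<open>w\<close>. All sizes grow by one, so the
      comparison of sizes descends.\<close>
    have wc1: "well_covered V1 E1"
      unfolding well_covered_def
    proof (intro allI impI)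
      fix S T assume S: "max_independent V1 E1 S" and T: "independent V1 E1 T"
      have S': "independent V1 E1 S" using S by (simp add: max_independent_def)
      have "\<exists>e\<in>E. e \<subseteq> insert v (insert l S)" if v: "v \<in> V - insert l S" for v
      proof (cases "v = w")
        case True
        thus ?thesis using w(1) by (intro bexI[of _ "{l, w}"]) auto
      next
        case False
        hence "v \<in> V1 - S" using v by (auto simp: V1_def)
        then obtain e where "e \<in> E1" "e \<subseteq> insert v S" using S by (auto simp: max_independent_def)
        thus ?thesis by (intro bexI[of _ e]) (auto simp: E1_def)
      qed
      hence "max_independent V E (insert l S)"
        using ind1[OF S'] by (simp add: max_independent_def)
      hence "card (insert l T) \<le> card (insert l S)"
        using wc ind1[OF T] by (auto simp: well_covered_def)
      moreover have "finite S" "finite T"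
        using S' T finV by (auto simp: independent_def V1_def intro: finite_subset)
      ultimately show "card T \<le> card S" using notl[OF S'] notl[OF T] by simp
    qed
    have "card V1 < card V" using finV w unfolding V1_def by (intro psubset_card_mono) auto
    from less.hyps[OF this F1 wc1] obtain M1 where M1: "M1 \<subseteq> E1" "pairwise disjnt M1"
      "\<forall>e\<in>M1. \<exists>l\<in>e. \<forall>f\<in>E1. l \<in> f \<longrightarrow> f = e" "\<Union> E1 \<subseteq> \<Union> M1" by metis
    have M1V: "\<Union> M1 \<subseteq> V1" using M1(1) E1V by blast
    \<comment> \<open>An edge lost in passing to \<open>E1\<close> contains \<open>w\<close>,
      because \<open>{l, w}\<close> is the only edge through \<open>l\<close>.\<close>
    have outside: "f = {w, z}" if f: "f \<in> E" "f \<notin> E1" "z \<in> f" "z \<notin> {l, w}" for f z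
    proof -
      have "w \<in> f" using f leaf[of f] by (auto simp: E1_def)
      then obtain y where "f = {w, y}" using simple_graph_edge[OF G f(1)] by metis
      thus ?thesis using f(3,4) by auto
    qed
    \<comment> \<open>An uncovered \<open>z\<close> would be a second leaf at \<open>w\<close>. In a
      maximal independent set containing \<open>w\<close>, trading \<open>w\<close> for both
      \<open>l\<close> and \<open>z\<close> would enlarge it.\<close>
    have cover: "\<Union> E \<subseteq> \<Union> (insert {l, w} M1)"
    proof (rule subsetI, rule ccontr)
      fix z assume z: "z \<in> \<Union> E" "z \<notin> \<Union> (insert {l, w} M1)"
      have z1: "z \<notin> \<Union> E1" "z \<notin> {l, w}" using z M1(4) by auto
      have zleaf: "f = {w, z}" if "f \<in> E" "z \<in> f" for f using outside[OF that(1)] that z1 by auto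
      have zw: "{w, z} \<in> E" using z(1) zleaf by auto
      have zV: "z \<in> V" using zw simple_graphD(3)[OF G] by auto
      have "independent V E {w}"
        using w(4) G unfolding independent_def simple_graph_def by fastforce
      then obtain S where S: "{w} \<subseteq> S" "max_independent V E S"
        using max_independent_extend[OF finV] by blast
      have indS: "independent V E S" using S(2) by (simp add: max_independent_def)
      have notS: "l \<notin> S" "z \<notin> S" using indS S(1) w(1) zw by (auto simp: independent_def)
      define T where "T = insert l (insert z (S - {w}))"
      have "independent V E T"
        unfolding independent_def
      proof (intro conjI ballI notI)
        show "T \<subseteq> V" using indS w zV by (auto simp: T_def independent_def)
        fix e assume e: "e \<in> E" "e \<subseteq> T"
        have wT: "w \<notin> T" using w(2) z1 by (auto simp: T_def)
        have "l \<notin> e" "z \<notin> e" using leaf[OF e(1)] zleaf[OF e(1)] e(2) wT by auto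
        hence "e \<subseteq> S" using e(2) by (auto simp: T_def)
        thus False using indS e(1) by (auto simp: independent_def)
      qed
      hence "card T \<le> card S" using wc S(2) by (auto simp: well_covered_def)
      moreover have "finite S" using indS finV by (auto simp: independent_def intro: finite_subset)
      moreover have "card T = Suc (Suc (card (S - {w})))"
        using \<open>finite S\<close> notS z1 by (auto simp: T_def card_insert_if)
      moreover have "Suc (card (S - {w})) = card S" using \<open>finite S\<close> S(1) by (intro card_Suc_Diff1) auto
      ultimately show False by simp
    qed
    have pendant: "\<exists>l\<in>e. \<forall>f\<in>E. l \<in> f \<longrightarrow> f = e" if e: "e \<in> M1" for e
    proof (rule ccontr)
      assume no: "\<not> ?thesis"
      obtain y where y: "y \<in> e" "\<And>f. f \<in> E1 \<Longrightarrow> y \<in> f \<Longrightarrow> f = e" using M1(3) e by metis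
      have eE: "e \<in> E" "e \<in> E1" using e M1(1) by (auto simp: E1_def)
      obtain x where x: "e = {y, x}" "x \<noteq> y" using simple_graph_edge[OF G eE(1) y(1)] by metis
      have xy1: "x \<in> V1" "y \<in> V1" using eE(2) E1V x by auto
      obtain f where f: "f \<in> E" "y \<in> f" "f \<noteq> e" using no y(1) by blast
      have wy: "{w, y} \<in> E"
        using outside[of f y] f y(2) xy1(2) by (auto simp: V1_def)
      obtain g where g: "g \<in> E" "x \<in> g" "g \<noteq> e" using no x(1) by auto
      obtain u where u: "g = {x, u}" "u \<noteq> x" "u \<in> V" using simple_graph_edge[OF G g(1,2)] by metis
      have uy: "u \<noteq> y" using g(3) u(1) x(1) by auto
      have dist: "w \<noteq> x" "w \<noteq> y" using xy1 by (auto simp: V1_def)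
      have yx: "{y, x} \<in> E" and xu: "{x, u} \<in> E" using eE(1) x(1) g(1) u(1) by simp_all
      \<comment> \<open>The path \<open>w\<close>, \<open>y\<close>, \<open>x\<close>,
        \<open>u\<close> would close to a triangle if \<open>u = w\<close>, and to a square if
        \<open>{w, u}\<close> were an edge.\<close>
      have uw: "u \<noteq> w"
        using forest_no_triangle[OF F wy yx, unfolded distinct.simps] xu dist x(2) by auto
      have nuw: "{w, u} \<notin> E"
        using forest_no_square[OF F wy yx xu] dist x(2) u(2) uy uw by (auto simp: insert_commute)
      have "independent V E {w, u}"
        unfolding independent_def
      proof (intro conjI ballI notI)
        fix e assume e: "e \<in> E" "e \<subseteq> {w, u}"
        then obtain a where a: "a \<in> e" using simple_graphD(4)[OF G] by blast
        obtain b where "e = {a, b}" "b \<noteq> a" by (rule simple_graph_edge[OF G e(1) a])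
        hence "e = {w, u}" using e(2) by auto
        thus False using nuw e(1) by simp
      qed (use w u in auto)
      then obtain S where S: "{w, u} \<subseteq> S" "max_independent V E S"
        using max_independent_extend[OF finV] by blast
      have indS: "independent V E S" using S(2) by (simp add: max_independent_def)
      have finS: "finite S" using indS finV by (auto simp: independent_def intro: finite_subset)
      have notS: "l \<notin> S" "x \<notin> S" "y \<notin> S"
        using indS S(1) w(1) wy g(1) u(1) by (auto simp: independent_def)
      \<comment> \<open>\<open>Z\<close> consists of the vertices isolated in the rest. The set
        \<open>T\<close> below takes \<open>l\<close>, one leaf from every edge of \<open>M1\<close>
        and all of \<open>Z\<close>, hence \<open>1 + card M1 + card Z\<close> vertices. Besides
        \<open>w\<close> and vertices of \<open>Z\<close>, the set \<open>S\<close> has at most one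
        vertex from each edge of \<open>M1\<close> and none from \<open>e\<close>, so it is
        smaller.\<close>
      define Z where "Z = V1 - \<Union> M1"
      have finM: "finite M1"
      proof (rule finite_subset)
        show "M1 \<subseteq> Pow V" using M1V by (auto simp: V1_def)
      qed (use finV in simp)
      have finZ: "finite Z" using finV by (simp add: Z_def V1_def)
      define h where "h = (\<lambda>e. SOME l. l \<in> e \<and> (\<forall>f\<in>E1. l \<in> f \<longrightarrow> f = e))"
      have h: "h e \<in> e" "\<And>f. f \<in> E1 \<Longrightarrow> h e \<in> f \<Longrightarrow> f = e" if "e \<in> M1" for e
        using someI_ex[of "\<lambda>l. l \<in> e \<and> (\<forall>f\<in>E1. l \<in> f \<longrightarrow> f = e)"] bspec[OF M1(3) that]
        unfolding h_def by auto
      define T where "T = insert l (h ` M1 \<union> Z)"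
      have hM: "h ` M1 \<subseteq> \<Union> M1" using h(1) by auto
      have "independent V E T"
        unfolding T_def
      proof (rule ind1, unfold independent_def, intro conjI ballI notI)
        show "h ` M1 \<union> Z \<subseteq> V1" using hM M1V by (auto simp: Z_def)
        fix e assume e: "e \<in> E1" "e \<subseteq> h ` M1 \<union> Z"
        have "e \<subseteq> \<Union> M1" using M1(4) e(1) by blast
        hence "e \<subseteq> h ` M1" using e(2) by (auto simp: Z_def)
        moreover obtain a where a: "a \<in> e" using simple_graphD(4)[OF G1 e(1)] by blast
        ultimately obtain p where p: "p \<in> M1" "a = h p" by blast
        obtain b where b: "e = {a, b}" "b \<noteq> a" using simple_graph_edge[OF G1 e(1) a] by metis
        then obtain q where q: "q \<in> M1" "b = h q" using \<open>e \<subseteq> h ` M1\<close> by auto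
        have "e = p" "e = q" using h(2)[OF p(1) e(1)] h(2)[OF q(1) e(1)] a b p(2) q(2) by auto
        thus False using b(2) p(2) q(2) by simp
      qed
      hence "card T \<le> card S" using wc S(2) by (auto simp: well_covered_def)
      moreover have "card T = Suc (card M1 + card Z)"
      proof -
        have "inj_on h M1"
        proof (rule inj_onI)
          fix p q assume pq: "p \<in> M1" "q \<in> M1" "h p = h q"
          thus "p = q" using h(1)[OF pq(2)] h(2)[OF pq(1), of q] M1(1) by auto
        qed
        moreover have "h ` M1 \<inter> Z = {}" using hM by (auto simp: Z_def)
        moreover have "l \<notin> h ` M1 \<union> Z" using hM M1V by (auto simp: Z_def V1_def)
        ultimately show ?thesis
          using finM finZ by (simp add: T_def card_Un_disjoint card_image)
      qed
      moreover have "card S \<le> card M1 + card Z"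
      proof -
        have "S \<subseteq> insert w (Z \<union> (\<Union>p\<in>M1 - {e}. S \<inter> p))"
        proof
          fix s assume s: "s \<in> S"
          hence "s \<in> V" "s \<noteq> l" "s \<notin> e" using indS notS x(1) by (auto simp: independent_def)
          thus "s \<in> insert w (Z \<union> (\<Union>p\<in>M1 - {e}. S \<inter> p))"
            using s by (cases "s = w") (auto simp: Z_def V1_def)
        qed
        hence "card S \<le> card (insert w (Z \<union> (\<Union>p\<in>M1 - {e}. S \<inter> p)))"
          using finZ finM finS by (intro card_mono) auto
        also have "\<dots> \<le> Suc (card (Z \<union> (\<Union>p\<in>M1 - {e}. S \<inter> p)))"
          by (rule card_insert_le_m1) auto
        also have "card (Z \<union> (\<Union>p\<in>M1 - {e}. S \<inter> p)) \<le> card Z + card (\<Union>p\<in>M1 - {e}. S \<inter> p)"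
          by (rule card_Un_le)
        also have "card (\<Union>p\<in>M1 - {e}. S \<inter> p) \<le> (\<Sum>p\<in>M1 - {e}. card (S \<inter> p))"
          using finM by (intro card_UN_le) auto
        also have "\<dots> \<le> (\<Sum>p\<in>M1 - {e}. 1)"
        proof (rule sum_mono)
          fix p assume "p \<in> M1 - {e}"
          hence p: "p \<in> E" using M1(1) by (auto simp: E1_def)
          then obtain a where a: "a \<in> p" using simple_graphD(4)[OF G] by blast
          then obtain b where b: "p = {a, b}" "b \<noteq> a" using simple_graph_edge[OF G p] by metis
          have "\<not> p \<subseteq> S" using indS p by (auto simp: independent_def)
          hence "S \<inter> p \<subseteq> {a} \<or> S \<inter> p \<subseteq> {b}" using b(1) by auto
          thus "card (S \<inter> p) \<le> 1" using card_mono[of "{a}" "S \<inter> p"] card_mono[of "{b}" "S \<inter> p"] by auto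
        qed
        also have "\<dots> = card M1 - 1" using e finM by simp
        finally show ?thesis using e finM card_gt_0_iff[of M1] by auto
      qed
      ultimately show False by simp
    qed
    have "disjnt {l, w} p" if "p \<in> M1" for p using that M1V by (auto simp: disjnt_def V1_def)
    hence "pairwise disjnt (insert {l, w} M1)"
      using M1(2) by (auto simp: pairwise_insert disjnt_sym)
    moreover have "insert {l, w} M1 \<subseteq> E" using w(1) M1(1) by (auto simp: E1_def)
    moreover have "\<exists>l'\<in>{l, w}. \<forall>f\<in>E. l' \<in> f \<longrightarrow> f = {l, w}" using leaf by auto
    ultimately show ?thesis
      using pendant cover by (intro exI[of _ "insert {l, w} M1"]) auto
  qed
qed

section \<open>Whiskered forests\<close>

definition whiskered :: "'v set \<Rightarrow> 'v set set \<Rightarrow> 'v set \<Rightarrow> ('v \<Rightarrow> 'v) \<Rightarrow> bool" where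
  "whiskered V E X y \<longleftrightarrow> X \<subseteq> V \<and> y ` X \<subseteq> V \<and> inj_on y X \<and> X \<inter> y ` X = {} \<and>
     \<Union> E \<subseteq> X \<union> y ` X \<and> (\<forall>x\<in>X. {x, y x} \<in> E) \<and> (\<forall>x\<in>X. \<forall>f\<in>E. y x \<in> f \<longrightarrow> f = {x, y x})"

theorem well_covered_forest_whiskered:
  assumes F: "forest V E" and wc: "well_covered V E"
  obtains X y where "whiskered V E X y"
proof -
  have G: "simple_graph V E" using F by (simp add: forest_def)
  obtain M where M: "M \<subseteq> E" "pairwise disjnt M"
    "\<forall>e\<in>M. \<exists>l\<in>e. \<forall>f\<in>E. l \<in> f \<longrightarrow> f = e" "\<Union> E \<subseteq> \<Union> M"
    using well_covered_forest_pendant_edges[OF F wc] by metis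
  have disj: "e = f" if "e \<in> M" "f \<in> M" "v \<in> e" "v \<in> f" for e f v
    using M(2) that unfolding pairwise_def disjnt_iff by blast
  \<comment> \<open>Both ends of an edge may be leaves, when it is a whole component; the end
    serving as whisker is chosen once for all.\<close>
  obtain h where h: "\<And>e. e \<in> M \<Longrightarrow> h e \<in> e" "\<And>e f. e \<in> M \<Longrightarrow> f \<in> E \<Longrightarrow> h e \<in> f \<Longrightarrow> f = e"
    using M(3) by metis
  have "\<exists>x. e = {x, h e} \<and> x \<noteq> h e" if "e \<in> M" for e
    using simple_graph_edge[OF G _ h(1)[OF that]] M(1) that by (metis insert_commute subsetD)
  then obtain b where b: "\<And>e. e \<in> M \<Longrightarrow> e = {b e, h e}" "\<And>e. e \<in> M \<Longrightarrow> b e \<noteq> h e" by metis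
  have be: "b e \<in> e" if "e \<in> M" for e using b(1)[OF that] by blast
  have hV: "h e \<in> V" if "e \<in> M" for e
    using h(1)[OF that] M(1) simple_graphD(3)[OF G] that by blast
  have injb: "inj_on b M" using disj be by (metis inj_onI)
  define X where "X = b ` M"
  define y where "y = h \<circ> the_inv_into M b"
  have yb: "y (b e) = h e" if "e \<in> M" for e
    using that by (simp add: y_def the_inv_into_f_f[OF injb])
  have MV: "\<Union> M \<subseteq> V" using M(1) simple_graphD(3)[OF G] by blast
  have "whiskered V E X y"
    unfolding whiskered_def
  proof (intro conjI ballI impI)
    show "X \<subseteq> V" using MV be by (auto simp: X_def)
    show "y ` X \<subseteq> V" using hV by (auto simp: X_def yb)
    show "inj_on y X"
    proof (rule inj_onI)
      fix p q assume "p \<in> X" "q \<in> X" "y p = y q"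
      then obtain e f where "e \<in> M" "f \<in> M" "p = b e" "q = b f" "h e = h f" by (auto simp: X_def yb)
      thus "p = q" using disj h(1) by metis
    qed
    have "b e \<noteq> h f" if "e \<in> M" "f \<in> M" for e f
      using disj[OF that be[OF that(1)], of] h(1)[OF that(2)] b(2)[OF that(1)] by metis
    thus "X \<inter> y ` X = {}" by (auto simp: X_def yb)
    show "\<Union> E \<subseteq> X \<union> y ` X"
    proof
      fix v assume "v \<in> \<Union> E"
      then obtain e where e: "e \<in> M" "v \<in> e" using M(4) by blast
      hence "v = b e \<or> v = h e" using b(1)[OF e(1)] by (metis empty_iff insert_iff)
      moreover from e have "b e \<in> X" "h e \<in> y ` X"
        using yb[of e] by (auto simp: X_def intro!: image_eqI[of "h e" y "b e"])
      ultimately show "v \<in> X \<union> y ` X" by blast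
    qed
    show "{x, y x} \<in> E" if "x \<in> X" for x
    proof -
      obtain e where e: "e \<in> M" "x = b e" using \<open>x \<in> X\<close> by (auto simp: X_def)
      thus ?thesis using b(1)[OF e(1)] M(1) by (metis subsetD yb)
    qed
    show "f = {x, y x}" if "x \<in> X" "f \<in> E" "y x \<in> f" for x f
    proof -
      obtain e where e: "e \<in> M" "x = b e" using \<open>x \<in> X\<close> by (auto simp: X_def)
      hence "f = e" using h(2)[OF e(1) that(2)] that(3) by (simp add: yb)
      thus ?thesis using b(1)[OF e(1)] by (simp add: e yb)
    qed
  qed
  thus ?thesis by (rule that)
qed

lemma cohen_macaulay_forest_whiskered:
  fixes V :: "'v set"
  assumes F: "forest V E" and CM: "cohen_macaulay_graph TYPE('k::field) V E"
  obtains X y where "whiskered V E X y"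
proof -
  have G: "simple_graph V E" using F by (simp add: forest_def)
  have CM': "cohen_macaulay_quotient V (sqideal V (\<lambda>S. \<exists>e\<in>E. e \<subseteq> S) :: ('v, 'k) mpoly set)"
    using CM by (simp add: cohen_macaulay_graph_def edge_ideal_eq[OF G])
  have mono: "mono (\<lambda>S. \<exists>e\<in>E. e \<subseteq> S)" by (auto simp: mono_def)
  have "well_covered V E"
    unfolding well_covered_def
  proof (intro allI impI)
    fix S T assume "max_independent V E S" "independent V E T"
    thus "card T \<le> card S"
      unfolding max_independent_def independent_def
      by (intro cohen_macaulay_imp_card_le_facet[OF simple_graphD(1)[OF G] mono CM']) auto
  qed
  from well_covered_forest_whiskered[OF F this] that show ?thesis by blast
qed

section \<open>Matchings in whiskered forests\<close>

lemma has_matching_mono_edges: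
  assumes "E \<subseteq> E'" "has_matching E k S"
  shows "has_matching E' k S"
proof -
  obtain M where "M \<subseteq> E" "finite M" "card M = k" "pairwise disjnt M" "\<Union> M \<subseteq> S"
    using assms(2) by (auto simp: has_matching_def)
  thus ?thesis unfolding has_matching_def using assms(1) by (intro exI[of _ M]) auto
qed

lemma pairwise_disjnt_unique:
  "pairwise disjnt M \<Longrightarrow> e \<in> M \<Longrightarrow> f \<in> M \<Longrightarrow> v \<in> e \<Longrightarrow> v \<in> f \<Longrightarrow> e = f"
  unfolding pairwise_def disjnt_iff by blast

definition edges_on :: "'v set set \<Rightarrow> ('v \<Rightarrow> 'v) \<Rightarrow> 'v set \<Rightarrow> 'v set set" where
  "edges_on E y U = {e \<in> E. e \<subseteq> U \<union> y ` U}"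

locale whiskered_forest =
  fixes V :: "'v set" and E :: "'v set set" and X :: "'v set" and y :: "'v \<Rightarrow> 'v"
  assumes forest: "forest V E" and whiskered: "whiskered V E X y"
begin

lemma simple: "simple_graph V E"
  using forest by (simp add: forest_def)

lemma finite_V: "finite V"
  by (rule simple_graphD(1)[OF simple])

lemma X_sub: "X \<subseteq> V" and y_sub: "x \<in> X \<Longrightarrow> y x \<in> V" and inj_y: "inj_on y X"
  and y_notin: "x \<in> X \<Longrightarrow> y x \<notin> X" and whisker: "x \<in> X \<Longrightarrow> {x, y x} \<in> E"
  and pendant: "x \<in> X \<Longrightarrow> f \<in> E \<Longrightarrow> y x \<in> f \<Longrightarrow> f = {x, y x}"
  and edges_sub: "\<Union> E \<subseteq> X \<union> y ` X"
  using whiskered by (auto simp: whiskered_def)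

lemma finite_X: "finite X"
  using X_sub finite_V by (rule finite_subset)

lemma y_neq [simp]: "x \<in> X \<Longrightarrow> z \<in> X \<Longrightarrow> y x \<noteq> z" "x \<in> X \<Longrightarrow> z \<in> X \<Longrightarrow> z \<noteq> y x"
  using y_notin by auto

lemma y_eq_iff: "x \<in> X \<Longrightarrow> z \<in> X \<Longrightarrow> y x = y z \<longleftrightarrow> x = z"
  using inj_y by (auto simp: inj_on_def)

lemma edges_on_X: "edges_on E y X = E"
  using edges_sub by (auto simp: edges_on_def)

text \<open>Every edge meets \<open>U\<close>, since an edge through a whisker end is the whisker
  itself; disjoint edges meet \<open>U\<close> in different vertices.\<close>

lemma has_matching_le_card:
  assumes U: "U \<subseteq> X" and k: "has_matching (edges_on E y U) k S"
  shows "k \<le> card U"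
proof -
  obtain M where M: "M \<subseteq> edges_on E y U" "finite M" "card M = k" "pairwise disjnt M"
    using k by (auto simp: has_matching_def)
  have "\<exists>u. u \<in> e \<inter> U" if "e \<in> M" for e
  proof -
    have e: "e \<in> E" "e \<subseteq> U \<union> y ` U" using that M(1) by (auto simp: edges_on_def)
    then obtain a where a: "a \<in> e" using simple_graphD(4)[OF simple] by blast
    show ?thesis
    proof (cases "a \<in> U")
      case False
      then obtain u where u: "u \<in> U" "a = y u" using a e(2) by auto
      hence "e = {u, y u}" using U e(1) a by (intro pendant) auto
      thus ?thesis using u by auto
    qed (use a in auto)
  qed
  then obtain g where g: "\<And>e. e \<in> M \<Longrightarrow> g e \<in> e \<inter> U" by metis
  have "inj_on g M"
  proof (rule inj_onI, rule ccontr)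
    fix e f assume "e \<in> M" "f \<in> M" "g e = g f" "e \<noteq> f"
    moreover from this have "disjnt e f" using M(4) by (simp add: pairwise_def)
    ultimately show False using g[of e] g[of f] unfolding disjnt_iff by (metis IntD1)
  qed
  moreover have "finite U" using U finite_X by (rule finite_subset)
  ultimately have "card M \<le> card U" using g by (intro card_inj_on_le[of g]) auto
  thus ?thesis using M(3) by simp
qed

section \<open>Removing one base vertex together with its whisker\<close>

context
  fixes U x U'
  assumes U: "U \<subseteq> X" "x \<in> U" and U'_def: "U' = U - {x}"
begin

lemma x_X: "x \<in> X" and x_notin: "x \<notin> U'"
  using U by (auto simp: U'_def)

lemma edges_on_avoid: "e \<in> edges_on E y U' \<Longrightarrow> x \<notin> e \<and> y x \<notin> e"
proof -
  assume "e \<in> edges_on E y U'"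
  hence e: "e \<subseteq> U' \<union> y ` U'" by (simp add: edges_on_def)
  have "y x \<notin> U'" "x \<notin> y ` U'" using y_notin U by (auto simp: U'_def)
  moreover have "y x \<notin> y ` U'"
  proof
    assume "y x \<in> y ` U'"
    then obtain u where "u \<in> U'" "y x = y u" by blast
    thus False using y_eq_iff[of x u] U by (auto simp: U'_def)
  qed
  ultimately show "x \<notin> e \<and> y x \<notin> e" using e x_notin by blast
qed

lemma edges_on_subset: "edges_on E y U' \<subseteq> edges_on E y U"
  by (auto simp: edges_on_def U'_def)

lemma edges_on_deleteI:
  assumes "e \<in> edges_on E y U" "x \<notin> e"
  shows "e \<in> edges_on E y U'"
proof -
  have "y x \<notin> e" using assms pendant[OF x_X, of e] by (auto simp: edges_on_def)
  thus ?thesis using assms by (auto simp: edges_on_def U'_def)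
qed

lemma has_matching_delete_subset:
  "has_matching (edges_on E y U') k S \<Longrightarrow> has_matching (edges_on E y U) k S"
  by (rule has_matching_mono_edges[OF edges_on_subset])

lemma has_matching_delete:
  assumes "x \<notin> S"
  shows "has_matching (edges_on E y U) k S \<longleftrightarrow> has_matching (edges_on E y U') k S"
proof
  assume "has_matching (edges_on E y U) k S"
  then obtain M where M: "M \<subseteq> edges_on E y U" "finite M" "card M = k" "pairwise disjnt M" "\<Union> M \<subseteq> S"
    by (auto simp: has_matching_def)
  have "M \<subseteq> edges_on E y U'" using M(1,5) assms by (intro subsetI edges_on_deleteI) auto
  thus "has_matching (edges_on E y U') k S" using M(2-5) by (auto simp: has_matching_def)
qed (rule has_matching_delete_subset)

text \<open>The whisker at \<open>x\<close> is always as good as any other edge through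
  \<open>x\<close>, because \<open>y x\<close> lies on no other edge. Removing the edge through
  \<open>x\<close> from a matching leaves edges that avoid the pair, and to such edges the whisker
  can be added.\<close>

lemma has_matching_pair:
  assumes S: "x \<in> S" "y x \<in> S" and k: "k \<ge> 1"
  shows "has_matching (edges_on E y U) k S \<longleftrightarrow> has_matching (edges_on E y U') (k - 1) S"
proof
  assume *: "has_matching (edges_on E y U) k S"
  then obtain M where M: "M \<subseteq> edges_on E y U" "finite M" "card M = k" "pairwise disjnt M" "\<Union> M \<subseteq> S"
    by (auto simp: has_matching_def)
  show "has_matching (edges_on E y U') (k - 1) S"
  proof (cases "\<exists>e\<in>M. x \<in> e")
    case True
    then obtain e where e: "e \<in> M" "x \<in> e" by blast
    have "M - {e} \<subseteq> edges_on E y U'"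
      using M(1) pairwise_disjnt_unique[OF M(4) e(1) _ e(2)] by (intro subsetI edges_on_deleteI) auto
    moreover have "card (M - {e}) = k - 1" using e M(2,3) by simp
    ultimately show ?thesis
      unfolding has_matching_def using M by (intro exI[of _ "M - {e}"]) (auto intro: pairwise_subset)
  next
    case False
    hence "M \<subseteq> edges_on E y U'" using M(1) by (intro subsetI edges_on_deleteI) auto
    hence "has_matching (edges_on E y U') k S" using M(2-5) by (auto simp: has_matching_def)
    thus ?thesis by (rule has_matching_less) simp
  qed
next
  assume "has_matching (edges_on E y U') (k - 1) S"
  then obtain M where M: "M \<subseteq> edges_on E y U'" "finite M" "card M = k - 1" "pairwise disjnt M" "\<Union> M \<subseteq> S"
    by (auto simp: has_matching_def)
  have d: "disjnt {x, y x} e" if "e \<in> M" for e using M(1) edges_on_avoid that by (auto simp: disjnt_def)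
  have "{x, y x} \<notin> M" using d by (auto simp: disjnt_def)
  hence "card (insert {x, y x} M) = k" using M(2,3) k by simp
  moreover have "insert {x, y x} M \<subseteq> edges_on E y U"
    using M(1) edges_on_subset whisker[OF x_X] U by (auto simp: edges_on_def)
  moreover have "pairwise disjnt (insert {x, y x} M)"
    using M(4) d by (auto simp: pairwise_insert disjnt_sym)
  ultimately show "has_matching (edges_on E y U) k S"
    unfolding has_matching_def using M(2,5) S by (intro exI[of _ "insert {x, y x} M"]) auto
qed

lemma base_neighbour:
  assumes "e \<in> edges_on E y U" "x \<in> e" "y x \<notin> e"
  obtains z where "z \<in> U'" "e = {x, z}"
proof -
  have e: "e \<in> E" "e \<subseteq> U \<union> y ` U" using assms(1) by (auto simp: edges_on_def)
  obtain z where z: "e = {x, z}" "z \<noteq> x" using simple_graph_edge[OF simple e(1) assms(2)] by metis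
  have "z \<in> U"
  proof (rule ccontr)
    assume "z \<notin> U"
    then obtain u where u: "u \<in> U" "z = y u" using e(2) z by auto
    have "e = {u, y u}" using u U e(1) z by (intro pendant) auto
    moreover have "x \<noteq> y u" using u U y_neq(2)[of u x] by blast
    ultimately show False using assms(3) z u by (auto simp: doubleton_eq_iff)
  qed
  thus ?thesis using z that by (auto simp: U'_def)
qed

lemma has_matching_isolated:
  assumes S: "y x \<notin> S" and no: "\<And>z. z \<in> U' \<Longrightarrow> {x, z} \<notin> E"
  shows "has_matching (edges_on E y U) k S \<longleftrightarrow> has_matching (edges_on E y U') k S"
proof
  assume "has_matching (edges_on E y U) k S"
  then obtain M where M: "M \<subseteq> edges_on E y U" "finite M" "card M = k" "pairwise disjnt M" "\<Union> M \<subseteq> S"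
    by (auto simp: has_matching_def)
  have "x \<notin> e" if "e \<in> M" for e
  proof
    assume "x \<in> e"
    moreover have "y x \<notin> e" "e \<in> edges_on E y U" using that M(1,5) S by auto
    ultimately obtain z where "z \<in> U'" "e = {x, z}" using base_neighbour by blast
    thus False using no \<open>e \<in> edges_on E y U\<close> by (auto simp: edges_on_def)
  qed
  hence "M \<subseteq> edges_on E y U'" using M(1) by (intro subsetI edges_on_deleteI) auto
  thus "has_matching (edges_on E y U') k S" using M(2-5) by (auto simp: has_matching_def)
qed (rule has_matching_delete_subset)

text \<open>Without its whisker, \<open>x\<close> is a second leaf at its only neighbour \<open>z\<close>, and so plays the same role
  as \<open>y z\<close>.\<close>

lemma has_matching_leaf:
  assumes S: "x \<in> S" "y x \<notin> S" and z: "z \<in> U'" "{x, z} \<in> E"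
    and unique: "\<And>z'. z' \<in> U' \<Longrightarrow> {x, z'} \<in> E \<Longrightarrow> z' = z"
  shows "has_matching (edges_on E y U) k S \<longleftrightarrow> has_matching (edges_on E y U') k (insert (y z) S)"
proof
  have zX: "z \<in> X" "z \<noteq> x" using z(1) U by (auto simp: U'_def)
  \<comment> \<open>Trades an edge of a matching for one disjoint from all the others; applied in
    one direction to replace \<open>{x, z}\<close> by \<open>{z, y z}\<close> and in the other to
    undo this.\<close>
  have exchange: "card (insert f (M - {e})) = k \<and> pairwise disjnt (insert f (M - {e}))"
    if "finite M" "card M = k" "pairwise disjnt M" "e \<in> M" "\<And>g. g \<in> M - {e} \<Longrightarrow> disjnt f g" "f \<noteq> {}"
    for M :: "'v set set" and e f k
  proof
    have "f \<notin> M - {e}" using that(5)[of f] that(6) by (auto simp: disjnt_def)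
    hence "card (insert f (M - {e})) = Suc (card (M - {e}))" using that(1) by simp
    thus "card (insert f (M - {e})) = k" using card_Suc_Diff1[OF that(1,4)] that(2) by simp
    show "pairwise disjnt (insert f (M - {e}))"
      using that(3,5) by (auto simp: pairwise_insert disjnt_sym intro: pairwise_subset)
  qed
  {
    assume "has_matching (edges_on E y U) k S"
    then obtain M where M: "M \<subseteq> edges_on E y U" "finite M" "card M = k" "pairwise disjnt M" "\<Union> M \<subseteq> S"
      by (auto simp: has_matching_def)
    show "has_matching (edges_on E y U') k (insert (y z) S)"
    proof (cases "\<exists>e\<in>M. x \<in> e")
      case True
      then obtain e where e: "e \<in> M" "x \<in> e" by blast
      have "y x \<notin> e" "e \<in> edges_on E y U" using e M(1,5) S by auto
      then obtain z' where z': "z' \<in> U'" "e = {x, z'}" using base_neighbour e(2) by blast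
      hence "z' = z" using \<open>e \<in> edges_on E y U\<close> by (intro unique) (auto simp: edges_on_def)
      hence ez: "e = {x, z}" using z' by simp
      have avoid: "x \<notin> g \<and> z \<notin> g" if "g \<in> M - {e}" for g
        using pairwise_disjnt_unique[OF M(4) e(1), of g] that ez by auto
      have d: "disjnt {z, y z} g" if "g \<in> M - {e}" for g
      proof -
        have "g \<in> E" using that M(1) by (auto simp: edges_on_def)
        hence "y z \<notin> g" using pendant[OF zX(1), of g] avoid[OF that] by auto
        thus ?thesis using avoid[OF that] by (auto simp: disjnt_def)
      qed
      have "M - {e} \<subseteq> edges_on E y U'" using M(1) avoid by (intro subsetI edges_on_deleteI) auto
      moreover have "{z, y z} \<in> edges_on E y U'" using whisker[OF zX(1)] z(1) by (auto simp: edges_on_def)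
      moreover have "z \<in> S" using e(1) ez M(5) by auto
      ultimately show ?thesis
        unfolding has_matching_def
        using exchange[OF M(2-4) e(1) d] M(2,5) by (intro exI[of _ "insert {z, y z} (M - {e})"]) auto
    next
      case False
      hence "M \<subseteq> edges_on E y U'" using M(1) by (intro subsetI edges_on_deleteI) auto
      thus ?thesis unfolding has_matching_def using M(2-5) by (intro exI[of _ M]) auto
    qed
  next
    assume "has_matching (edges_on E y U') k (insert (y z) S)"
    then obtain M where M: "M \<subseteq> edges_on E y U'" "finite M" "card M = k" "pairwise disjnt M"
      "\<Union> M \<subseteq> insert (y z) S" by (auto simp: has_matching_def)
    have MU: "M \<subseteq> edges_on E y U" using M(1) edges_on_subset by blast
    show "has_matching (edges_on E y U) k S"
    proof (cases "\<exists>e\<in>M. y z \<in> e")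
      case True
      then obtain e where e: "e \<in> M" "y z \<in> e" by blast
      have ez: "e = {z, y z}" using e M(1) by (intro pendant[OF zX(1)]) (auto simp: edges_on_def)
      have avoid: "x \<notin> g \<and> z \<notin> g \<and> y z \<notin> g" if "g \<in> M - {e}" for g
        using M(1) pairwise_disjnt_unique[OF M(4) e(1), of g] that ez edges_on_avoid[of g] by auto
      have d: "disjnt {x, z} g" if "g \<in> M - {e}" for g
        using avoid[OF that] by (auto simp: disjnt_def)
      have "{x, z} \<in> edges_on E y U" using z U by (auto simp: edges_on_def U'_def)
      moreover have "z \<in> S" using e(1) ez M(5) zX by auto
      moreover have "\<Union> (M - {e}) \<subseteq> S" using M(5) avoid by blast
      ultimately show ?thesis
        unfolding has_matching_def
        using exchange[OF M(2-4) e(1) d] M(2) MU S(1)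
        by (intro exI[of _ "insert {x, z} (M - {e})"]) auto
    next
      case False
      hence "\<Union> M \<subseteq> S" using M(5) by blast
      thus ?thesis unfolding has_matching_def using M(2-4) MU by (intro exI[of _ M]) auto
    qed
  }
qed

end

end

section \<open>A regular sequence for whiskered forests\<close>

lemma mono_meets: "mono (\<lambda>S. S \<inter> N \<noteq> {})"
  by (auto simp: mono_def)

text \<open>Modulo the variables in \<open>N\<close> the polynomials are distinct remaining
  variables. Each of them is regular, and adding it merely enlarges \<open>N\<close>.\<close>

lemma regs_coordinates:
  fixes p :: "'i \<Rightarrow> ('v, 'k::field) mpoly"
  assumes "distinct ns" "inj_on f (set ns)"
    and "\<And>i. i \<in> set ns \<Longrightarrow> p i \<in> vpoly V" "\<And>i. i \<in> set ns \<Longrightarrow> f i \<in> V - N"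
    and "\<And>i. i \<in> set ns \<Longrightarrow> p i - Var (f i) \<in> sqideal V (\<lambda>S. S \<inter> N \<noteq> {})"
  shows "regs V (sqideal V (\<lambda>S. S \<inter> N \<noteq> {})) (map p ns)"
  using assms
proof (induction ns arbitrary: N)
  case (Cons i ns)
  let ?I = "sqideal V (\<lambda>S. S \<inter> N \<noteq> {}) :: ('v, 'k) mpoly set"
  let ?I' = "sqideal V (\<lambda>S. S \<inter> insert (f i) N \<noteq> {}) :: ('v, 'k) mpoly set"
  have I: "pideal V ?I" by (rule pideal_sqideal[OF mono_meets])
  have p: "p i \<in> vpoly V" "p i - Var (f i) \<in> ?I" and fi: "f i \<in> V" "f i \<notin> N"
    using Cons.prems by auto
  have "a \<in> ?I" if a: "a \<in> vpoly V" "p i * a \<in> ?I" for a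
  proof -
    have "p i * a - Var (f i) * a \<in> ?I"
      using pidealD(5)[OF I a(1) p(2)] by (simp add: left_diff_distrib)
    hence "xmon {f i} * a \<in> ?I" using pideal_congD[OF I] a(2) by (auto simp: Var_eq_xmon)
    thus ?thesis using fi a(1) by (simp add: xmon_mult_in_sqideal)
  qed
  moreover have "iadd V ?I (p i) = ?I'"
  proof -
    have "iadd V ?I (p i) = iadd V ?I (xmon {f i})"
      using p fi by (intro iadd_cong[OF I]) (auto simp: Var_eq_xmon)
    also have "\<dots> = sqideal V (\<lambda>S. S \<inter> N \<noteq> {} \<or> {f i} \<subseteq> S)"
      using fi by (intro iadd_sqideal_xmon mono_meets) auto
    also have "\<dots> = ?I'" by (rule sqideal_cong) auto
    finally show ?thesis .
  qed
  moreover have "regs V ?I' (map p ns)"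
  proof (rule Cons.IH)
    show "p j - Var (f j) \<in> ?I'" if "j \<in> set ns" for j
      using Cons.prems(5)[of j] that sqideal_mono[of V "\<lambda>S. S \<inter> N \<noteq> {}" "\<lambda>S. S \<inter> insert (f i) N \<noteq> {}"]
      by auto
  qed (use Cons.prems in \<open>auto simp: inj_on_def\<close>)
  ultimately show ?case by simp
qed simp

lemma xmon_in_irrelevant_ideal:
  assumes "finite W" "W \<subseteq> V" "W \<noteq> {}"
  shows "xmon W \<in> irrelevant_ideal V"
proof -
  obtain w where w: "w \<in> W" using assms(3) by blast
  have sub: "Var ` V \<subseteq> vpoly V" by auto
  have eq: "xmon W = xmon (W - {w}) * Var w"
    using w assms(1) xmon_Un[of "W - {w}" "{w}"] by (simp add: Var_eq_xmon insert_absorb)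
  thus ?thesis
    unfolding irrelevant_ideal_def eq
    using assms w Idl_self[OF sub] by (intro pidealD(4)[OF pideal_Idl[OF sub]] vpoly_xmon) auto
qed

section \<open>The explicit parameters and their regularity\<close>

context whiskered_forest
begin

definition pair_sym :: "nat \<Rightarrow> ('v, 'k::field) mpoly" where
  "pair_sym j = (\<Sum>A | A \<subseteq> X \<and> card A = j. xmon (A \<union> y ` A))"

text \<open>To be applied to the vertices that are not whisker ends: each pair then contributes one
  sum, and the second case takes care of the isolated vertices.\<close>

definition pair_sum :: "'v \<Rightarrow> ('v, 'k::field) mpoly" where
  "pair_sum v = (if v \<in> X then Var v + Var (y v) else Var v)"

definition params :: "'v list \<Rightarrow> nat \<Rightarrow> ('v, 'k::field) mpoly list" where
  "params vs r = map pair_sym (rev [1..<Suc r]) @ map pair_sum vs"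

lemma params_Suc: "params vs (Suc r) = pair_sym (Suc r) # params vs r"
  by (simp add: params_def)

lemma length_params: "length (params vs r) = r + length vs"
  by (simp add: params_def)

lemma params_irrelevant:
  assumes "set vs \<subseteq> V"
  shows "set (params vs r) \<subseteq> (irrelevant_ideal V :: ('v, 'k::field) mpoly set)"
proof -
  have sub: "(Var ` V :: ('v, 'k) mpoly set) \<subseteq> vpoly V" by auto
  note I = pideal_Idl[OF sub, folded irrelevant_ideal_def]
  have Var: "Var v \<in> (irrelevant_ideal V :: ('v, 'k) mpoly set)" if "v \<in> V" for v
    using Idl_self[OF sub] that by (auto simp: irrelevant_ideal_def)
  have "pair_sym j \<in> (irrelevant_ideal V :: ('v, 'k) mpoly set)" if "j \<ge> 1" for j
    unfolding pair_sym_def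
  proof (rule pideal_sum[OF I], rule xmon_in_irrelevant_ideal)
    fix A assume "A \<in> {A. A \<subseteq> X \<and> card A = j}"
    thus "finite (A \<union> y ` A)" "A \<union> y ` A \<subseteq> V" "A \<union> y ` A \<noteq> {}"
      using that finite_X X_sub y_sub by (auto intro: finite_subset)
  qed
  moreover have "pair_sum v \<in> (irrelevant_ideal V :: ('v, 'k) mpoly set)" if "v \<in> V" for v
    using that X_sub y_sub Var pidealD(3)[OF I] by (auto simp: pair_sum_def)
  ultimately show ?thesis using assms by (auto simp: params_def)
qed

text \<open>Modulo the variables in \<open>N\<close>, the polynomial \<open>pair_sym r\<close> becomes the product of all variables
  of the \<open>r\<close> pairs that avoid \<open>N\<close>; killing any one of these variables leaves \<open>r - 1\<close> such pairs.
  Once no pair avoids \<open>N\<close>, the remaining parameters are the remaining variables.\<close>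

lemma regs_params_prime:
  assumes vs: "set vs = V - y ` X" "distinct vs"
    and "N \<subseteq> X \<union> y ` X" "\<And>x. x \<in> X \<Longrightarrow> x \<notin> N \<or> y x \<notin> N"
    and "card {x \<in> X. x \<notin> N \<and> y x \<notin> N} = r"
  shows "regs V (sqideal V (\<lambda>S. S \<inter> N \<noteq> {})) (params vs r :: ('v, 'k::field) mpoly list)"
  using assms(3-)
proof (induction r arbitrary: N)
  case 0
  let ?I = "sqideal V (\<lambda>S. S \<inter> N \<noteq> {}) :: ('v, 'k) mpoly set"
  have N: "x \<in> N \<or> y x \<in> N" if "x \<in> X" for x using 0(3) that finite_X by auto
  have Var: "Var v \<in> ?I" if "v \<in> N" for v
  proof -
    have "v \<in> V" using that 0(1) X_sub y_sub by auto
    thus ?thesis using that by (simp add: Var_eq_xmon xmon_in_sqideal)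
  qed
  have zero: "0 \<in> ?I" by (rule pidealD(2)[OF pideal_sqideal[OF mono_meets]])
  \<comment> \<open>Now exactly one end of every pair lies in \<open>N\<close>, and the sum over the
    pair reduces to the variable of the other end.\<close>
  define f where "f = (\<lambda>v. if v \<in> X \<and> v \<in> N then y v else v)"
  have "regs V ?I (map pair_sum vs)"
  proof (rule regs_coordinates[where f = f])
    show "inj_on f (set vs)"
      using y_eq_iff unfolding vs(1) f_def by (intro inj_onI) (auto split: if_splits)
    fix v assume v: "v \<in> set vs"
    show "pair_sum v \<in> vpoly V" using v vs(1) y_sub by (auto simp: pair_sum_def)
    show "f v \<in> V - N"
      using v vs(1) y_sub 0(1) 0(2)[of v] by (auto simp: f_def)
    show "pair_sum v - Var (f v) \<in> ?I"
      using N[of v] Var[of v] Var[of "y v"] zero by (auto simp: pair_sum_def f_def)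
  qed (rule vs(2))
  thus ?case by (simp add: params_def)
next
  case (Suc r)
  let ?I = "sqideal V (\<lambda>S. S \<inter> N \<noteq> {}) :: ('v, 'k) mpoly set"
  have I: "pideal V ?I" by (rule pideal_sqideal[OF mono_meets])
  define A where "A = {x \<in> X. x \<notin> N \<and> y x \<notin> N}"
  define W where "W = A \<union> y ` A"
  have A: "A \<subseteq> X" "card A = Suc r" using Suc.prems(3) by (auto simp: A_def)
  have finA: "finite A" using A(1) finite_X by (rule finite_subset)
  have W: "finite W" "W \<subseteq> V" "W \<inter> N = {}"
    using finA A(1) X_sub y_sub by (auto simp: W_def A_def)
  have xm: "xmon (B \<union> y ` B) \<in> (vpoly V :: ('v, 'k) mpoly set)" if "B \<subseteq> X" for B
    using that finite_X X_sub y_sub by (intro vpoly_xmon) (auto intro: finite_subset)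
  \<comment> \<open>Any other index set \<open>B\<close> has the size of \<open>A\<close>, so it
    contains a vertex outside \<open>A\<close>; the pair of that vertex meets \<open>N\<close>, and
    the monomial of \<open>B\<close> vanishes.\<close>
  have cong: "pair_sym (Suc r) - xmon W \<in> ?I"
  proof -
    have fin: "finite {B. B \<subseteq> X \<and> card B = Suc r}" using finite_X by auto
    have "pair_sym (Suc r) = xmon W + (\<Sum>B\<in>{B. B \<subseteq> X \<and> card B = Suc r} - {A}. xmon (B \<union> y ` B) :: ('v, 'k) mpoly)"
      unfolding pair_sym_def W_def using A fin by (subst sum.remove[of _ A]) auto
    moreover have "(\<Sum>B\<in>{B. B \<subseteq> X \<and> card B = Suc r} - {A}. xmon (B \<union> y ` B)) \<in> ?I"
    proof (rule pideal_sum[OF I])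
      fix B assume B: "B \<in> {B. B \<subseteq> X \<and> card B = Suc r} - {A}"
      have "\<not> B \<subseteq> A" using B A finA card_subset_eq[of A B] by auto
      then obtain x where "x \<in> B" "x \<in> N \<or> y x \<in> N" using B by (auto simp: A_def)
      moreover have "finite (B \<union> y ` B)" "B \<union> y ` B \<subseteq> V"
        using B finite_X X_sub y_sub by (auto intro: finite_subset)
      ultimately show "xmon (B \<union> y ` B) \<in> ?I" by (subst xmon_in_sqideal) auto
    qed
    ultimately show ?thesis by simp
  qed
  have ps: "pair_sym (Suc r) \<in> (vpoly V :: ('v, 'k) mpoly set)"
    unfolding pair_sym_def by (intro vpoly_sum xm) auto
  have "a \<in> ?I" if a: "a \<in> vpoly V" "pair_sym (Suc r) * a \<in> ?I" for a
  proof -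
    have "pair_sym (Suc r) * a - xmon W * a \<in> ?I"
      using pidealD(5)[OF I a(1) cong] by (simp add: left_diff_distrib)
    hence "xmon W * a \<in> ?I" using pideal_congD[OF I] a(2) by blast
    hence "a \<in> sqideal V (\<lambda>S. (W \<union> S) \<inter> N \<noteq> {})" using W a(1) by (simp add: xmon_mult_in_sqideal)
    thus ?thesis using W(3) by (simp add: Int_Un_distrib2)
  qed
  moreover have "iadd V ?I (pair_sym (Suc r)) = sqideal V (\<lambda>S. S \<inter> N \<noteq> {} \<or> W \<subseteq> S)"
    using iadd_cong[OF I ps _ cong] W iadd_sqideal_xmon[OF mono_meets W(1,2), of N] by simp
  \<comment> \<open>The generator \<open>xmon W\<close> is resolved one variable at a time,
    \<open>Y\<close> being the factor still present. The colon by \<open>v\<close> strikes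
    \<open>v\<close> out of the product, down to the unit ideal for empty \<open>Y\<close>; adding
    \<open>v\<close> instead puts it into \<open>N\<close>, which spoils one pair and reduces
    \<open>r\<close> by one.\<close>
  moreover have "regs V (sqideal V (\<lambda>S. S \<inter> N \<noteq> {} \<or> Y \<subseteq> S)) (params vs r :: ('v, 'k) mpoly list)"
    if "Y \<subseteq> W" for Y
    using finite_subset[OF that W(1)] that
  proof (induction Y rule: finite_induct)
    case empty
    have "sqideal V (\<lambda>S. S \<inter> N \<noteq> {} \<or> {} \<subseteq> S) = (vpoly V :: ('v, 'k) mpoly set)"
      by (auto simp: sqideal_def)
    thus ?case using params_irrelevant[of vs r] irrelevant_ideal_subset[of V] vs(1)
      by (auto intro!: regs_carrier)
  next
    case (insert v Y)
    have v: "v \<in> W" "v \<in> V" "v \<notin> N" using insert.prems W by auto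
    show ?case
    proof (rule regs_sqideal_split[where v = v])
      show "mono (\<lambda>S. S \<inter> N \<noteq> {} \<or> insert v Y \<subseteq> S)" by (auto simp: mono_def)
      show "set (params vs r) \<subseteq> (vpoly V :: ('v, 'k) mpoly set)"
        using params_irrelevant[of vs r] irrelevant_ideal_subset[of V] vs(1) by blast
      have "sqideal V (\<lambda>S. insert v S \<inter> N \<noteq> {} \<or> insert v Y \<subseteq> insert v S) =
          (sqideal V (\<lambda>S. S \<inter> N \<noteq> {} \<or> Y \<subseteq> S) :: ('v, 'k) mpoly set)"
        using v(3) insert.hyps(2) by (intro sqideal_cong) auto
      thus "regs V (sqideal V (\<lambda>S. insert v S \<inter> N \<noteq> {} \<or> insert v Y \<subseteq> insert v S))
          (params vs r :: ('v, 'k) mpoly list)"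
        using insert by simp
      have eq: "sqideal V (\<lambda>S. (S \<inter> N \<noteq> {} \<or> insert v Y \<subseteq> S) \<or> v \<in> S) =
          (sqideal V (\<lambda>S. S \<inter> insert v N \<noteq> {}) :: ('v, 'k) mpoly set)"
        by (intro sqideal_cong) auto
      obtain x where x: "x \<in> A" "v = x \<or> v = y x" using v(1) by (auto simp: W_def)
      have xX: "x \<in> X" using x(1) A(1) by blast
      show "regs V (sqideal V (\<lambda>S. (S \<inter> N \<noteq> {} \<or> insert v Y \<subseteq> S) \<or> v \<in> S))
          (params vs r :: ('v, 'k) mpoly list)"
        unfolding eq
      proof (rule Suc.IH)
        show "insert v N \<subseteq> X \<union> y ` X" using x xX Suc.prems(1) by auto
        show "z \<notin> insert v N \<or> y z \<notin> insert v N" if "z \<in> X" for z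
          using that x xX y_eq_iff[OF that xX] y_notin[OF that] y_notin[OF xX] Suc.prems(2)[OF that] by (auto simp: A_def)
        have "{z \<in> X. z \<notin> insert v N \<and> y z \<notin> insert v N} = A - {x}"
          using x xX by (auto simp: A_def y_eq_iff dest: y_notin)
        thus "card {z \<in> X. z \<notin> insert v N \<and> y z \<notin> insert v N} = r"
          using x(1) A(2) finA by simp
      qed
    qed (rule v(2))
  qed
  ultimately show ?case by (simp add: params_Suc)
qed

text \<open>The induction removes a leaf \<open>x\<close> of the base forest: \<open>N\<close> collects the variables set to zero,
  \<open>T\<close> those with respect to which a colon ideal is taken, and every pair outside \<open>U\<close> that avoids
  \<open>N\<close> has already contributed one edge.\<close>

lemma regs_params_matching:
  assumes vs: "set vs = V - y ` X" "distinct vs"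
    and "U \<subseteq> X" "N \<subseteq> X \<union> y ` X" "N \<inter> (U \<union> y ` U) = {}" "\<And>x. x \<in> X \<Longrightarrow> x \<notin> N \<or> y x \<notin> N"
    and "k \<le> Suc (card U)" "card {x \<in> X - U. x \<notin> N \<and> y x \<notin> N} + k = Suc r"
  shows "regs V (sqideal V (\<lambda>S. S \<inter> N \<noteq> {} \<or> has_matching (edges_on E y U) k (S \<union> T)))
    (params vs r :: ('v, 'k::field) mpoly list)"
  using assms(3-)
proof (induction "card U" arbitrary: U N k T rule: less_induct)
  case less
  let ?\<Psi> = "\<lambda>N U k T S. S \<inter> N \<noteq> {} \<or> has_matching (edges_on E y U) k (S \<union> T)"
  let ?R = "\<lambda>\<Phi>. regs V (sqideal V \<Phi>) (params vs r :: ('v, 'k) mpoly list)"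
  have finU: "finite U" using less.prems(1) finite_X by (rule finite_subset)
  have fs: "set (params vs r) \<subseteq> (vpoly V :: ('v, 'k) mpoly set)"
    using params_irrelevant[of vs r] irrelevant_ideal_subset[of V] vs(1) by blast
  have mono: "mono (?\<Psi> N U k T)" for T
    by (rule monoI) (auto intro: has_matchingD)
  have cong: "?R \<Phi>" if "?R \<Phi>'" "\<And>S. \<Phi> S = \<Phi>' S" for \<Phi> \<Phi>'
    using that by presburger
  \<comment> \<open>For \<open>k = 0\<close> the ideal is the unit ideal. For
    \<open>k = Suc (card U)\<close> no matching is large enough, only the variables in
    \<open>N\<close> generate, and the numerical hypothesis says that exactly \<open>r\<close> pairs
    avoid \<open>N\<close>. In between, a leaf of the base forest on \<open>U\<close> is
    removed.\<close>
  consider "k = 0" | "k = Suc (card U)" | "1 \<le> k" "k \<le> card U" using less.prems(5) by linarith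
  thus ?case
  proof cases
    case 1
    have "has_matching (edges_on E y U) 0 S" for S
      unfolding has_matching_def by (intro exI[of _ "{}"]) auto
    hence "sqideal V (?\<Psi> N U k T) = (vpoly V :: ('v, 'k) mpoly set)"
      using 1 by (auto simp: sqideal_def)
    thus ?thesis using regs_carrier[OF fs] by simp
  next
    case 2
    have no: "\<not> has_matching (edges_on E y U) k S" for S
      using has_matching_le_card[OF less.prems(1), of k S] 2 by auto
    have "{x \<in> X. x \<notin> N \<and> y x \<notin> N} = U \<union> {x \<in> X - U. x \<notin> N \<and> y x \<notin> N}"
      using less.prems(1,3) by auto
    moreover have "card (U \<union> {x \<in> X - U. x \<notin> N \<and> y x \<notin> N}) =
        card U + card {x \<in> X - U. x \<notin> N \<and> y x \<notin> N}"
      using finU finite_X by (intro card_Un_disjoint) auto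
    ultimately have "card {x \<in> X. x \<notin> N \<and> y x \<notin> N} = r" using less.prems(6) 2 by simp
    from regs_params_prime[OF vs less.prems(2,4) this, where ?'k = 'k] show ?thesis by (simp add: no)
  next
    case 3
    hence "U \<noteq> {}" by auto
    then obtain x where x: "x \<in> U" "\<And>z z'. z \<in> U \<Longrightarrow> z' \<in> U \<Longrightarrow> {x, z} \<in> E \<Longrightarrow> {x, z'} \<in> E \<Longrightarrow> z = z'"
      using forest_leaf[OF forest finU] by metis
    define U' where "U' = U - {x}"
    note ctx = less.prems(1) x(1) U'_def
    have xX: "x \<in> X" using ctx by blast
    have xN: "x \<notin> N" "y x \<notin> N" using less.prems(3) x(1) by auto
    have cU': "card U' < card U" "Suc (card U') = card U"
      using finU x(1) card_Suc_Diff1[OF finU x(1)] by (auto simp: U'_def)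
    have U'X: "U' \<subseteq> X" using ctx by auto
    have NU': "N \<inter> (U' \<union> y ` U') = {}" using less.prems(3) by (auto simp: U'_def)
    have avoid: "x \<notin> U' \<union> y ` U'" "y x \<notin> U' \<union> y ` U'"
    proof -
      show "x \<notin> U' \<union> y ` U'" using y_notin less.prems(1) xX by (auto simp: U'_def)
      have "y x \<noteq> y u" if "u \<in> U'" for u using that y_eq_iff[OF xX, of u] U'X by (auto simp: U'_def)
      thus "y x \<notin> U' \<union> y ` U'" using y_notin[OF xX] U'X by auto
    qed
    have XU': "X - U' = insert x (X - U)" "x \<notin> X - U" using ctx by auto
    have count: "card {z \<in> X - U'. z \<notin> N \<and> y z \<notin> N} = Suc (card {z \<in> X - U. z \<notin> N \<and> y z \<notin> N})"
    proof -
      have "{z \<in> X - U'. z \<notin> N \<and> y z \<notin> N} = insert x {z \<in> X - U. z \<notin> N \<and> y z \<notin> N}"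
        using XU'(1) xN by auto
      thus ?thesis using XU'(2) finite_X by simp
    qed
    \<comment> \<open>With one end set to zero, the pair leaves \<open>U\<close> without counting
      among those that avoid \<open>N\<close>, so \<open>k\<close> is kept. \<open>T\<close> is
      arbitrary because the leaf exchange below changes it.\<close>
    have kill: "?R (?\<Psi> (insert v N) U' k T)" if v: "v = x \<or> v = y x" for v T
    proof (rule less.hyps[OF cU'(1) U'X])
      show "insert v N \<subseteq> X \<union> y ` X" using v xX less.prems(2) by auto
      show "insert v N \<inter> (U' \<union> y ` U') = {}" using v avoid NU' by auto
      show "z \<notin> insert v N \<or> y z \<notin> insert v N" if "z \<in> X" for z
        using v that xX xN y_eq_iff[OF that xX] y_notin[OF that] y_notin[OF xX] less.prems(4)[OF that] by auto
      show "k \<le> Suc (card U')" using 3 cU' by simp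
      have "z \<noteq> v" "y z \<noteq> v" if "z \<in> X - U" for z
        using that v xX x(1) y_eq_iff[of z x] y_notin[of z] y_notin[of x] by auto
      hence "{z \<in> X - U'. z \<notin> insert v N \<and> y z \<notin> insert v N} = {z \<in> X - U. z \<notin> N \<and> y z \<notin> N}"
        unfolding XU'(1) using v by blast
      thus "card {z \<in> X - U'. z \<notin> insert v N \<and> y z \<notin> insert v N} + k = Suc r"
        using less.prems(6) by simp
    qed
    \<comment> \<open>With both ends divided out, the whisker is available for every
      \<open>S\<close>: \<open>k\<close> drops by one while one more pair outside \<open>U\<close>
      avoids \<open>N\<close>, and the sum is unchanged.\<close>
    have both: "?R (?\<Psi> N U k T)" if T: "x \<in> T" "y x \<in> T" for T
    proof (rule cong)
      show "?R (?\<Psi> N U' (k - 1) T)"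
        using less.prems 3 cU' count by (intro less.hyps[OF cU'(1) U'X _ NU']) auto
      show "?\<Psi> N U k T S = ?\<Psi> N U' (k - 1) T S" for S
        using has_matching_pair[OF ctx, of "S \<union> T" k] T 3 by auto
    qed
    have one: "?R (?\<Psi> N U k T)" if T: "x \<in> T" for T
    proof (cases "y x \<in> T")
      case False
      show ?thesis
      proof (rule regs_sqideal_split[OF mono y_sub[OF xX] fs])
        show "?R (\<lambda>S. ?\<Psi> N U k T (insert (y x) S))"
          by (rule cong, rule both[of "insert (y x) T"]) (use T xN in auto)
        \<comment> \<open>Once \<open>y x\<close> is zero, \<open>x\<close> can be matched only with
          its single neighbour \<open>z\<close>, which the whisker at \<open>z\<close> imitates if
          \<open>y z\<close> is added to \<open>T\<close>. Without a neighbour \<open>x\<close> is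
          useless and \<open>T\<close> stays.\<close>
        obtain T' where T': "\<And>S. y x \<notin> S \<Longrightarrow>
            has_matching (edges_on E y U) k (S \<union> T) = has_matching (edges_on E y U') k (S \<union> T')"
        proof (cases "\<exists>z\<in>U'. {x, z} \<in> E")
          case True
          then obtain z where z: "z \<in> U'" "{x, z} \<in> E" by blast
          have unique: "z' = z" if "z' \<in> U'" "{x, z'} \<in> E" for z'
            using x(2)[of z' z] z that by (auto simp: U'_def)
          have "has_matching (edges_on E y U) k (S \<union> T) =
              has_matching (edges_on E y U') k (insert (y z) (S \<union> T))" if "y x \<notin> S" for S
            by (rule has_matching_leaf[OF ctx _ _ z unique]) (use that T False in auto)
          thus ?thesis using that[of "insert (y z) T"] by simp
        next
          case no: False
          hence "has_matching (edges_on E y U) k (S \<union> T) = has_matching (edges_on E y U') k (S \<union> T)"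
            if "y x \<notin> S" for S
            using that False by (intro has_matching_isolated[OF ctx]) auto
          thus ?thesis using that[of T] by simp
        qed
        show "?R (\<lambda>S. ?\<Psi> N U k T S \<or> y x \<in> S)"
          by (rule cong, rule kill[of "y x" T']) (use T' in auto)
      qed
    qed (use both T in blast)
    show ?thesis
    proof (cases "x \<in> T")
      case False
      show ?thesis
      proof (rule regs_sqideal_split[OF mono subsetD[OF X_sub xX] fs])
        show "?R (\<lambda>S. ?\<Psi> N U k T (insert x S))"
          by (rule cong, rule one[of "insert x T"]) (use xN in auto)
        have "has_matching (edges_on E y U) k (S \<union> T) = has_matching (edges_on E y U') k (S \<union> T)"
          if "x \<notin> S" for S
          using that False by (intro has_matching_delete[OF ctx]) auto
        thus "?R (\<lambda>S. ?\<Psi> N U k T S \<or> x \<in> S)"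
          by (intro cong[OF kill[of x T]]) auto
      qed
    qed (rule one)
  qed
qed

text \<open>The whiskers contained in \<open>S\<close> form a matching, so at most \<open>r\<close>
  base vertices are in \<open>A\<close>. A whisker end whose base vertex is missing from
  \<open>S\<close> is counted by that base vertex in \<open>B\<close>; all the rest then fits among
  the vertices that are not whisker ends.\<close>

lemma card_le_of_no_matching:
  assumes S: "S \<subseteq> V" "\<not> has_matching E (Suc r) S"
  shows "card S \<le> r + card (V - y ` X)"
proof -
  define A where "A = {x \<in> X. x \<in> S \<and> y x \<in> S}"
  define B where "B = {x \<in> X. x \<notin> S \<and> y x \<in> S}"
  have fin: "finite A" "finite B" "finite S"
    using finite_X finite_subset[OF S(1) finite_V] by (auto simp: A_def B_def)
  have "card A \<le> r"
  proof (rule ccontr)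
    assume *: "\<not> card A \<le> r"
    have "inj_on (\<lambda>x. {x, y x}) A"
      by (rule inj_onI) (auto simp: A_def doubleton_eq_iff)
    hence "card ((\<lambda>x. {x, y x}) ` A) = card A" by (rule card_image)
    moreover have "pairwise disjnt ((\<lambda>x. {x, y x}) ` A)"
      using y_eq_iff by (auto simp: pairwise_def disjnt_def A_def)
    ultimately have "has_matching E (card A) S"
      unfolding has_matching_def using fin whisker
      by (intro exI[of _ "(\<lambda>x. {x, y x}) ` A"]) (auto simp: A_def)
    thus False using has_matching_less[of E "card A" S "Suc r"] S(2) * by simp
  qed
  have "S = (S - y ` X) \<union> (y ` A \<union> y ` B)"
    by (auto simp: A_def B_def)
  hence "card S \<le> card (S - y ` X) + card (y ` A \<union> y ` B)" by (metis card_Un_le)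
  also have "card (y ` A \<union> y ` B) \<le> card A + card B"
    using card_Un_le[of "y ` A" "y ` B"] card_image_le[OF fin(1), of y] card_image_le[OF fin(2), of y] by linarith
  also have "card (S - y ` X) + (card A + card B) = card A + card ((S - y ` X) \<union> B)"
    using fin by (subst card_Un_disjoint) (auto simp: B_def)
  also have "card ((S - y ` X) \<union> B) \<le> card (V - y ` X)"
    using S(1) X_sub finite_V by (intro card_mono) (auto simp: B_def dest: y_notin)
  finally show ?thesis using \<open>card A \<le> r\<close> by simp
qed

theorem cohen_macaulay_sqideal_matching:
  assumes "k \<ge> 1"
  shows "cohen_macaulay_quotient V (sqideal V (has_matching E k) :: ('v, 'k::field) mpoly set)"
proof -
  \<comment> \<open>No matching has more than \<open>card X\<close> edges, so every \<open>k\<close>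
    above \<open>Suc (card X)\<close> gives the zero ideal just as \<open>Suc (card X)\<close> does,
    and \<open>k\<close> may be lowered to \<open>Suc r\<close>.\<close>
  define r where "r = min (k - 1) (card X)"
  have eq: "has_matching E k S \<longleftrightarrow> has_matching E (Suc r) S" for S
  proof (cases "k \<le> Suc (card X)")
    case True
    thus ?thesis using assms by (simp add: r_def)
  next
    case False
    thus ?thesis
      using has_matching_le_card[of X k S] has_matching_le_card[of X "Suc r" S]
      by (auto simp: edges_on_X r_def)
  qed
  obtain vs where vs: "set vs = V - y ` X" "distinct vs"
    using finite_distinct_list[of "V - y ` X"] finite_V by blast
  have "regs V (sqideal V (\<lambda>S. S \<inter> {} \<noteq> {} \<or> has_matching (edges_on E y X) (Suc r) (S \<union> {})))
      (params vs r :: ('v, 'k) mpoly list)"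
    by (rule regs_params_matching[OF vs]) (auto simp: r_def)
  hence "regs V (sqideal V (has_matching E (Suc r))) (params vs r :: ('v, 'k) mpoly list)"
    by (simp add: edges_on_X)
  moreover have "set (params vs r) \<subseteq> (irrelevant_ideal V :: ('v, 'k) mpoly set)"
    using vs(1) by (intro params_irrelevant) auto
  moreover have "\<not> has_matching E (Suc r) {}"
  proof
    assume "has_matching E (Suc r) {}"
    hence "has_matching E 1 {}" by (rule has_matching_less) simp
    hence "\<exists>e\<in>E. e \<subseteq> {}" by (simp only: has_matching_1)
    thus False using simple_graphD(4)[OF simple] by auto
  qed
  moreover have "card S \<le> length (params vs r :: ('v, 'k) mpoly list)"
    if "S \<subseteq> V" "\<not> has_matching E (Suc r) S" for S
    using card_le_of_no_matching[OF that] vs by (simp add: length_params flip: distinct_card)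
  ultimately have "cohen_macaulay_quotient V (sqideal V (has_matching E (Suc r)) :: ('v, 'k) mpoly set)"
    by (intro cohen_macaulayI[OF finite_V mono_has_matching])
  thus ?thesis using eq by presburger
qed

end

theorem corollary3p6:
  fixes V :: "'v set" and E :: "'v set set" and k :: nat
  assumes "forest V E"
    and "cohen_macaulay_graph TYPE('k::field) V E"
    and "k \<ge> 1"
  shows "cohen_macaulay_quotient V
           (squarefree_power V (edge_ideal V E :: ('v, 'k) mpoly set) k)"
proof -
  obtain X y where "whiskered V E X y"
    by (rule cohen_macaulay_forest_whiskered[OF assms(1,2)])
  then interpret whiskered_forest V E X y
    using assms(1) by unfold_locales
  show ?thesis
    unfolding squarefree_power_edge_ideal[OF simple]
    by (rule cohen_macaulay_sqideal_matching[OF assms(3)])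
qed

end
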